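(* For each fixed integer $s \geq 3$, $f_s(n) = O(\sqrt{n}\,\log n)$ as $n \to \infty$.
   Context: For integers $s \geq 2$ and $n \geq 1$, the Erdős–Rogers function $f_s(n)$ is the maximum integer $m$ such that every $n$-vertex graph containing no complete graph $K_{s+1}$ has a set of $m$ vertices whose induced subgraph contains no $K_s$. *)

theory Defs
  imports Complex_Main "HOL-Library.Landau_Symbols"
begin

definition simple_graph :: "nat \<Rightarrow> (nat \<Rightarrow> nat \<Rightarrow> bool) \<Rightarrow> bool" where
  "simple_graph n E \<longleftrightarrow> (\<forall>u<n. \<forall>v<n. E u v \<longleftrightarrow> E v u) \<and> (\<forall>v<n. \<not> E v v)"

definition is_clique :: "(nat \<Rightarrow> nat \<Rightarrow> bool) \<Rightarrow> nat set \<Rightarrow> bool" where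
  "is_clique E K \<longleftrightarrow> (\<forall>u\<in>K. \<forall>v\<in>K. u \<noteq> v \<longrightarrow> E u v)"

definition Kfree :: "(nat \<Rightarrow> nat \<Rightarrow> bool) \<Rightarrow> nat set \<Rightarrow> nat \<Rightarrow> bool" where
  "Kfree E V k \<longleftrightarrow> \<not> (\<exists>K\<subseteq>V. card K = k \<and> is_clique E K)"

definition erdos_rogers :: "nat \<Rightarrow> nat \<Rightarrow> nat" where
  "erdos_rogers s n = Max {m. \<forall>E. simple_graph n E \<and> Kfree E {0..<n} (s + 1) \<longrightarrow>
       (\<exists>S\<subseteq>{0..<n}. card S = m \<and> Kfree E S s)}"

end

theory Submission
  imports Defs "HOL-Real_Asymp.Real_Asymp" "HOL-Library.FuncSet"
begin

text \<open>
  Fix about $C \sqrt n \log^2 n$ colours and let every vertex independently carry each colour with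
  probability $1 / (\sqrt n \log n)$, together with a random label below $s$. Processing the colours
  in order, join two vertices of a colour with different labels unless this closes a $K_4$ that is not
  contained in one colour class. A clique of the resulting graph with at least four vertices lies in
  one colour class, hence has at most $s$ vertices.

  Let $S$ be a set of order $\sqrt n \log n$ vertices. Given the earlier colours, the next colour
  creates a $K_s$ inside $S$ with probability bounded away from zero, provided that only a small
  proportion of the pairs in $S$ is blocked. So $S$ survives all colours with probability less than
  $n^{-2 |S|}$, and a union bound over $S$ applies.

  The crux is that no set $S$ contains many blocked pairs. On average a proportion of order
  $1 / \log n$ of the pairs is blocked, mostly by fans: a vertex joined to three vertices of one colour.
  That every $S$ behaves well follows from entropy estimates for the incidences between sets of
  vertices and sets of colours.
\<close>

section \<open>The coloured graph\<close>

text \<open>With \<open>B\<close> about sqrt(n) log n and \<open>m\<close> about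
  \<open>B / 4\<close>, a colour meets a fixed \<open>m\<close>-set in a bounded number of vertices
  on average, so it can complete a K_s there with constant probability \<open>c0\<close>. With
  \<open>C = 2 / c0\<close>, the roughly \<open>C * B * log n\<close> colours all fail with
  probability about exp(-2 B log n), which beats the at most n^m choices of the set. The obstacle is
  that \<open>typical\<close> concerns the whole labelling, and conditioning on it would destroy the
  independence of later colours. The product estimate is therefore made only for runs whose past
  passes the test \<open>healthy\<close>, which reads earlier colours alone; \<open>typical\<close>
  then guarantees that the test never fails. Danger is computed from \<open>joined\<close>, which
  ignores labels and omitted edges. It thus depends on the colours only and grows with time, so a
  bound after all \<open>M\<close> colours covers every stage. Fans are charged to columns: vertices
  of the column in \<open>S\<close> times apexes in \<open>S\<close>. Apexes involve neighbourhoods,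
  which are unions of columns. Paying log n for each of their vertices would be ruinous, so a second
  entropy condition pays per column.\<close>

definition shares :: "(nat \<Rightarrow> 'v set) \<Rightarrow> nat \<Rightarrow> 'v \<Rightarrow> 'v \<Rightarrow> bool" where
  "shares A i x y \<longleftrightarrow> (\<exists>j<i. x \<in> A j \<and> y \<in> A j)"

text \<open>Pruning turns the columns into a linear hypergraph (\<open>prune_linear\<close>). The
  comparison is with the raw earlier columns, not with their pruned versions, so there is no
  recursion and column \<open>j\<close> is pruned using columns up to \<open>j\<close> only.\<close>

definition prune :: "(nat \<Rightarrow> 'v set) \<Rightarrow> nat \<Rightarrow> 'v set" where
  "prune A j = {x \<in> A j. \<forall>z\<in>A j. z \<noteq> x \<longrightarrow> \<not> shares A j x z}"

text \<open>An overestimate of adjacency: labels and suppressed edges are disregarded, which makes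
  it monotone in the stage and a function of the columns alone.\<close>

definition joined :: "(nat \<Rightarrow> 'v set) \<Rightarrow> nat \<Rightarrow> 'v \<Rightarrow> 'v \<Rightarrow> bool" where
  "joined A i x y \<longleftrightarrow> x \<noteq> y \<and> (\<exists>j<i. x \<in> prune A j \<and> y \<in> prune A j)"

text \<open>A new edge between \<open>x\<close> and \<open>y\<close> would close a $K_4$ over a joined pair of common
  neighbours; three vertices of one new column would close a $K_4$ with a common neighbour.\<close>
definition pair_danger :: "(nat \<Rightarrow> 'v set) \<Rightarrow> nat \<Rightarrow> 'v \<Rightarrow> 'v \<Rightarrow> bool" where
  "pair_danger A i x y \<longleftrightarrow>
     (\<exists>z w. joined A i x z \<and> joined A i x w \<and> joined A i y z \<and> joined A i y w \<and> joined A i z w)"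

definition triple_danger :: "(nat \<Rightarrow> 'v set) \<Rightarrow> nat \<Rightarrow> 'v \<Rightarrow> 'v \<Rightarrow> 'v \<Rightarrow> bool" where
  "triple_danger A i x y z \<longleftrightarrow> (\<exists>w. joined A i x w \<and> joined A i y w \<and> joined A i z w)"

text \<open>An edge is dropped as soon as any third vertex of the pruned column endangers it,
  whatever label that vertex has. This is harsher than avoiding a $K_4$ requires, but it lets labels
  enter only through \<open>c i x \<noteq> c i y\<close>.\<close>

definition edge_at :: "(nat \<Rightarrow> 'v set) \<Rightarrow> (nat \<Rightarrow> 'v \<Rightarrow> nat) \<Rightarrow> nat \<Rightarrow> 'v \<Rightarrow> 'v \<Rightarrow> bool" where
  "edge_at A c i x y \<longleftrightarrow> x \<in> prune A i \<and> y \<in> prune A i \<and> c i x \<noteq> c i y \<and> \<not> pair_danger A i x y \<and>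
     (\<forall>z\<in>prune A i. z \<noteq> x \<longrightarrow> z \<noteq> y \<longrightarrow> \<not> triple_danger A i x y z)"

definition edge :: "(nat \<Rightarrow> 'v set) \<Rightarrow> (nat \<Rightarrow> 'v \<Rightarrow> nat) \<Rightarrow> nat \<Rightarrow> 'v \<Rightarrow> 'v \<Rightarrow> bool" where
  "edge A c M x y \<longleftrightarrow> (\<exists>i<M. edge_at A c i x y)"

lemma prune_subset: "prune A j \<subseteq> A j"
  by (auto simp: prune_def)

lemma shares_mono: "shares A i x y \<Longrightarrow> i \<le> k \<Longrightarrow> shares A k x y"
  unfolding shares_def using order_less_le_trans by blast

lemma joined_mono: "joined A i x y \<Longrightarrow> i \<le> k \<Longrightarrow> joined A k x y"
  unfolding joined_def using order_less_le_trans by blast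

lemma joined_imp_shares: "joined A i x y \<Longrightarrow> shares A i x y"
  by (auto simp: joined_def shares_def prune_def)

lemma pair_danger_mono: "pair_danger A i x y \<Longrightarrow> i \<le> k \<Longrightarrow> pair_danger A k x y"
  unfolding pair_danger_def using joined_mono[of A i _ _ k] by blast

lemma pair_danger_sym: "pair_danger A i x y \<longleftrightarrow> pair_danger A i y x"
  unfolding pair_danger_def by blast

lemma triple_danger_mono: "triple_danger A i x y z \<Longrightarrow> i \<le> k \<Longrightarrow> triple_danger A k x y z"
  unfolding triple_danger_def using joined_mono[of A i _ _ k] by blast

lemma edge_at_sym: "edge_at A c i x y \<longleftrightarrow> edge_at A c i y x"
proof -
  have "triple_danger A i x y z \<longleftrightarrow> triple_danger A i y x z" for z
    unfolding triple_danger_def by blast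
  then show ?thesis
    unfolding edge_at_def using pair_danger_sym[of A i x y] by auto
qed

lemma edge_sym: "edge A c M x y \<longleftrightarrow> edge A c M y x"
  unfolding edge_def using edge_at_sym[of A c _ x y] by blast

lemma edge_irrefl: "\<not> edge A c M x x"
  by (auto simp: edge_def edge_at_def)

text \<open>Two vertices surviving the pruning of one column lie together in no other column in which one
  of them survives: the earlier of the two columns would have pruned a vertex of the later one.\<close>
lemma prune_linear:
  assumes "x \<in> prune A j" "y \<in> prune A j" "x \<in> A k" "y \<in> prune A k" "x \<noteq> y"
  shows "k = j"
proof (rule ccontr)
  assume "k \<noteq> j"
  then consider "k < j" | "j < k" by linarith
  then show False
  proof cases
    case 1
    then have "shares A j x y" using assms prune_subset[of A k] by (auto simp: shares_def)
    then show False using assms prune_subset[of A j] by (auto simp: prune_def)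
  next
    case 2
    then have "shares A k y x" using assms prune_subset[of A j] by (auto simp: shares_def)
    then show False using assms by (auto simp: prune_def)
  qed
qed

text \<open>Consider the last column contributing an edge inside \<open>K\<close>. Its labels admit
  at most \<open>s\<close> vertices of \<open>K\<close>, so some vertex lies outside and is attached
  by earlier edges only. Three vertices inside then form a dangerous triple; if only two are inside,
  two outside vertices make them a dangerous pair.\<close>

lemma edge_clique_free:
  assumes s: "s \<ge> 3" and lab: "\<And>i x. i < M \<Longrightarrow> x \<in> A i \<Longrightarrow> c i x < s"
    and K: "card K = s + 1" "\<And>x y. x \<in> K \<Longrightarrow> y \<in> K \<Longrightarrow> x \<noteq> y \<Longrightarrow> edge A c M x y"
  shows False
proof -
  have finK: "finite K" using K(1) card.infinite by force
  have "\<exists>x y. x \<in> K \<and> y \<in> K \<and> x \<noteq> y"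
  proof -
    have "\<not> card K \<le> Suc 0" using K(1) s by simp
    then show ?thesis using card_le_Suc0_iff_eq[OF finK] by blast
  qed
  then obtain x0 y0 where xy0: "x0 \<in> K" "y0 \<in> K" "x0 \<noteq> y0" by blast
  define I where "I = {i. i < M \<and> (\<exists>x\<in>K. \<exists>y\<in>K. x \<noteq> y \<and> edge_at A c i x y)}"
  have finI: "finite I" unfolding I_def by simp
  have neI: "I \<noteq> {}" using K(2)[OF xy0] xy0 unfolding I_def edge_def by blast
  define i where "i = Max I"
  have iI: "i \<in> I" and imax: "\<And>j. j \<in> I \<Longrightarrow> j \<le> i" using finI neI unfolding i_def by auto
  obtain x y where xy: "x \<in> K" "y \<in> K" "x \<noteq> y" "edge_at A c i x y" "i < M"
    using iI unfolding I_def by blast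
  define T where "T = K \<inter> prune A i"
  have xT: "x \<in> T" "y \<in> T" using xy unfolding T_def edge_at_def by auto
  \<comment> \<open>An edge between two vertices of \<open>T\<close> might a priori come from
    another column; linearity of the pruned columns rules this out.\<close>
  have inT: "edge_at A c i u v" if uvT: "u \<in> T" "v \<in> T" "u \<noteq> v" for u v
  proof -
    have uv: "u \<in> K" "v \<in> K" "u \<in> prune A i" "v \<in> prune A i" using uvT unfolding T_def by auto
    obtain j where j: "j < M" "edge_at A c j u v"
      using K(2)[OF uv(1,2) uvT(3)] unfolding edge_def by blast
    have "u \<in> prune A j" "v \<in> prune A j" using j unfolding edge_at_def by auto
    then have "i = j" using prune_linear[of u A j v i] uv uvT(3) prune_subset[of A i] by blast
    then show ?thesis using j by simp
  qed
  have outT: "joined A i u v" if uvK: "u \<in> K" "v \<in> K" "v \<notin> T" "u \<noteq> v" for u v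
  proof -
    obtain j where j: "j < M" "edge_at A c j u v"
      using K(2)[OF uvK(1,2,4)] unfolding edge_def by blast
    have "j \<in> I" using j uvK(1,2,4) unfolding I_def by blast
    then have "j \<le> i" by (rule imax)
    moreover have "j \<noteq> i" using j uvK unfolding T_def edge_at_def by auto
    ultimately have "j < i" by simp
    then show ?thesis using j uvK unfolding joined_def edge_at_def by auto
  qed
  have injT: "inj_on (c i) T" using inT unfolding inj_on_def edge_at_def by blast
  have "c i ` T \<subseteq> {..<s}" using lab[OF xy(5)] prune_subset[of A i] unfolding T_def by blast
  then have cT: "card T \<le> s" using card_inj_on_le[OF injT, of "{..<s}"] by simp
  have TK: "T \<subseteq> K" unfolding T_def by simp
  have cKT: "card (K - T) = s + 1 - card T"
    using K(1) card_Diff_subset[OF finite_subset[OF TK finK] TK] by simp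
  then have "card (K - T) > 0" using cT by simp
  then have "K - T \<noteq> {}" by (auto simp: card_gt_0_iff)
  then obtain w where w: "w \<in> K" "w \<notin> T" by blast
  show False
  proof (cases "\<exists>z\<in>T. z \<noteq> x \<and> z \<noteq> y")
    case True
    then obtain z where z: "z \<in> T" "z \<noteq> x" "z \<noteq> y" by blast
    have K3: "x \<in> K" "y \<in> K" "z \<in> K" "x \<noteq> w" "y \<noteq> w" "z \<noteq> w" using w xT z TK by auto
    have "triple_danger A i x y z" unfolding triple_danger_def
      using outT[OF K3(1) w K3(4)] outT[OF K3(2) w K3(5)] outT[OF K3(3) w K3(6)] by blast
    then show False using xy(4) z unfolding edge_at_def T_def by blast
  next
    case False
    then have "T = {x, y}" using xT by blast
    then have "card T = 2" using xy by simp
    \<comment> \<open>Here \<open>s + 1 - 2 \<ge> 2\<close>, so a second outside vertex exists: this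
      is where \<open>s \<ge> 3\<close> enters.\<close>
    then have "card (K - T - {w}) > 0" using cKT s w finK by simp
    then have "K - T - {w} \<noteq> {}" by (auto simp: card_gt_0_iff)
    then obtain z where z: "z \<in> K" "z \<notin> T" "z \<noteq> w" by blast
    have K4: "x \<in> K" "y \<in> K" "x \<noteq> w" "y \<noteq> w" "x \<noteq> z" "y \<noteq> z" using w xT z TK by auto
    have "pair_danger A i x y" unfolding pair_danger_def
      using outT[OF K4(1) w K4(3)] outT[OF K4(2) w K4(4)] outT[OF K4(1) z(1,2) K4(5)]
        outT[OF K4(2) z(1,2) K4(6)] outT[OF z(1) w z(3)] by blast
    then show False using xy(4) unfolding edge_at_def by blast
  qed
qed

section \<open>Typical column systems\<close>

lemma finite_below: "X \<subseteq> {..<n::nat} \<Longrightarrow> finite X"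
  by (rule finite_subset) auto

definition cols :: "(nat \<Rightarrow> 'v set) \<Rightarrow> nat \<Rightarrow> 'v \<Rightarrow> nat set" where
  "cols A M v = {j. j < M \<and> v \<in> A j}"

lemma finite_cols [simp]: "finite (cols A M v)"
  by (simp add: cols_def)

lemma sum_incidences:
  assumes "finite S" "finite J"
  shows "(\<Sum>j\<in>J. card (S \<inter> A j)) = (\<Sum>v\<in>S. card {j\<in>J. v \<in> A j})"
proof -
  have "(\<Sum>j\<in>J. card (S \<inter> A j)) = (\<Sum>j\<in>J. \<Sum>v\<in>S. if v \<in> A j then 1 else 0)"
    using assms(1) by (intro sum.cong) (auto simp: sum.If_cases Int_def)
  also have "\<dots> = (\<Sum>v\<in>S. \<Sum>j\<in>J. if v \<in> A j then 1 else 0)" by (rule sum.swap)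
  also have "\<dots> = (\<Sum>v\<in>S. card {j\<in>J. v \<in> A j})"
    using assms(2) by (intro sum.cong) (auto simp: sum.If_cases Int_def)
  finally show ?thesis .
qed

text \<open>Greedy maximum cut: each new element joins the side from which it sees less weight, so
  the two directions of the cut together keep half of the weight. The heavier direction keeps a
  quarter, and \<open>w\<close> may be asymmetric.\<close>

lemma large_cut:
  fixes w :: "'a \<Rightarrow> 'a \<Rightarrow> real"
  assumes "finite J" and nonneg: "\<And>j k. 0 \<le> w j k"
  shows "\<exists>J1\<subseteq>J. (\<Sum>j\<in>J. \<Sum>k\<in>J-{j}. w j k) \<le> 4 * (\<Sum>j\<in>J1. \<Sum>k\<in>J-J1. w j k)"
proof -
  have "\<exists>J1\<subseteq>J. (\<Sum>j\<in>J. \<Sum>k\<in>J-{j}. w j k)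
      \<le> 2 * ((\<Sum>j\<in>J1. \<Sum>k\<in>J-J1. w j k) + (\<Sum>j\<in>J-J1. \<Sum>k\<in>J1. w j k))"
    using assms(1)
  proof (induction J rule: finite_induct)
    case empty
    then show ?case by simp
  next
    case (insert x J)
    then obtain J1 where J1: "J1 \<subseteq> J" and IH: "(\<Sum>j\<in>J. \<Sum>k\<in>J-{j}. w j k)
      \<le> 2 * ((\<Sum>j\<in>J1. \<Sum>k\<in>J-J1. w j k) + (\<Sum>j\<in>J-J1. \<Sum>k\<in>J1. w j k))" by blast
    define P where "P X = (\<Sum>k\<in>X. w x k + w k x)" for X
    have fin: "finite J1" "finite (J - J1)" using J1 insert.hyps finite_subset by auto
    have xJ: "x \<notin> J1" "x \<notin> J - J1" using J1 insert.hyps by auto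
    have all: "(\<Sum>j\<in>insert x J. \<Sum>k\<in>insert x J-{j}. w j k) = P J + (\<Sum>j\<in>J. \<Sum>k\<in>J-{j}. w j k)"
    proof -
      have e: "insert x J - {j} = insert x (J - {j})" if "j \<in> J" for j using that insert.hyps by auto
      have "(\<Sum>j\<in>J. \<Sum>k\<in>insert x J-{j}. w j k) = (\<Sum>j\<in>J. w j x + (\<Sum>k\<in>J-{j}. w j k))"
        using insert.hyps by (intro sum.cong) (auto simp: e)
      moreover have "insert x J - {x} = J" using insert.hyps by auto
      ultimately show ?thesis using insert.hyps by (simp add: P_def sum.distrib)
    qed
    have PJ: "P J = P J1 + P (J - J1)"
      using sum.subset_diff[OF J1 insert.hyps(1)] unfolding P_def by (metis add.commute)
    show ?case
    proof (cases "P J1 \<le> P (J - J1)")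
      case True
      have e: "insert x J - insert x J1 = J - J1" using insert.hyps by auto
      have "(\<Sum>j\<in>insert x J1. \<Sum>k\<in>J-J1. w j k) + (\<Sum>j\<in>J-J1. \<Sum>k\<in>insert x J1. w j k)
         = P (J - J1) + ((\<Sum>j\<in>J1. \<Sum>k\<in>J-J1. w j k) + (\<Sum>j\<in>J-J1. \<Sum>k\<in>J1. w j k))"
        using fin xJ by (simp add: P_def sum.distrib)
      then show ?thesis using True IH J1 all PJ
        by (intro exI[of _ "insert x J1"]) (auto simp: e)
    next
      case False
      have e: "insert x J - J1 = insert x (J - J1)" using xJ by auto
      have "(\<Sum>j\<in>J1. \<Sum>k\<in>insert x (J-J1). w j k) + (\<Sum>j\<in>insert x (J-J1). \<Sum>k\<in>J1. w j k)
         = P J1 + ((\<Sum>j\<in>J1. \<Sum>k\<in>J-J1. w j k) + (\<Sum>j\<in>J-J1. \<Sum>k\<in>J1. w j k))"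
        using fin xJ by (simp add: P_def sum.distrib)
      then show ?thesis using False IH J1 all PJ
        by (intro exI[of _ J1]) (auto simp: e)
    qed
  qed
  then obtain J1 where J1: "J1 \<subseteq> J" and b: "(\<Sum>j\<in>J. \<Sum>k\<in>J-{j}. w j k)
      \<le> 2 * ((\<Sum>j\<in>J1. \<Sum>k\<in>J-J1. w j k) + (\<Sum>j\<in>J-J1. \<Sum>k\<in>J1. w j k))" by blast
  show ?thesis
  proof (cases "(\<Sum>j\<in>J-J1. \<Sum>k\<in>J1. w j k) \<le> (\<Sum>j\<in>J1. \<Sum>k\<in>J-J1. w j k)")
    case True
    then show ?thesis using J1 b by (intro exI[of _ J1]) auto
  next
    case False
    moreover have "J - (J - J1) = J1" using J1 by auto
    ultimately show ?thesis using J1 b by (intro exI[of _ "J - J1"]) auto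
  qed
qed

text \<open>Tuples that would span a clique if column \<open>i\<close> contained them with labels
  \<open>0, ..., s - 1\<close> and nothing else interfered. They are ordered, position being the
  intended label, and extensional, so that there are \<open>card S ^ s\<close> candidates.\<close>

definition good_tuple :: "(nat \<Rightarrow> 'v set) \<Rightarrow> nat \<Rightarrow> nat \<Rightarrow> 'v set \<Rightarrow> (nat \<Rightarrow> 'v) \<Rightarrow> bool" where
  "good_tuple A i s S u \<longleftrightarrow> u \<in> {..<s} \<rightarrow>\<^sub>E S \<and>
     (\<forall>a<s. \<forall>b<s. a \<noteq> b \<longrightarrow> u a \<noteq> u b \<and> \<not> shares A i (u a) (u b) \<and> \<not> pair_danger A i (u a) (u b)) \<and>
     (\<forall>a<s. \<forall>b<s. \<forall>c<s. a \<noteq> b \<longrightarrow> c \<noteq> a \<longrightarrow> c \<noteq> b \<longrightarrow> \<not> triple_danger A i (u a) (u b) (u c))"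

text \<open>Vertices whose presence in column \<open>i\<close> could spoil the tuple, by pruning one
  of its members or by completing a dangerous triple. Since \<open>shares\<close> relates every
  covered vertex to itself, members of the tuple may occur here; later uses exclude the image of
  \<open>u\<close>.\<close>

definition blockers :: "(nat \<Rightarrow> 'v set) \<Rightarrow> nat \<Rightarrow> nat \<Rightarrow> (nat \<Rightarrow> 'v) \<Rightarrow> 'v set" where
  "blockers A i s u = {z. \<exists>a<s. shares A i (u a) z} \<union> {z. \<exists>a<s. \<exists>b<s. a \<noteq> b \<and> triple_danger A i (u a) (u b) z}"

lemma card_fixed_tuples:
  assumes "X \<subseteq> {..<s}"
  shows "card (PiE {..<s} (\<lambda>c. if c \<in> X then {v c} else S)) = card S ^ (s - card X)"
proof -
  have "card (PiE {..<s} (\<lambda>c. if c \<in> X then {v c} else S)) = (\<Prod>c<s. if c \<in> X then 1 else card S)"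
    by (simp add: card_PiE if_distrib cong: if_cong)
  also have "\<dots> = card S ^ card ({..<s} - X)" by (simp add: prod.If_cases Diff_eq)
  also have "card ({..<s} - X) = s - card X"
    using card_Diff_subset[OF finite_subset[OF assms] assms] by simp
  finally show ?thesis .
qed

lemma card_pair_tuples:
  assumes "a < s" "b < s" "a \<noteq> b" "finite S" "P \<subseteq> S \<times> S"
  shows "card {u \<in> {..<s} \<rightarrow>\<^sub>E S. (u a, u b) \<in> P} \<le> card P * card S ^ (s - 2)"
proof -
  define F where "F xy = PiE {..<s} (\<lambda>c. if c \<in> {a, b} then {(if c = a then fst xy else snd xy)} else S)" for xy
  have finP: "finite P" using assms finite_subset by (metis finite_SigmaI)
  have "{u \<in> {..<s} \<rightarrow>\<^sub>E S. (u a, u b) \<in> P} \<subseteq> (\<Union>xy\<in>P. F xy)"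
  proof
    fix u assume u: "u \<in> {u \<in> {..<s} \<rightarrow>\<^sub>E S. (u a, u b) \<in> P}"
    then have "u \<in> F (u a, u b)" using assms(3) unfolding F_def by (auto simp: PiE_iff)
    then show "u \<in> (\<Union>xy\<in>P. F xy)" using u by blast
  qed
  moreover have "finite (F xy)" for xy unfolding F_def using assms(4) by (intro finite_PiE) auto
  ultimately have "card {u \<in> {..<s} \<rightarrow>\<^sub>E S. (u a, u b) \<in> P} \<le> card (\<Union>xy\<in>P. F xy)"
    using finP by (intro card_mono) auto
  also have "\<dots> \<le> (\<Sum>xy\<in>P. card (F xy))" by (rule card_UN_le[OF finP])
  also have "\<dots> = (\<Sum>xy\<in>P. card S ^ (s - 2))"
  proof (rule sum.cong)
    fix xy
    have "card (F xy) = card S ^ (s - card {a, b})"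
      unfolding F_def by (rule card_fixed_tuples) (use assms in auto)
    moreover have "card {a, b} = 2" using assms(3) by simp
    ultimately show "card (F xy) = card S ^ (s - 2)" by simp
  qed simp
  finally show ?thesis by simp
qed

lemma card_triple_tuples:
  assumes "a < s" "b < s" "c < s" "a \<noteq> b" "c \<noteq> a" "c \<noteq> b" "finite S" "P \<subseteq> S \<times> S \<times> S"
  shows "card {u \<in> {..<s} \<rightarrow>\<^sub>E S. (u a, u b, u c) \<in> P} \<le> card P * card S ^ (s - 3)"
proof -
  define F where "F t = PiE {..<s} (\<lambda>i. if i \<in> {a, b, c} then
    {(if i = a then fst t else if i = b then fst (snd t) else snd (snd t))} else S)" for t
  have finP: "finite P" using assms finite_subset by (metis finite_SigmaI)
  have "{u \<in> {..<s} \<rightarrow>\<^sub>E S. (u a, u b, u c) \<in> P} \<subseteq> (\<Union>t\<in>P. F t)"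
  proof
    fix u assume u: "u \<in> {u \<in> {..<s} \<rightarrow>\<^sub>E S. (u a, u b, u c) \<in> P}"
    then have "u \<in> F (u a, u b, u c)" using assms(4-6) unfolding F_def by (auto simp: PiE_iff)
    then show "u \<in> (\<Union>t\<in>P. F t)" using u by blast
  qed
  moreover have "finite (F t)" for t unfolding F_def using assms(7) by (intro finite_PiE) auto
  ultimately have "card {u \<in> {..<s} \<rightarrow>\<^sub>E S. (u a, u b, u c) \<in> P} \<le> card (\<Union>t\<in>P. F t)"
    using finP by (intro card_mono) auto
  also have "\<dots> \<le> (\<Sum>t\<in>P. card (F t))" by (rule card_UN_le[OF finP])
  also have "\<dots> = (\<Sum>t\<in>P. card S ^ (s - 3))"
  proof (rule sum.cong)
    fix t
    have "card (F t) = card S ^ (s - card {a, b, c})"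
      unfolding F_def by (rule card_fixed_tuples) (use assms in auto)
    moreover have "card {a, b, c} = 3" using assms(4-6) by auto
    ultimately show "card (F t) = card S ^ (s - 3)" by simp
  qed simp
  finally show ?thesis by simp
qed

text \<open>Think of each vertex as lying in each of the \<open>M\<close> columns with probability \<open>1 / B\<close>. The two
  entropy conditions say that the number \<open>t\<close> of incidences of a block never has a binomial tail
  probability that loses to the number of such blocks; in the second one, the vertex side of the
  block is a union of columns and costs only \<open>card J\<close> choices of a column.\<close>
locale typical =
  fixes n M B m :: nat and A :: "nat \<Rightarrow> nat set" and C sn l al d ka :: real
  assumes A_sub: "\<And>j. j < M \<Longrightarrow> A j \<subseteq> {..<n}"
    and size_le: "\<And>j. j < M \<Longrightarrow> real (card (A j)) \<le> al"
    and cols_le: "\<And>v. v < n \<Longrightarrow> real (card (cols A M v)) \<le> d"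
    and codeg_le: "\<And>x y. x < n \<Longrightarrow> y < n \<Longrightarrow> x \<noteq> y \<Longrightarrow>
      real (card {v\<in>{..<n}-{x,y}. \<exists>k<M. \<exists>j<M. k \<noteq> j \<and> x \<in> A k \<and> y \<in> A j \<and> v \<in> A k \<and> v \<in> A j}) \<le> ka"
    and sparse: "\<And>S J t. S \<subseteq> {..<n} \<Longrightarrow> J \<subseteq> {..<M} \<Longrightarrow> S \<noteq> {} \<Longrightarrow> J \<noteq> {} \<Longrightarrow>
      t = (\<Sum>j\<in>J. card (S \<inter> A j)) \<Longrightarrow> 0 < t \<Longrightarrow>
      real t * (ln (real t * real B / (real (card S) * real (card J))) - 1) \<le> (real (card S) + real (card J) + 5) * l"
    and col_sparse: "\<And>J K t. J \<subseteq> {..<M} \<Longrightarrow> K \<subseteq> {..<M} \<Longrightarrow> J \<inter> K = {} \<Longrightarrow> J \<noteq> {} \<Longrightarrow> K \<noteq> {} \<Longrightarrow>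
      t = (\<Sum>k\<in>K. card (A k \<inter> (\<Union>j\<in>J. A j))) \<Longrightarrow> 0 < t \<Longrightarrow>
      real t * (ln (real t * real B / (real (card J) * al * real (card K))) - 1)
        \<le> (real (card J) + 5) * l + real (card K) * (1 + ln (real M / real (card K)))"
    and params: "1 \<le> C" "0 < sn" "1 < l" "al = 6 * sn / l" "d = 20 * C * l" "0 \<le> ka"
      "sn * l \<le> real B" "4 * m \<le> B" "sn * l \<le> 5 * real m" "real M \<le> 4 * C * sn * l^2"
      "1 + ln (real M) \<le> l" "0 < M" "5 \<le> m"
begin

abbreviation "U J \<equiv> (\<Union>j\<in>J. A j)"
abbreviation "I v \<equiv> cols A M v"

lemma al_pos: "0 < al" and d_pos: "0 < d" and d_al: "d * al = 120 * C * sn"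
  using params(1-5) by simp_all

lemma B_pos: "0 < real B"
  using params(2,3,7) by (smt (verit) mult_pos_pos)

lemma finite_A: "j < M \<Longrightarrow> finite (A j)"
  using finite_subset[OF A_sub] by simp

lemma card_Int_column_le:
  assumes "j < M" shows "real (card (S \<inter> A j)) \<le> al"
proof -
  have "card (S \<inter> A j) \<le> card (A j)" using assms finite_A by (intro card_mono) auto
  then show ?thesis using size_le[OF assms] by linarith
qed

lemma U_sub: "J \<subseteq> {..<M} \<Longrightarrow> U J \<subseteq> {..<n}"
  using A_sub by blast

lemma finite_U: "J \<subseteq> {..<M} \<Longrightarrow> finite (U J)"
  using finite_subset[OF U_sub] by simp

lemma total_incidences:
  assumes "S \<subseteq> {..<n}"
  shows "real (\<Sum>j<M. card (S \<inter> A j)) \<le> d * real (card S)"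
proof -
  have fin: "finite S" using assms finite_subset by blast
  have "real (\<Sum>j<M. card (S \<inter> A j)) = (\<Sum>v\<in>S. real (card (I v)))"
    using sum_incidences[OF fin, of "{..<M}" A] by (simp add: cols_def)
  also have "\<dots> \<le> (\<Sum>v\<in>S. d)" using assms by (intro sum_mono cols_le) auto
  finally show ?thesis by (simp add: mult.commute)
qed

section \<open>Columns with several vertices in one neighbourhood\<close>

definition rich :: "nat \<Rightarrow> nat \<Rightarrow> nat set" where
  "rich q y = {j. j < M \<and> y \<notin> A j \<and> q \<le> card (A j \<inter> U (I y))}"

lemma finite_rich [simp]: "finite (rich q y)"
  by (simp add: rich_def)

lemma ln_mono_div:
  assumes "0 < (a::real)" "a \<le> b" shows "ln a \<le> ln b"
  using assms by simp

text \<open>\<open>col_sparse\<close> is applied with the columns through \<open>y\<close> as vertex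
  side: the neighbourhood \<open>U (I y)\<close> costs only the choice of at most \<open>d\<close>
  columns. The clause \<open>y \<notin> A j\<close> in \<open>rich\<close> makes the two families of
  columns disjoint, as that condition demands.\<close>

lemma rich_entropy:
  assumes y: "y < n" and q: "1 \<le> q" and K: "K \<subseteq> rich q y" "K \<noteq> {}"
    and big: "1 \<le> ln (real q * l / (120 * C))"
  shows "real q * real (card K) * (ln (real q * l / (120 * C)) - 1)
    \<le> (d + 5) * l + real (card K) * (1 + ln (real M / real (card K)))"
proof -
  have KM: "K \<subseteq> {..<M}" "K \<inter> I y = {}" and IM: "I y \<subseteq> {..<M}"
    using K by (auto simp: rich_def cols_def)
  have finK: "finite K" using KM finite_subset by blast
  have kpos: "0 < card K" using finK K by (simp add: card_gt_0_iff)
  have ne: "I y \<noteq> {}"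
  proof
    assume "I y = {}"
    then have "U (I y) = {}" by simp
    then show False using K q by (auto simp: rich_def)
  qed
  define t where "t = (\<Sum>k\<in>K. card (A k \<inter> U (I y)))"
  have "q * card K = (\<Sum>k\<in>K. q)" by simp
  also have "\<dots> \<le> t" unfolding t_def using K by (intro sum_mono) (auto simp: rich_def)
  finally have tq: "q * card K \<le> t" .
  have tpos: "0 < t" using tq kpos q by (smt (verit) mult_pos_pos less_le_trans le_less_trans zero_less_one)
  have rpos: "0 < card (I y)" using ne by (simp add: card_gt_0_iff)
  have main: "real t * (ln (real t * real B / (real (card (I y)) * al * real (card K))) - 1)
        \<le> (real (card (I y)) + 5) * l + real (card K) * (1 + ln (real M / real (card K)))"
    by (rule col_sparse[OF IM KM(1) _ ne K(2) t_def tpos]) (use KM in auto)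
  \<comment> \<open>Since \<open>d * al = 120 * C * sn\<close> and \<open>sn * l \<le> B\<close>, a
    column is expected to have at most \<open>120 * C / l\<close> vertices in the neighbourhood; the
    argument of the logarithm is \<open>q\<close> divided by this.\<close>
  have "real q * l / (120 * C) = real q * real (card K) * (sn * l) / (d * al * real (card K))"
    using kpos params(2) d_al params(1) by (simp add: field_simps)
  also have "\<dots> \<le> real t * real B / (real (card (I y)) * al * real (card K))"
  proof (rule frac_le)
    show "0 \<le> real t * real B" by simp
    show "real q * real (card K) * (sn * l) \<le> real t * real B"
    proof (rule mult_mono)
      show "real q * real (card K) \<le> real t" using tq by (metis of_nat_le_iff of_nat_mult)
    qed (use params in auto)
    show "0 < real (card (I y)) * al * real (card K)" using rpos kpos al_pos by simp
    show "real (card (I y)) * al * real (card K) \<le> d * al * real (card K)"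
      using cols_le[OF y] al_pos by (intro mult_right_mono) auto
  qed
  finally have arg: "real q * l / (120 * C) \<le> real t * real B / (real (card (I y)) * al * real (card K))" .
  have pos: "0 < real q * l / (120 * C)" using q params(1,3) by simp
  have lnle: "ln (real q * l / (120 * C)) \<le> ln (real t * real B / (real (card (I y)) * al * real (card K)))"
    by (rule ln_mono_div[OF pos arg])
  have "real q * real (card K) * (ln (real q * l / (120 * C)) - 1)
      \<le> real t * (ln (real t * real B / (real (card (I y)) * al * real (card K))) - 1)"
  proof (rule mult_mono)
    show "real q * real (card K) \<le> real t" using tq by (metis of_nat_le_iff of_nat_mult)
  qed (use lnle big in auto)
  also have "\<dots> \<le> (real (card (I y)) + 5) * l + real (card K) * (1 + ln (real M / real (card K)))"
    by (rule main)
  also have "\<dots> \<le> (d + 5) * l + real (card K) * (1 + ln (real M / real (card K)))"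
    using cols_le[OF y] params(3) by simp
  finally show ?thesis .
qed

text \<open>If there were \<open>k > x\<close> such columns, then \<open>ln (M / k)\<close> would be
  at most \<open>ln (M / x)\<close>, and the third condition on \<open>x\<close> leaves a surplus of
  at least one per column. Hence \<open>k \<le> (d + 5) * l\<close>, against the second
  condition.\<close>

lemma card_rich_le:
  assumes y: "y < n" and q: "1 \<le> q" and big: "1 \<le> ln (real q * l / (120 * C))"
    and x: "0 < x" "(d + 5) * l < x" "2 + ln (real M / x) \<le> real q * (ln (real q * l / (120 * C)) - 1)"
  shows "real (card (rich q y)) \<le> x"
proof (rule ccontr)
  define k where "k = real (card (rich q y))"
  define e where "e = ln (real q * l / (120 * C)) - 1"
  assume "\<not> real (card (rich q y)) \<le> x"
  then have k: "x < k" by (simp add: k_def)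
  have ne: "rich q y \<noteq> {}" using k x(1) by (auto simp: k_def)
  have "real q * k * e \<le> (d + 5) * l + k * (1 + ln (real M / k))"
    unfolding k_def e_def by (rule rich_entropy[OF y q order_refl ne big])
  also have "ln (real M / k) \<le> ln (real M / x)"
    using k x(1) params(12) by (intro ln_mono_div divide_left_mono) auto
  then have "k * (1 + ln (real M / k)) \<le> k * (real q * e - 1)"
    using x(3) k x(1) unfolding e_def by (intro mult_left_mono) auto
  finally have "k \<le> (d + 5) * l" by (simp add: algebra_simps)
  then show False using k x(2) by simp
qed

text \<open>The entropy estimate for the single column \<open>j\<close>, with \<open>q\<close> equal
  to the size of the intersection itself.\<close>

lemma column_in_nbhd:
  assumes y: "y < n" and j: "j < M" "y \<notin> A j"
    and big: "2 \<le> ln (l / (120 * C))" "(d + 6) * l \<le> l ^ 3"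
  shows "real (card (A j \<inter> U (I y))) \<le> l ^ 3"
proof (rule ccontr)
  define q where "q = card (A j \<inter> U (I y))"
  assume "\<not> real (card (A j \<inter> U (I y))) \<le> l ^ 3"
  then have q: "l ^ 3 < real q" by (simp add: q_def)
  have l3: "0 < l ^ 3" using params(3) by simp
  have q1: "1 \<le> real q" using q l3 by (cases q) auto
  have "l / (120 * C) \<le> real q * l / (120 * C)"
    using q1 params(1,3) by (intro divide_right_mono) auto
  then have "ln (l / (120 * C)) \<le> ln (real q * l / (120 * C))"
    using params(1,3) by (intro ln_mono_div) auto
  then have big': "1 \<le> ln (real q * l / (120 * C)) - 1" using big(1) by simp
  have "real q * 1 \<le> real q * (ln (real q * l / (120 * C)) - 1)"
    using big' by (intro mult_left_mono) auto
  also have "\<dots> = real q * real (card {j}) * (ln (real q * l / (120 * C)) - 1)" by simp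
  also have "\<dots> \<le> (d + 5) * l + real (card {j}) * (1 + ln (real M / real (card {j})))"
    by (rule rich_entropy[OF y]) (use q1 big' j in \<open>auto simp: rich_def q_def\<close>)
  also have "\<dots> \<le> (d + 6) * l" using params(11) by (simp add: algebra_simps)
  finally show False using q big(2) by simp
qed

text \<open>Columns with 2 to 8 vertices in the neighbourhood contribute at most 64 each. Those with
  9 or more are rarer by a factor \<open>l ^ 6\<close>, which pays for the crude bound
  \<open>l ^ 3\<close> on each intersection.\<close>

lemma sum_rich_squares:
  assumes y: "y < n"
    and r2: "real (card (rich 2 y)) \<le> x" and r9: "real (card (rich 9 y)) * l ^ 6 \<le> x"
    and big: "2 \<le> ln (l / (120 * C))" "(d + 6) * l \<le> l ^ 3"
  shows "(\<Sum>j\<in>rich 2 y. real (card (A j \<inter> U (I y)))^2) \<le> 65 * x"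
proof -
  have sub: "rich 9 y \<subseteq> rich 2 y" by (auto simp: rich_def)
  have "(\<Sum>j\<in>rich 2 y. real (card (A j \<inter> U (I y)))^2)
    \<le> (\<Sum>j\<in>rich 2 y. 64 + (if j \<in> rich 9 y then l ^ 6 else 0))"
  proof (rule sum_mono)
    fix j assume j: "j \<in> rich 2 y"
    show "real (card (A j \<inter> U (I y)))^2 \<le> 64 + (if j \<in> rich 9 y then l ^ 6 else 0)"
    proof (cases "j \<in> rich 9 y")
      case True
      have "real (card (A j \<inter> U (I y))) \<le> l ^ 3"
        using j by (intro column_in_nbhd[OF y _ _ big]) (auto simp: rich_def)
      then have "real (card (A j \<inter> U (I y)))^2 \<le> (l^3)^2" by (intro power_mono) auto
      then show ?thesis using True by (simp flip: power_mult)
    next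
      case False
      then have "card (A j \<inter> U (I y)) \<le> 8" using j by (auto simp: rich_def)
      then have "real (card (A j \<inter> U (I y)))^2 \<le> 8^2" by (intro power_mono) auto
      then show ?thesis using False by simp
    qed
  qed
  also have "\<dots> = 64 * real (card (rich 2 y)) + l^6 * real (card (rich 9 y))"
    using sub by (simp add: sum.distrib sum.If_cases Int_absorb1)
  also have "\<dots> \<le> 65 * x" using r2 r9 by (simp add: mult.commute)
  finally show ?thesis .
qed

section \<open>Classification of dangerous pairs\<close>

definition apexes :: "nat \<Rightarrow> nat set" where
  "apexes j = {y. y < n \<and> j \<in> rich 2 y}"

text \<open>A dangerous pair is of one of two kinds. In a fan, one vertex lies on a column two of whose vertices
  are joined to the other one, the apex; in the crossing kind, both vertices are apexes.\<close>
definition fan :: "nat \<Rightarrow> nat \<Rightarrow> bool" where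
  "fan x y \<longleftrightarrow> (\<exists>j<M. x \<in> A j \<and> y \<in> apexes j)"

definition cross :: "nat \<Rightarrow> nat \<Rightarrow> bool" where
  "cross x y \<longleftrightarrow> (\<exists>j\<in>rich 2 y. \<exists>z\<in>A j \<inter> U (I y). \<exists>w\<in>A j \<inter> U (I y). z \<noteq> w \<and> x \<noteq> z \<and> x \<noteq> w \<and>
     (\<exists>k<M. \<exists>k'<M. k \<noteq> k' \<and> z \<in> A k \<and> w \<in> A k' \<and> x \<in> A k \<and> x \<in> A k'))"

lemma apexesI:
  assumes "y < n" "j < M" "y \<notin> A j" "z \<noteq> w" "z \<in> A j" "w \<in> A j"
    "k < M" "y \<in> A k" "z \<in> A k" "k' < M" "y \<in> A k'" "w \<in> A k'"
  shows "j \<in> rich 2 y"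
proof -
  have "{z, w} \<subseteq> A j \<inter> U (I y)" using assms by (auto simp: cols_def)
  then have "card {z, w} \<le> card (A j \<inter> U (I y))"
    using assms finite_A by (intro card_mono) auto
  then show ?thesis using assms by (auto simp: rich_def)
qed

text \<open>Let \<open>j\<close> be the column joining the two common neighbours \<open>z\<close>,
  \<open>w\<close>. If \<open>y\<close> reaches both through one column, linearity identifies it
  with \<open>j\<close>; then \<open>x\<close> is off \<open>j\<close> and an apex of it. Otherwise
  \<open>y\<close> is off \<open>j\<close> and an apex, and \<open>x\<close> either lies on
  \<open>j\<close>, a fan, or reaches \<open>z\<close> and \<open>w\<close> through two different
  columns, the crossing kind.\<close>

lemma pair_danger_cases:
  assumes pd: "pair_danger A M x y" and ns: "\<not> shares A M x y" and xn: "x < n" and yn: "y < n"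
  shows "fan x y \<or> fan y x \<or> cross x y"
proof -
  have pA: "v \<in> A i" if "v \<in> prune A i" for v i using that by (auto simp: prune_def)
  obtain z w where zw: "joined A M x z" "joined A M x w" "joined A M y z" "joined A M y w" "joined A M z w"
    using pd unfolding pair_danger_def by blast
  obtain k where k: "k < M" "y \<in> prune A k" "z \<in> prune A k" and yz: "y \<noteq> z"
    using zw(3) unfolding joined_def by blast
  obtain l' where l: "l' < M" "y \<in> prune A l'" "w \<in> prune A l'" and yw: "y \<noteq> w"
    using zw(4) unfolding joined_def by blast
  obtain p where p: "p < M" "x \<in> prune A p" "z \<in> prune A p" and xz: "x \<noteq> z"
    using zw(1) unfolding joined_def by blast
  obtain q where q: "q < M" "x \<in> prune A q" "w \<in> prune A q" and xw: "x \<noteq> w"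
    using zw(2) unfolding joined_def by blast
  obtain j where j: "j < M" "z \<in> prune A j" "w \<in> prune A j" and zw': "z \<noteq> w"
    using zw(5) unfolding joined_def by blast
  have lin: "i' = i" if "u \<in> prune A i" "v \<in> prune A i" "u \<in> A i'" "v \<in> prune A i'" "u \<noteq> v" for u v i i'
    by (rule prune_linear[OF that])
  show ?thesis
  proof (cases "k = l'")
    case True
    have "j = k" using lin[of z k w j] k(3) l(3) True j pA[OF j(2)] zw' by simp
    then have yj: "y \<in> A j" using pA[OF k(2)] by simp
    then have xj: "x \<notin> A j" using ns j(1) unfolding shares_def by blast
    have "j \<in> rich 2 x"
      by (rule apexesI[OF xn j(1) xj zw' pA[OF j(2)] pA[OF j(3)] p(1) pA[OF p(2)] pA[OF p(3)]
            q(1) pA[OF q(2)] pA[OF q(3)]])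
    then have "fan y x" unfolding fan_def apexes_def using yj j(1) xn by blast
    then show ?thesis by blast
  next
    case False
    have yj: "y \<notin> A j"
    proof
      assume "y \<in> A j"
      then have "j = k" "j = l'" using lin[of y k z j] lin[of y l' w j] k l j yz yw by auto
      then show False using False by simp
    qed
    have rj: "j \<in> rich 2 y"
      by (rule apexesI[OF yn j(1) yj zw' pA[OF j(2)] pA[OF j(3)] k(1) pA[OF k(2)] pA[OF k(3)]
            l(1) pA[OF l(2)] pA[OF l(3)]])
    show ?thesis
    proof (cases "x \<in> A j")
      case True
      then show ?thesis using rj j(1) yn unfolding fan_def apexes_def by blast
    next
      case xj: False
      have pq: "p \<noteq> q"
      proof
        assume "p = q"
        then have "j = p" using lin[of z p w j] p q j pA[OF j(2)] zw' by simp
        then show False using xj pA[OF p(2)] by simp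
      qed
      have "z \<in> A j \<inter> U (I y)" "w \<in> A j \<inter> U (I y)"
        using pA[OF j(2)] pA[OF j(3)] pA[OF k(2)] pA[OF k(3)] pA[OF l(2)] pA[OF l(3)] k(1) l(1)
        by (auto simp: cols_def)
      then have "cross x y" unfolding cross_def
        using rj zw' xz xw pq p(1) q(1) pA[OF p(2)] pA[OF p(3)] pA[OF q(2)] pA[OF q(3)] by blast
      then show ?thesis by blast
    qed
  qed
qed

text \<open>For fixed \<open>y\<close> a rich column offers at most the square of its intersection
  with the neighbourhood as pairs \<open>z\<close>, \<open>w\<close>; at most \<open>ka\<close>
  vertices reach such a pair through two different columns.\<close>

lemma card_cross_le:
  assumes y: "y < n" and S: "S \<subseteq> {..<n}"
    and T: "(\<Sum>j\<in>rich 2 y. real (card (A j \<inter> U (I y)))^2) \<le> x"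
  shows "real (card {u\<in>S. cross u y}) \<le> x * ka"
proof -
  define V where "V j = A j \<inter> U (I y)" for j
  define N where "N z w = {v\<in>{..<n}-{z,w}. \<exists>k<M. \<exists>j<M. k \<noteq> j \<and> z \<in> A k \<and> w \<in> A j \<and> v \<in> A k \<and> v \<in> A j}" for z w
  define Q where "Q = (\<lambda>j. {zw \<in> V j \<times> V j. fst zw \<noteq> snd zw})"
  have finV: "finite (V j)" if "j \<in> rich 2 y" for j
    using that finite_A unfolding V_def rich_def by auto
  have Vn: "V j \<subseteq> {..<n}" if "j \<in> rich 2 y" for j
    using that A_sub unfolding V_def rich_def by auto
  have finQ: "finite (Q j)" if "j \<in> rich 2 y" for j
    using finV[OF that] unfolding Q_def by (auto intro: finite_subset)
  have finN: "finite (N z w)" for z w unfolding N_def by auto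
  have "{u\<in>S. cross u y} \<subseteq> (\<Union>j\<in>rich 2 y. \<Union>zw\<in>Q j. N (fst zw) (snd zw))"
  proof
    fix u assume "u \<in> {u\<in>S. cross u y}"
    then obtain j z w k k' where "u \<in> S" "j \<in> rich 2 y" "z \<in> V j" "w \<in> V j" "z \<noteq> w" "u \<noteq> z" "u \<noteq> w"
      "k < M" "k' < M" "k \<noteq> k'" "z \<in> A k" "w \<in> A k'" "u \<in> A k" "u \<in> A k'"
      unfolding cross_def V_def by blast
    then have "u \<in> N z w" "(z, w) \<in> Q j" using S unfolding N_def Q_def by auto
    then show "u \<in> (\<Union>j\<in>rich 2 y. \<Union>zw\<in>Q j. N (fst zw) (snd zw))"
      using \<open>j \<in> rich 2 y\<close> by force
  qed
  then have "card {u\<in>S. cross u y} \<le> card (\<Union>j\<in>rich 2 y. \<Union>zw\<in>Q j. N (fst zw) (snd zw))"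
    using finQ finN by (intro card_mono) auto
  also have "\<dots> \<le> (\<Sum>j\<in>rich 2 y. card (\<Union>zw\<in>Q j. N (fst zw) (snd zw)))"
    by (rule card_UN_le) simp
  also have "\<dots> \<le> (\<Sum>j\<in>rich 2 y. \<Sum>zw\<in>Q j. card (N (fst zw) (snd zw)))"
    using finQ by (intro sum_mono card_UN_le) auto
  finally have "real (card {u\<in>S. cross u y})
      \<le> real (\<Sum>j\<in>rich 2 y. \<Sum>zw\<in>Q j. card (N (fst zw) (snd zw)))"
    by (rule of_nat_mono)
  also have "\<dots> = (\<Sum>j\<in>rich 2 y. \<Sum>zw\<in>Q j. real (card (N (fst zw) (snd zw))))" by simp
  also have "\<dots> \<le> (\<Sum>j\<in>rich 2 y. real (card (V j))^2 * ka)"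
  proof (rule sum_mono)
    fix j assume j: "j \<in> rich 2 y"
    have "(\<Sum>zw\<in>Q j. real (card (N (fst zw) (snd zw)))) \<le> (\<Sum>zw\<in>Q j. ka)"
    proof (rule sum_mono)
      fix zw assume "zw \<in> Q j"
      then have "fst zw < n" "snd zw < n" "fst zw \<noteq> snd zw" using Vn[OF j] unfolding Q_def by auto
      then show "real (card (N (fst zw) (snd zw))) \<le> ka" unfolding N_def by (rule codeg_le)
    qed
    also have "\<dots> = real (card (Q j)) * ka" by simp
    also have "\<dots> \<le> real (card (V j))^2 * ka"
    proof (rule mult_right_mono)
      have "card (Q j) \<le> card (V j \<times> V j)"
        using finV[OF j] unfolding Q_def by (intro card_mono) auto
      then have "real (card (Q j)) \<le> real (card (V j) * card (V j))"
        by (simp only: card_cartesian_product)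
      then show "real (card (Q j)) \<le> real (card (V j))^2" by (simp add: power2_eq_square)
    qed (use params in auto)
    finally show "(\<Sum>zw\<in>Q j. real (card (N (fst zw) (snd zw)))) \<le> real (card (V j))^2 * ka" .
  qed
  also have "\<dots> = (\<Sum>j\<in>rich 2 y. real (card (V j))^2) * ka" by (simp add: sum_distrib_right)
  also have "\<dots> \<le> x * ka" using T params(6) unfolding V_def by (intro mult_right_mono) auto
  finally show ?thesis .
qed

section \<open>Columns with many apexes in a set\<close>

definition meets :: "nat \<Rightarrow> nat \<Rightarrow> bool" where
  "meets j k \<longleftrightarrow> A j \<inter> A k \<noteq> {}"

abbreviation mult :: "nat set \<Rightarrow> nat \<Rightarrow> nat" where
  "mult J v \<equiv> card {j\<in>J. v \<in> A j}"

text \<open>In \<open>sparse\<close> a vertex costs \<open>l\<close>, while each of its at least 5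
  incidences with \<open>J\<close> gains at least \<open>9/20 * l\<close>, so these vertices pay for
  themselves. What remains is \<open>t * (9/20 - 1/5) \<le> card J + 5 \<le> 6 * r\<close>, whence
  the factor 24.\<close>

lemma sum_mult_heavy:
  assumes J: "J \<subseteq> {..<M}" "J \<noteq> {}" and r: "real (card J) \<le> r"
    and big: "9/20 * l \<le> ln (5 * real B / r) - 1"
  shows "real (\<Sum>v\<in>{v\<in>{..<n}. 5 \<le> mult J v}. mult J v) \<le> 24 * r"
proof -
  define V where "V = {v\<in>{..<n}. 5 \<le> mult J v}"
  define t where "t = (\<Sum>v\<in>V. mult J v)"
  have finJ: "finite J" and finV: "finite V" using J unfolding V_def by (auto intro: finite_below)
  have r1: "1 \<le> real (card J)" using J finJ by (simp add: Suc_le_eq card_gt_0_iff)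
  show ?thesis
  proof (cases "V = {}")
    case True
    then show ?thesis using r r1 unfolding V_def[symmetric] by simp
  next
    case False
    then have cV: "1 \<le> real (card V)" using finV by (simp add: Suc_le_eq card_gt_0_iff)
    have t_eq: "t = (\<Sum>j\<in>J. card (V \<inter> A j))" unfolding t_def using sum_incidences[OF finV finJ] by simp
    have "(\<Sum>v\<in>V. 5) \<le> t" unfolding t_def by (rule sum_mono) (auto simp: V_def)
    then have t5: "5 * card V \<le> t" by simp
    then have t5r: "5 * real (card V) \<le> real t" by (metis of_nat_le_iff of_nat_mult of_nat_numeral)
    have tpos: "0 < t" using t5r cV by (cases t) auto
    have bound: "real t * (ln (real t * real B / (real (card V) * real (card J))) - 1) \<le> (real (card V) + real (card J) + 5) * l"
      by (rule sparse[OF _ J(1) False J(2) t_eq tpos]) (auto simp: V_def)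
    have "5 * real B / r \<le> real t * real B / (real (card V) * real (card J))"
    proof -
      have "5 * real B / r \<le> 5 * real B / real (card J)"
        using r r1 by (intro divide_left_mono) auto
      also have "\<dots> = (5 * real (card V)) * real B / (real (card V) * real (card J))"
        using cV by (simp add: field_simps)
      also have "\<dots> \<le> real t * real B / (real (card V) * real (card J))"
        using t5r by (intro divide_right_mono mult_right_mono) auto
      finally show ?thesis .
    qed
    then have "ln (5 * real B / r) \<le> ln (real t * real B / (real (card V) * real (card J)))"
      using B_pos r r1 by (intro ln_mono_div) auto
    then have "real t * (9/20 * l) \<le> real t * (ln (real t * real B / (real (card V) * real (card J))) - 1)"
      using big by (intro mult_left_mono) auto
    with bound have "(real t * (9/20)) * l \<le> (real (card V) + real (card J) + 5) * l" by simp
    then have "real t * (9/20) \<le> real (card V) + real (card J) + 5"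
      by (rule mult_right_le_imp_le) (use params(3) in simp)
    then have "real t \<le> 24 * r" using t5r r1 r by linarith
    then show ?thesis unfolding t_def V_def .
  qed
qed

text \<open>Two meeting columns have a vertex in common. A vertex lying in at most four columns of
  \<open>J\<close> accounts for at most four of them; heavier vertices are listed separately, to be
  handled by \<open>sum_mult_heavy\<close>.\<close>

lemma card_meets_le:
  assumes J: "J \<subseteq> {..<M}" and k: "k < M"
  shows "card {j\<in>J. meets j k} \<le> 4 * card (A k \<inter> U J) + (\<Sum>v\<in>A k \<inter> {v\<in>{..<n}. 5 \<le> mult J v}. mult J v)"
proof -
  have finJ: "finite J" using J by (auto intro: finite_below)
  have fin: "finite (A k \<inter> U J)" using finite_A[OF k] by simp
  have "{j\<in>J. meets j k} \<subseteq> (\<Union>v\<in>A k \<inter> U J. {j\<in>J. v \<in> A j})" unfolding meets_def by auto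
  then have "card {j\<in>J. meets j k} \<le> card (\<Union>v\<in>A k \<inter> U J. {j\<in>J. v \<in> A j})"
    using fin finJ by (intro card_mono) auto
  also have "\<dots> \<le> (\<Sum>v\<in>A k \<inter> U J. mult J v)" using fin by (rule card_UN_le)
  also have "\<dots> \<le> (\<Sum>v\<in>A k \<inter> U J. 4 + (if v \<in> {v\<in>{..<n}. 5 \<le> mult J v} then mult J v else 0))"
  proof (rule sum_mono)
    fix v assume "v \<in> A k \<inter> U J"
    then have "v < n" using A_sub[OF k] by auto
    then show "mult J v \<le> 4 + (if v \<in> {v\<in>{..<n}. 5 \<le> mult J v} then mult J v else 0)" by simp
  qed
  also have "\<dots> = 4 * card (A k \<inter> U J) + (\<Sum>v\<in>(A k \<inter> U J) \<inter> {v\<in>{..<n}. 5 \<le> mult J v}. mult J v)"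
    using fin by (simp add: sum.distrib sum.If_cases Int_def)
  also have "\<dots> \<le> 4 * card (A k \<inter> U J) + (\<Sum>v\<in>A k \<inter> {v\<in>{..<n}. 5 \<le> mult J v}. mult J v)"
    using finite_A[OF k] by (intro add_left_mono sum_mono2) auto
  finally show ?thesis .
qed

text \<open>Columns meeting \<open>U J\<close> in at most \<open>rho\<close> vertices are paid for
  by the total of at most \<open>d * m\<close> incidences with \<open>S\<close>. For the others,
  \<open>card (S \<inter> A k)\<close> is bounded crudely by \<open>al\<close>, and
  \<open>col_sparse\<close> bounds the sum of their intersections with \<open>U J\<close> by
  \<open>6 * r * l / lam\<close>.\<close>

lemma spread:
  assumes S: "S \<subseteq> {..<n}" "card S = m"
    and J: "J \<subseteq> {..<M}" "J \<noteq> {}" and K: "K \<subseteq> {..<M}" "J \<inter> K = {}"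
    and r: "real (card J) \<le> r" and rho: "0 < rho" and lam: "0 < lam"
    and big: "lam \<le> ln (rho * real B / (r * al)) - 1 - l / rho"
  shows "(\<Sum>k\<in>K. real (card (S \<inter> A k)) * real (card (A k \<inter> U J))) \<le> rho * (d * real m) + 36 * sn * r / lam"
proof -
  define u where "u k = real (card (A k \<inter> U J))" for k
  define a where "a k = real (card (S \<inter> A k))" for k
  define H where "H = {k\<in>K. rho < u k}"
  have finK: "finite K" "finite J" and finS: "finite S" using J K S by (auto intro: finite_below)
  have finH: "finite H" using finK unfolding H_def by simp
  have r1: "1 \<le> real (card J)" using J finK by (simp add: Suc_le_eq card_gt_0_iff)
  have a_al: "a k \<le> al" if "k \<in> K" for k
    unfolding a_def using that K by (intro card_Int_column_le) auto
  have high: "al * (\<Sum>k\<in>H. u k) \<le> 36 * sn * r / lam"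
  proof (cases "H = {}")
    case True
    then show ?thesis using params r r1 lam by simp
  next
    case False
    define t where "t = (\<Sum>k\<in>H. card (A k \<inter> U J))"
    have h1: "1 \<le> real (card H)" using False finH by (simp add: Suc_le_eq card_gt_0_iff)
    have tu: "real t = (\<Sum>k\<in>H. u k)" unfolding t_def u_def by simp
    have "(\<Sum>k\<in>H. rho) \<le> (\<Sum>k\<in>H. u k)" by (rule sum_mono) (auto simp: H_def)
    then have trho: "real (card H) * rho \<le> real t" by (simp add: tu)
    have tpos: "0 < t" using trho h1 rho by (cases t) (auto simp: mult_le_0_iff)
    have "real t * (ln (real t * real B / (real (card J) * al * real (card H))) - 1)
        \<le> (real (card J) + 5) * l + real (card H) * (1 + ln (real M / real (card H)))"
      by (rule col_sparse[OF J(1) _ _ J(2) False t_def tpos]) (use K in \<open>auto simp: H_def\<close>)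
    also have "\<dots> \<le> 6 * r * l + real (card H) * l"
    proof (rule add_mono)
      have "real (card J) + 5 \<le> 6 * r" using r r1 by linarith
      then show "(real (card J) + 5) * l \<le> 6 * r * l" using params(3) by (intro mult_right_mono) auto
      have "ln (real M / real (card H)) \<le> ln (real M)"
        using h1 params(12) by (intro ln_mono_div) (auto simp: divide_le_eq)
      then show "real (card H) * (1 + ln (real M / real (card H))) \<le> real (card H) * l"
        using params(11) by (intro mult_left_mono) auto
    qed
    \<comment> \<open>Each column of \<open>H\<close> carries more than \<open>rho\<close>
      incidences, so its cost \<open>l\<close> is spread over them; this is the term
      \<open>l / rho\<close> subtracted in \<open>big\<close>.\<close>
    also have "real (card H) * l \<le> real t * (l / rho)"
      using trho rho params(3) by (simp add: field_simps)
    finally have main: "real t * (ln (real t * real B / (real (card J) * al * real (card H))) - 1)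
      \<le> 6 * r * l + real t * (l / rho)" by simp
    have "rho * real B / (r * al) \<le> rho * real B / (real (card J) * al)"
      using r r1 rho al_pos by (intro divide_left_mono mult_right_mono) auto
    also have "\<dots> = real (card H) * rho * real B / (real (card J) * al * real (card H))"
      using h1 by (simp add: field_simps)
    also have "\<dots> \<le> real t * real B / (real (card J) * al * real (card H))"
      using trho al_pos by (intro divide_right_mono mult_right_mono) auto
    finally have "ln (rho * real B / (r * al)) \<le> ln (real t * real B / (real (card J) * al * real (card H)))"
      using B_pos r r1 rho al_pos by (intro ln_mono_div) auto
    then have "real t * (lam + l / rho) \<le> real t * (ln (real t * real B / (real (card J) * al * real (card H))) - 1)"
      using big by (intro mult_left_mono) auto
    then have "real t * lam \<le> 6 * r * l" using main by (simp add: algebra_simps)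
    then have "real t \<le> 6 * r * l / lam" using lam by (simp add: field_simps)
    then have "al * real t \<le> al * (6 * r * l / lam)" using al_pos by (intro mult_left_mono) auto
    also have "\<dots> = 36 * sn * r / lam" using params(3,4) by simp
    finally show ?thesis by (simp add: tu)
  qed
  have "(\<Sum>k\<in>K. a k * u k) \<le> (\<Sum>k\<in>K. rho * a k + (if k \<in> H then al * u k else 0))"
  proof (rule sum_mono)
    fix k assume k: "k \<in> K"
    have a0: "0 \<le> a k" "0 \<le> u k" by (auto simp: a_def u_def)
    show "a k * u k \<le> rho * a k + (if k \<in> H then al * u k else 0)"
    proof (cases "k \<in> H")
      case True
      have "a k * u k \<le> al * u k" using a_al[OF k] a0 by (intro mult_right_mono)
      then show ?thesis using True rho a0 by (simp add: add_increasing)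
    next
      case False
      then have "u k \<le> rho" using k by (auto simp: H_def)
      then have "a k * u k \<le> a k * rho" using a0 by (intro mult_left_mono)
      then show ?thesis using False by (simp add: mult.commute)
    qed
  qed
  also have "\<dots> = rho * (\<Sum>k\<in>K. a k) + al * (\<Sum>k\<in>H. u k)"
  proof -
    have "K \<inter> H = H" by (auto simp: H_def)
    then show ?thesis using finK by (simp add: sum.distrib sum.If_cases sum_distrib_left)
  qed
  also have "\<dots> \<le> rho * (d * real m) + 36 * sn * r / lam"
  proof (rule add_mono)
    have "(\<Sum>k\<in>K. a k) \<le> (\<Sum>k<M. a k)" using K by (intro sum_mono2) (auto simp: a_def)
    also have "\<dots> \<le> d * real m" using total_incidences[OF S(1)] S(2) by (simp add: a_def)
    finally show "rho * (\<Sum>k\<in>K. a k) \<le> rho * (d * real m)" using rho by (intro mult_left_mono) auto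
  qed (use high in simp)
  finally show ?thesis unfolding a_def u_def .
qed

text \<open>By \<open>card_meets_le\<close> the pairs of meeting columns are counted through common
  vertices. Light vertices give four times the sum in \<open>spread\<close>; at a heavy vertex at
  most \<open>d\<close> columns of \<open>K\<close> arrive, each with at most \<open>al\<close>
  vertices of \<open>S\<close>.\<close>

lemma meeting_incidences:
  assumes S: "S \<subseteq> {..<n}" "card S = m"
    and J: "J \<subseteq> {..<M}" and K: "K \<subseteq> {..<M}" "J \<inter> K = {}"
    and r: "real (card J) \<le> r" "0 \<le> r" and rho: "0 < rho" and lam: "0 < lam"
    and big: "lam \<le> ln (rho * real B / (r * al)) - 1 - l / rho" "9/20 * l \<le> ln (5 * real B / r) - 1"
  shows "(\<Sum>j\<in>J. \<Sum>k\<in>K. if meets j k then real (card (S \<inter> A k)) else 0)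
    \<le> 4 * (rho * (d * real m) + 36 * sn * r / lam) + 24 * r * (d * al)"
proof (cases "J = {}")
  case True
  have "0 \<le> 4 * (rho * (d * real m) + 36 * sn * r / lam) + 24 * r * (d * al)"
    using rho lam d_pos al_pos r params(2) by simp
  then show ?thesis using True by simp
next
  case False
  define V where "V = {v\<in>{..<n}. 5 \<le> mult J v}"
  define a where "a k = real (card (S \<inter> A k))" for k
  have finK: "finite K" "finite J" using J K by (auto intro: finite_below)
  have finV: "finite V" by (auto simp: V_def)
  have a_al: "a k \<le> al" if "k < M" for k
    unfolding a_def using that by (rule card_Int_column_le)
  have "(\<Sum>j\<in>J. \<Sum>k\<in>K. if meets j k then a k else 0) = (\<Sum>k\<in>K. \<Sum>j\<in>J. if meets j k then a k else 0)"
    by (rule sum.swap)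
  also have "\<dots> = (\<Sum>k\<in>K. a k * real (card {j\<in>J. meets j k}))"
    using finK by (intro sum.cong) (auto simp: sum.If_cases Int_def)
  also have "\<dots> \<le> (\<Sum>k\<in>K. a k * (4 * real (card (A k \<inter> U J)) + real (\<Sum>v\<in>A k \<inter> V. mult J v)))"
  proof (intro sum_mono mult_left_mono)
    fix k assume "k \<in> K"
    then have "k < M" using K by auto
    then have "card {j\<in>J. meets j k} \<le> 4 * card (A k \<inter> U J) + (\<Sum>v\<in>A k \<inter> V. mult J v)"
      unfolding V_def by (rule card_meets_le[OF J])
    from of_nat_mono[OF this, where 'a = real]
    show "real (card {j\<in>J. meets j k}) \<le> 4 * real (card (A k \<inter> U J)) + real (\<Sum>v\<in>A k \<inter> V. mult J v)"
      by simp
  qed (simp add: a_def)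
  also have "\<dots> = 4 * (\<Sum>k\<in>K. a k * real (card (A k \<inter> U J))) + (\<Sum>k\<in>K. a k * real (\<Sum>v\<in>A k \<inter> V. mult J v))"
    by (simp add: distrib_left sum.distrib sum_distrib_left mult.assoc mult.left_commute)
  also have "\<dots> \<le> 4 * (rho * (d * real m) + 36 * sn * r / lam) + 24 * r * (d * al)"
  proof (intro add_mono mult_left_mono)
    show "(\<Sum>k\<in>K. a k * real (card (A k \<inter> U J))) \<le> rho * (d * real m) + 36 * sn * r / lam"
      unfolding a_def by (rule spread[OF S J False K r(1) rho lam big(1)])
    have "(\<Sum>k\<in>K. a k * real (\<Sum>v\<in>A k \<inter> V. mult J v))
        = (\<Sum>k\<in>K. \<Sum>v\<in>V. if v \<in> A k then a k * real (mult J v) else 0)"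
      using finV by (intro sum.cong) (auto simp: sum.If_cases sum_distrib_left Int_def conj_commute)
    also have "\<dots> = (\<Sum>v\<in>V. \<Sum>k\<in>K. if v \<in> A k then a k * real (mult J v) else 0)" by (rule sum.swap)
    also have "\<dots> \<le> (\<Sum>v\<in>V. real (mult J v) * (d * al))"
    proof (rule sum_mono)
      fix v assume "v \<in> V"
      then have vn: "v < n" by (auto simp: V_def)
      have "(\<Sum>k\<in>K. if v \<in> A k then a k * real (mult J v) else 0) = (\<Sum>k\<in>{k\<in>K. v \<in> A k}. a k * real (mult J v))"
        using finK by (simp add: sum.If_cases Int_def)
      also have "\<dots> \<le> (\<Sum>k\<in>{k\<in>K. v \<in> A k}. al * real (mult J v))"
        using K a_al by (intro sum_mono mult_right_mono) auto
      also have "\<dots> = real (card {k\<in>K. v \<in> A k}) * (al * real (mult J v))" by simp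
      also have "\<dots> \<le> d * (al * real (mult J v))"
      proof (rule mult_right_mono)
        have "card {k\<in>K. v \<in> A k} \<le> card (I v)" using K by (intro card_mono) (auto simp: cols_def)
        then show "real (card {k\<in>K. v \<in> A k}) \<le> d" using cols_le[OF vn] by simp
      qed (use al_pos in auto)
      finally show "(\<Sum>k\<in>K. if v \<in> A k then a k * real (mult J v) else 0) \<le> real (mult J v) * (d * al)"
        by (simp add: mult_ac)
    qed
    also have "\<dots> = real (\<Sum>v\<in>V. mult J v) * (d * al)" by (simp add: sum_distrib_right)
    also have "\<dots> \<le> 24 * r * (d * al)"
      using sum_mult_heavy[OF J False r(1) big(2)] d_pos al_pos unfolding V_def by (intro mult_right_mono) auto
    finally show "(\<Sum>k\<in>K. a k * real (\<Sum>v\<in>A k \<inter> V. mult J v)) \<le> 24 * r * (d * al)" .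
  qed simp
  finally show ?thesis unfolding a_def .
qed

lemma card_apexes_le:
  assumes S: "S \<subseteq> {..<n}" and j: "j < M"
  shows "real (card (S \<inter> apexes j)) \<le> (\<Sum>k\<in>{..<M}-{j}. if meets j k then real (card (S \<inter> A k)) else 0)"
proof -
  define K where "K = {k\<in>{..<M}-{j}. meets j k}"
  have finS: "finite S" using S by (auto intro: finite_below)
  have finK: "finite K" by (auto simp: K_def)
  have "S \<inter> apexes j \<subseteq> (\<Union>k\<in>K. S \<inter> A k)"
  proof
    fix y assume "y \<in> S \<inter> apexes j"
    then have y: "y \<in> S" "y \<notin> A j" "2 \<le> card (A j \<inter> U (I y))" by (auto simp: apexes_def rich_def)
    then have "A j \<inter> U (I y) \<noteq> {}" by (intro notI) simp
    then obtain z k where "z \<in> A j" "k \<in> I y" "z \<in> A k" by blast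
    then have "k \<in> K" "y \<in> A k" using y by (auto simp: K_def meets_def cols_def)
    then show "y \<in> (\<Union>k\<in>K. S \<inter> A k)" using y by blast
  qed
  then have "card (S \<inter> apexes j) \<le> card (\<Union>k\<in>K. S \<inter> A k)" using finS finK by (intro card_mono) auto
  also have "\<dots> \<le> (\<Sum>k\<in>K. card (S \<inter> A k))" by (rule card_UN_le[OF finK])
  finally have "real (card (S \<inter> apexes j)) \<le> real (\<Sum>k\<in>K. card (S \<inter> A k))" by (rule of_nat_mono)
  also have "\<dots> = (\<Sum>k\<in>{..<M}-{j}. if meets j k then real (card (S \<inter> A k)) else 0)"
    unfolding K_def by (simp add: sum.If_cases Int_def)
  finally show ?thesis .
qed

text \<open>An apex of a column \<open>j\<close> lies in some column meeting \<open>j\<close>. Cutting the heavy columns into two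
  classes makes the two columns involved independent, so that the second entropy condition applies.\<close>
lemma few_heavy_apexes:
  assumes S: "S \<subseteq> {..<n}" "card S = m"
    and beta: "0 < beta" and r: "1 \<le> r" and rho: "0 < rho" and lam: "0 < lam"
    and big: "lam \<le> ln (rho * real B / (real r * al)) - 1 - l / rho" "9/20 * l \<le> ln (5 * real B / real r) - 1"
    and small: "5 * (4 * (rho * (d * real m) + 36 * sn * real r / lam) + 24 * real r * (d * al)) \<le> real r * (beta * real m)"
  shows "card {j. j < M \<and> beta * real m < real (card (S \<inter> apexes j))} < r"
proof (rule ccontr)
  assume "\<not> ?thesis"
  then have "r \<le> card {j. j < M \<and> beta * real m < real (card (S \<inter> apexes j))}" by simp
  then obtain J where J: "J \<subseteq> {j. j < M \<and> beta * real m < real (card (S \<inter> apexes j))}" "card J = r"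
    by (rule obtain_subset_with_card_n)
  have JM: "J \<subseteq> {..<M}" using J by auto
  have finJ: "finite J" using JM by (auto intro: finite_below)
  have neJ: "J \<noteq> {}" using J r by auto
  define X where "X = 4 * (rho * (d * real m) + 36 * sn * real r / lam) + 24 * real r * (d * al)"
  define w where "w j k = (if meets j k then real (card (S \<inter> A k)) else 0)" for j k
  have w0: "0 \<le> w j k" for j k by (simp add: w_def)
  obtain J1 where J1: "J1 \<subseteq> J" and cut: "(\<Sum>j\<in>J. \<Sum>k\<in>J-{j}. w j k) \<le> 4 * (\<Sum>j\<in>J1. \<Sum>k\<in>J-J1. w j k)"
    using large_cut[of J w, OF finJ w0] by blast
  have "card J1 \<le> r" using card_mono[OF finJ J1] J by simp
  then have c1: "(\<Sum>j\<in>J1. \<Sum>k\<in>J-J1. w j k) \<le> X"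
    unfolding w_def X_def using J1 JM
    by (intro meeting_incidences[OF S _ _ _ _ _ rho lam big]) auto
  have c2: "(\<Sum>j\<in>J. \<Sum>k\<in>{..<M}-J. w j k) \<le> X"
    unfolding w_def X_def using JM J(2)
    by (intro meeting_incidences[OF S _ _ _ _ _ rho lam big]) auto
  have "real r * (beta * real m) = (\<Sum>j\<in>J. beta * real m)" using J by simp
  also have "\<dots> < (\<Sum>j\<in>J. real (card (S \<inter> apexes j)))"
    using J finJ neJ by (intro sum_strict_mono) auto
  also have "\<dots> \<le> (\<Sum>j\<in>J. \<Sum>k\<in>{..<M}-{j}. w j k)"
    unfolding w_def using JM by (intro sum_mono card_apexes_le[OF S(1)]) auto
  also have "\<dots> = (\<Sum>j\<in>J. (\<Sum>k\<in>{..<M}-J. w j k) + (\<Sum>k\<in>J-{j}. w j k))"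
  proof (rule sum.cong)
    fix j assume "j \<in> J"
    then have e: "{..<M}-{j} = ({..<M}-J) \<union> (J-{j})" using JM by auto
    show "(\<Sum>k\<in>{..<M}-{j}. w j k) = (\<Sum>k\<in>{..<M}-J. w j k) + (\<Sum>k\<in>J-{j}. w j k)"
      unfolding e using finJ by (intro sum.union_disjoint) auto
  qed simp
  also have "\<dots> = (\<Sum>j\<in>J. \<Sum>k\<in>{..<M}-J. w j k) + (\<Sum>j\<in>J. \<Sum>k\<in>J-{j}. w j k)" by (rule sum.distrib)
  \<comment> \<open>One \<open>X\<close> comes from the columns outside \<open>J\<close>; the pairs
    inside \<open>J\<close> lose the factor 4 of the cut. This explains the 5 in the hypothesis
    \<open>small\<close>.\<close>
  also have "\<dots> \<le> X + 4 * X" using c1 c2 cut by linarith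
  finally have "real r * (beta * real m) < 5 * X" by simp
  then show False using small unfolding X_def by linarith
qed

text \<open>A random column has at most \<open>1/4\<close> vertices of \<open>S\<close> on average,
  so an incidence in a column with more than \<open>eta * l\<close> of them gains about
  \<open>ln (4 * eta * l)\<close>; the column itself is paid for by \<open>1 / eta\<close> per
  incidence. The point is the factor \<open>1 / g\<close> saved over the trivial order
  \<open>m * l\<close>.\<close>

lemma frequent_incidences:
  assumes S: "S \<subseteq> {..<n}" "card S = m" and eta: "0 < eta" and g: "0 < g"
    and big: "g / 2 \<le> ln (4 * eta * l) - 1 - 1 / eta"
  shows "(\<Sum>j\<in>{j. j < M \<and> eta * l < real (card (S \<inter> A j))}. real (card (S \<inter> A j))) \<le> 4 * real m * l / g"
proof -
  define J where "J = {j. j < M \<and> eta * l < real (card (S \<inter> A j))}"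
  define t where "t = (\<Sum>j\<in>J. card (S \<inter> A j))"
  have finJ: "finite J" by (auto simp: J_def)
  have m5: "5 \<le> real m" using params(13) by simp
  show ?thesis
  proof (cases "J = {}")
    case True
    then show ?thesis using g m5 params(3) unfolding J_def[symmetric] by simp
  next
    case False
    have j1: "1 \<le> real (card J)" using False finJ by (simp add: Suc_le_eq card_gt_0_iff)
    have "(\<Sum>j\<in>J. eta * l) \<le> (\<Sum>j\<in>J. real (card (S \<inter> A j)))" by (rule sum_mono) (auto simp: J_def)
    then have tl: "real (card J) * (eta * l) \<le> real t" by (simp add: t_def)
    have el: "0 < eta * l" using eta params(3) by simp
    have "0 < real (card J) * (eta * l)" using mult_pos_pos[OF _ el] j1 by simp
    then have tpos: "0 < t" using tl by linarith
    have Sne: "S \<noteq> {}" using S(2) m5 by auto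
    have main: "real t * (ln (real t * real B / (real (card S) * real (card J))) - 1) \<le> (real (card S) + real (card J) + 5) * l"
      by (rule sparse[OF S(1) _ Sne False t_def tpos]) (auto simp: J_def)
    have "4 * eta * l = (real (card J) * (eta * l)) * (4 * real m) / (real m * real (card J))"
      using j1 m5 by (simp add: field_simps)
    also have "\<dots> \<le> real t * real B / (real m * real (card J))"
      using tl el params(8) by (intro divide_right_mono mult_mono) auto
    finally have "ln (4 * eta * l) \<le> ln (real t * real B / (real m * real (card J)))"
      using el by (intro ln_mono_div) auto
    then have "real t * (g / 2 + 1 / eta) \<le> real t * (ln (real t * real B / (real m * real (card J))) - 1)"
      using big by (intro mult_left_mono) auto
    also have "\<dots> \<le> (real m + real (card J) + 5) * l" using main S(2) by simp
    also have "\<dots> \<le> 2 * real m * l + real t / eta"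
    proof -
      have "real (card J) * l \<le> real t / eta" using tl eta by (simp add: field_simps)
      moreover have "5 * l \<le> real m * l" using m5 params(3) by simp
      ultimately show ?thesis by (simp add: algebra_simps)
    qed
    finally have "real t * g \<le> 4 * real m * l" by (simp add: algebra_simps)
    then have "real t \<le> 4 * real m * l / g" using g by (simp add: field_simps)
    then show ?thesis unfolding t_def J_def by simp
  qed
qed

text \<open>When \<open>r\<close> is tiny compared with \<open>B\<close>, every incidence gains a
  constant fraction of \<open>l\<close>, while vertices and columns together cost at most
  \<open>2 * m * l\<close>. So the number of incidences has order \<open>m\<close>, without the
  factor \<open>l\<close> of the general bound.\<close>

lemma few_columns_incidences:
  assumes S: "S \<subseteq> {..<n}" "card S = m" and J: "J \<subseteq> {..<M}" and r: "card J \<le> r" "r + 5 \<le> m"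
    and big: "2/5 * l \<le> ln (8 * real B / real r) - 1"
  shows "(\<Sum>j\<in>J. real (card (S \<inter> A j))) \<le> 8 * real m"
proof (rule ccontr)
  define t where "t = (\<Sum>j\<in>J. card (S \<inter> A j))"
  assume "\<not> ?thesis"
  then have t: "8 * real m < real t" by (simp add: t_def)
  have finJ: "finite J" using J by (auto intro: finite_below)
  have m5: "5 \<le> real m" using params(13) by simp
  have tpos: "0 < t" using t m5 by (cases t) auto
  have neJ: "J \<noteq> {}" using tpos by (auto simp: t_def)
  have j1: "1 \<le> real (card J)" using neJ finJ by (simp add: Suc_le_eq card_gt_0_iff)
  have Sne: "S \<noteq> {}" using S(2) m5 by auto
  have main: "real t * (ln (real t * real B / (real (card S) * real (card J))) - 1) \<le> (real (card S) + real (card J) + 5) * l"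
    by (rule sparse[OF S(1) J Sne neJ t_def tpos])
  have rJ: "real (card J) \<le> real r" using r by simp
  have "8 * real B / real r \<le> 8 * real B / real (card J)"
    using rJ j1 by (intro divide_left_mono) auto
  also have "\<dots> = 8 * real m * real B / (real m * real (card J))" using m5 by simp
  also have "\<dots> \<le> real t * real B / (real m * real (card J))"
    using t by (intro divide_right_mono mult_right_mono) auto
  finally have "ln (8 * real B / real r) \<le> ln (real t * real B / (real m * real (card J)))"
    using B_pos rJ j1 by (intro ln_mono_div) auto
  then have "real t * (2/5 * l) \<le> real t * (ln (real t * real B / (real m * real (card J))) - 1)"
    using big by (intro mult_left_mono) auto
  also have "\<dots> \<le> (real m + real (card J) + 5) * l" using main S(2) by simp
  also have "\<dots> \<le> (2 * real m) * l"
    using r params(3) by (intro mult_right_mono) auto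
  finally have "real t * (2/5) \<le> 2 * real m" using params(3) by simp
  then show False using t m5 by linarith
qed

section \<open>Counting sharing and dangerous pairs inside a set\<close>

lemma sum_card_apexes:
  assumes S: "S \<subseteq> {..<n}" "card S = m" and x: "\<And>y. y < n \<Longrightarrow> real (card (rich 2 y)) \<le> x"
  shows "(\<Sum>j<M. real (card (S \<inter> apexes j))) \<le> real m * x"
proof -
  have finS: "finite S" using S by (auto intro: finite_below)
  have "(\<Sum>j<M. real (card (S \<inter> apexes j))) = real (\<Sum>y\<in>S. card {j\<in>{..<M}. y \<in> apexes j})"
    by (subst sum_incidences[OF finS, symmetric]) auto
  also have "\<dots> = (\<Sum>y\<in>S. real (card (rich 2 y)))"
    unfolding of_nat_sum using S by (intro sum.cong) (auto simp: apexes_def rich_def intro!: arg_cong[where f = card])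
  also have "\<dots> \<le> (\<Sum>y\<in>S. x)" using S by (intro sum_mono x) auto
  finally show ?thesis using S by simp
qed

text \<open>The columns are split by the number of their vertices in \<open>S\<close> and, if that number is large, by the
  number of their apexes in \<open>S\<close>, with the two thresholds \<open>b1 * m\<close> and \<open>b2 * m\<close>.\<close>
lemma fan_sum:
  assumes S: "S \<subseteq> {..<n}" "card S = m" and x: "\<And>y. y < n \<Longrightarrow> real (card (rich 2 y)) \<le> x"
    and eta: "0 < eta" and g: "0 < g" and big: "g / 2 \<le> ln (4 * eta * l) - 1 - 1 / eta"
    and b1: "0 < b1" "card {j. j < M \<and> b1 * real m < real (card (S \<inter> apexes j))} < r1"
    and r1: "r1 + 5 \<le> m" "2/5 * l \<le> ln (8 * real B / real r1) - 1"
    and b2: "0 < b2" "card {j. j < M \<and> b2 * real m < real (card (S \<inter> apexes j))} < r2"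
  shows "(\<Sum>j<M. real (card (S \<inter> A j)) * real (card (S \<inter> apexes j)))
    \<le> eta * l * (real m * x) + b1 * real m * (4 * real m * l / g) + b2 * real m * (8 * real m) + real r2 * (al * real m)"
proof -
  define a where "a j = real (card (S \<inter> A j))" for j
  define b where "b j = real (card (S \<inter> apexes j))" for j
  define H where "H = {j. j < M \<and> eta * l < a j}"
  define J1 where "J1 = {j. j < M \<and> b1 * real m < b j}"
  define J2 where "J2 = {j. j < M \<and> b2 * real m < b j}"
  have finS: "finite S" using S by (auto intro: finite_below)
  have a0: "0 \<le> a j" "0 \<le> b j" for j by (auto simp: a_def b_def)
  have bm: "b j \<le> real m" for j unfolding b_def using card_mono[OF finS, of "S \<inter> apexes j"] S by auto
  have a_al: "a j \<le> al" if "j < M" for j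
    unfolding a_def using that by (rule card_Int_column_le)
  have el: "0 < eta * l" using eta params(3) by simp
  have "(\<Sum>j<M. a j * b j) \<le> (\<Sum>j<M. eta * l * b j + (if j \<in> H then b1 * real m * a j else 0) +
      (if j \<in> J1 then b2 * real m * a j else 0) + (if j \<in> J2 then al * real m else 0))"
  proof (rule sum_mono)
    fix j assume "j \<in> {..<M}"
    then have j: "j < M" by simp
    define p1 p2 p3 p4 where "p1 = eta * l * b j" and "p2 = (if j \<in> H then b1 * real m * a j else 0)"
      and "p3 = (if j \<in> J1 then b2 * real m * a j else 0)" and "p4 = (if j \<in> J2 then al * real m else 0)"
    have nn: "0 \<le> p1" "0 \<le> p2" "0 \<le> p3" "0 \<le> p4"
      using el a0 b1(1) b2(1) al_pos by (auto simp: p1_def p2_def p3_def p4_def)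
    consider "j \<notin> H" | "j \<in> H" "j \<notin> J1" | "j \<in> J1" "j \<notin> J2" | "j \<in> J2" by blast
    then have "a j * b j \<le> p1 \<or> a j * b j \<le> p2 \<or> a j * b j \<le> p3 \<or> a j * b j \<le> p4"
    proof cases
      case 1
      then have "a j * b j \<le> eta * l * b j" using j a0 by (intro mult_right_mono) (auto simp: H_def)
      then show ?thesis by (simp add: p1_def)
    next
      case 2
      then have "a j * b j \<le> a j * (b1 * real m)" using j a0 by (intro mult_left_mono) (auto simp: J1_def)
      then show ?thesis using 2 by (simp add: p2_def mult_ac)
    next
      case 3
      then have "a j * b j \<le> a j * (b2 * real m)" using j a0 by (intro mult_left_mono) (auto simp: J2_def)
      then show ?thesis using 3 by (simp add: p3_def mult_ac)
    next
      case 4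
      have "a j * b j \<le> al * real m" using a_al[OF j] bm a0 al_pos by (intro mult_mono) auto
      then show ?thesis using 4 by (simp add: p4_def)
    qed
    then have "a j * b j \<le> p1 + p2 + p3 + p4" using nn by linarith
    then show "a j * b j \<le> eta * l * b j + (if j \<in> H then b1 * real m * a j else 0) +
      (if j \<in> J1 then b2 * real m * a j else 0) + (if j \<in> J2 then al * real m else 0)"
      unfolding p1_def p2_def p3_def p4_def .
  qed
  also have "\<dots> = eta * l * (\<Sum>j<M. b j) + b1 * real m * (\<Sum>j\<in>H. a j) + b2 * real m * (\<Sum>j\<in>J1. a j) + real (card J2) * (al * real m)"
  proof -
    have "{..<M} \<inter> H = H" "{..<M} \<inter> J1 = J1" "{..<M} \<inter> J2 = J2" by (auto simp: H_def J1_def J2_def)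
    then show ?thesis by (simp add: sum.distrib sum.If_cases sum_distrib_left)
  qed
  also have "\<dots> \<le> eta * l * (real m * x) + b1 * real m * (4 * real m * l / g) + b2 * real m * (8 * real m) + real r2 * (al * real m)"
  proof (intro add_mono mult_left_mono)
    show "(\<Sum>j<M. b j) \<le> real m * x" unfolding b_def by (rule sum_card_apexes[OF S x])
    show "(\<Sum>j\<in>H. a j) \<le> 4 * real m * l / g"
      unfolding a_def H_def by (rule frequent_incidences[OF S eta g big])
    show "(\<Sum>j\<in>J1. a j) \<le> 8 * real m"
      unfolding a_def using b1(2)
      by (intro few_columns_incidences[OF S _ _ r1]) (auto simp: J1_def b_def)
    show "real (card J2) * (al * real m) \<le> real r2 * (al * real m)"
      using b2(2) al_pos by (intro mult_right_mono) (auto simp: J2_def b_def)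
  qed (use el b1 b2 in auto)
  finally show ?thesis unfolding a_def b_def .
qed

lemma card_fan_pairs:
  assumes S: "S \<subseteq> {..<n}"
  shows "real (card {(x, y) \<in> S \<times> S. fan x y}) \<le> (\<Sum>j<M. real (card (S \<inter> A j)) * real (card (S \<inter> apexes j)))"
proof -
  have finS: "finite S" using S by (auto intro: finite_below)
  have "{(x, y) \<in> S \<times> S. fan x y} \<subseteq> (\<Union>j\<in>{..<M}. (S \<inter> A j) \<times> (S \<inter> apexes j))"
    unfolding fan_def by auto
  then have "card {(x, y) \<in> S \<times> S. fan x y} \<le> card (\<Union>j\<in>{..<M}. (S \<inter> A j) \<times> (S \<inter> apexes j))"
    using finS by (intro card_mono) auto
  also have "\<dots> \<le> (\<Sum>j<M. card ((S \<inter> A j) \<times> (S \<inter> apexes j)))" by (rule card_UN_le) simp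
  finally have "real (card {(x, y) \<in> S \<times> S. fan x y}) \<le> real (\<Sum>j<M. card ((S \<inter> A j) \<times> (S \<inter> apexes j)))"
    by (rule of_nat_mono)
  then show ?thesis by (simp add: card_cartesian_product)
qed

lemma card_sharing_pairs:
  assumes S: "S \<subseteq> {..<n}" "card S = m"
  shows "real (card {(x, y) \<in> S \<times> S. shares A M x y}) \<le> al * (d * real m)"
proof -
  have finS: "finite S" using S by (auto intro: finite_below)
  have "{(x, y) \<in> S \<times> S. shares A M x y} \<subseteq> (\<Union>j\<in>{..<M}. (S \<inter> A j) \<times> (S \<inter> A j))"
    unfolding shares_def by auto
  then have "card {(x, y) \<in> S \<times> S. shares A M x y} \<le> card (\<Union>j\<in>{..<M}. (S \<inter> A j) \<times> (S \<inter> A j))"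
    using finS by (intro card_mono) auto
  also have "\<dots> \<le> (\<Sum>j<M. card ((S \<inter> A j) \<times> (S \<inter> A j)))" by (rule card_UN_le) simp
  finally have "real (card {(x, y) \<in> S \<times> S. shares A M x y}) \<le> real (\<Sum>j<M. card ((S \<inter> A j) \<times> (S \<inter> A j)))"
    by (rule of_nat_mono)
  also have "\<dots> = (\<Sum>j<M. real (card (S \<inter> A j)) * real (card (S \<inter> A j)))" by (simp add: card_cartesian_product)
  also have "\<dots> \<le> (\<Sum>j<M. al * real (card (S \<inter> A j)))"
  proof (intro sum_mono mult_right_mono)
    fix j assume "j \<in> {..<M}"
    then have "j < M" by simp
    then show "real (card (S \<inter> A j)) \<le> al" by (rule card_Int_column_le)
  qed simp
  also have "\<dots> = al * real (\<Sum>j<M. card (S \<inter> A j))" by (simp add: sum_distrib_left)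
  also have "\<dots> \<le> al * (d * real m)"
    using total_incidences[OF S(1)] S(2) al_pos by (intro mult_left_mono) auto
  finally show ?thesis .
qed

lemma card_cross_pairs:
  assumes S: "S \<subseteq> {..<n}" "card S = m"
    and T: "\<And>y. y < n \<Longrightarrow> (\<Sum>j\<in>rich 2 y. real (card (A j \<inter> U (I y)))^2) \<le> x"
  shows "real (card {(u, y) \<in> S \<times> S. cross u y}) \<le> real m * (x * ka)"
proof -
  have finS: "finite S" using S by (auto intro: finite_below)
  have "{(u, y) \<in> S \<times> S. cross u y} = (\<Union>y\<in>S. {u\<in>S. cross u y} \<times> {y})" by auto
  then have "card {(u, y) \<in> S \<times> S. cross u y} \<le> (\<Sum>y\<in>S. card ({u\<in>S. cross u y} \<times> {y}))"
    using card_UN_le[OF finS] by metis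
  then have "real (card {(u, y) \<in> S \<times> S. cross u y}) \<le> real (\<Sum>y\<in>S. card ({u\<in>S. cross u y} \<times> {y}))"
    by (rule of_nat_mono)
  also have "\<dots> = (\<Sum>y\<in>S. real (card {u\<in>S. cross u y}))" by (simp add: card_cartesian_product)
  also have "\<dots> \<le> (\<Sum>y\<in>S. x * ka)" using S by (intro sum_mono card_cross_le[OF _ S(1) T]) auto
  finally show ?thesis using S by simp
qed

section \<open>Dangerous triples, blockers and good tuples\<close>

lemma shares_verts: "shares A M x y \<Longrightarrow> x < n \<and> y < n"
  using A_sub unfolding shares_def by blast

lemma card_nbhd_le:
  assumes "v < n" shows "real (card (U (I v))) \<le> d * al"
proof -
  have "card (U (I v)) \<le> (\<Sum>j\<in>I v. card (A j))" by (rule card_UN_le) simp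
  then have "real (card (U (I v))) \<le> real (\<Sum>j\<in>I v. card (A j))" by (rule of_nat_mono)
  also have "\<dots> \<le> (\<Sum>j\<in>I v. al)"
    unfolding of_nat_sum by (intro sum_mono size_le) (auto simp: cols_def)
  also have "\<dots> \<le> d * al" using cols_le[OF assms] al_pos by simp
  finally show ?thesis .
qed

text \<open>The fourth vertex \<open>w\<close> is reached from \<open>x\<close> and \<open>y\<close>
  through different columns, because \<open>x\<close> and \<open>y\<close> share none; this leaves
  at most \<open>ka\<close> choices. Then \<open>z\<close> lies in the neighbourhood of
  \<open>w\<close>, which has at most \<open>d * al\<close> vertices.\<close>

lemma card_triple_danger:
  assumes x: "x < n" and y: "y < n" and xy: "x \<noteq> y" "\<not> shares A M x y"
  shows "real (card {z. triple_danger A M x y z}) \<le> ka * (d * al)" "finite {z. triple_danger A M x y z}"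
proof -
  define W where "W = {v\<in>{..<n}-{x,y}. \<exists>k<M. \<exists>j<M. k \<noteq> j \<and> x \<in> A k \<and> y \<in> A j \<and> v \<in> A k \<and> v \<in> A j}"
  have finW: "finite W" by (auto simp: W_def)
  have Wn: "w < n" if "w \<in> W" for w using that by (auto simp: W_def)
  have finU: "finite (U (I w))" for w by (intro finite_U) (auto simp: cols_def)
  have pA: "v \<in> A i" if "v \<in> prune A i" for v i using that by (auto simp: prune_def)
  have sub: "{z. triple_danger A M x y z} \<subseteq> (\<Union>w\<in>W. U (I w))"
  proof
    fix z assume "z \<in> {z. triple_danger A M x y z}"
    then obtain w where w: "joined A M x w" "joined A M y w" "joined A M z w" unfolding triple_danger_def by blast
    obtain k where k: "k < M" "x \<in> A k" "w \<in> A k" using w(1) pA unfolding joined_def by blast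
    obtain j where j: "j < M" "y \<in> A j" "w \<in> A j" using w(2) pA unfolding joined_def by blast
    obtain p where p: "p < M" "z \<in> A p" "w \<in> A p" using w(3) pA unfolding joined_def by blast
    have "w \<noteq> x" "w \<noteq> y" using w unfolding joined_def by auto
    moreover have "w < n" using A_sub[OF k(1)] k(3) by auto
    moreover have "k \<noteq> j" using xy(2) k j unfolding shares_def by blast
    ultimately have "w \<in> W" using k j unfolding W_def by blast
    moreover have "z \<in> U (I w)" using p by (auto simp: cols_def)
    ultimately show "z \<in> (\<Union>w\<in>W. U (I w))" by blast
  qed
  show fin: "finite {z. triple_danger A M x y z}" using finW finU by (intro finite_subset[OF sub]) auto
  have "card {z. triple_danger A M x y z} \<le> card (\<Union>w\<in>W. U (I w))"
    using finW finU by (intro card_mono sub) auto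
  also have "\<dots> \<le> (\<Sum>w\<in>W. card (U (I w)))" by (rule card_UN_le[OF finW])
  finally have "real (card {z. triple_danger A M x y z}) \<le> real (\<Sum>w\<in>W. card (U (I w)))" by (rule of_nat_mono)
  also have "\<dots> \<le> (\<Sum>w\<in>W. d * al)" unfolding of_nat_sum by (intro sum_mono card_nbhd_le Wn)
  also have "\<dots> \<le> ka * (d * al)"
    using codeg_le[OF x y xy(1)] d_pos al_pos unfolding W_def[symmetric] by simp
  finally show "real (card {z. triple_danger A M x y z}) \<le> ka * (d * al)" .
qed

lemma card_blockers:
  assumes u: "\<And>a. a < s \<Longrightarrow> u a < n" "\<And>a b. a < s \<Longrightarrow> b < s \<Longrightarrow> a \<noteq> b \<Longrightarrow> u a \<noteq> u b \<and> \<not> shares A M (u a) (u b)"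
  shows "real (card (blockers A M s u)) \<le> real s * (d * al) + real s ^ 2 * (ka * (d * al))"
proof -
  define P where "P = {ab\<in>{..<s}\<times>{..<s}. fst ab \<noteq> snd ab}"
  have finP: "finite P" by (auto simp: P_def)
  have cP: "card P \<le> s * s"
    using card_mono[of "{..<s}\<times>{..<s}" P] by (auto simp: P_def card_cartesian_product)
  have e1: "{z. \<exists>a<s. shares A M (u a) z} = (\<Union>a<s. U (I (u a)))"
    by (auto simp: shares_def cols_def)
  have e2: "{z. \<exists>a<s. \<exists>b<s. a \<noteq> b \<and> triple_danger A M (u a) (u b) z}
     = (\<Union>ab\<in>P. {z. triple_danger A M (u (fst ab)) (u (snd ab)) z})"
  proof -
    have "(\<Union>ab\<in>P. Z (fst ab) (snd ab)) = {z. \<exists>a<s. \<exists>b<s. a \<noteq> b \<and> z \<in> Z a b}" for Z :: "nat \<Rightarrow> nat \<Rightarrow> nat set"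
      unfolding P_def by force
    from this[of "\<lambda>a b. {z. triple_danger A M (u a) (u b) z}"] show ?thesis by simp
  qed
  have "card (blockers A M s u) \<le> card (\<Union>a<s. U (I (u a)))
      + card (\<Union>ab\<in>P. {z. triple_danger A M (u (fst ab)) (u (snd ab)) z})"
    unfolding blockers_def e1 e2 by (rule card_Un_le)
  also have "\<dots> \<le> (\<Sum>a<s. card (U (I (u a)))) + (\<Sum>ab\<in>P. card {z. triple_danger A M (u (fst ab)) (u (snd ab)) z})"
    using finP by (intro add_mono card_UN_le) auto
  finally have "real (card (blockers A M s u))
      \<le> real ((\<Sum>a<s. card (U (I (u a)))) + (\<Sum>ab\<in>P. card {z. triple_danger A M (u (fst ab)) (u (snd ab)) z}))"
    by (rule of_nat_mono)
  also have "\<dots> = (\<Sum>a<s. real (card (U (I (u a))))) + (\<Sum>ab\<in>P. real (card {z. triple_danger A M (u (fst ab)) (u (snd ab)) z}))"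
    by simp
  also have "\<dots> \<le> (\<Sum>a<s. d * al) + (\<Sum>ab\<in>P. ka * (d * al))"
  proof (intro add_mono sum_mono)
    fix a assume "a \<in> {..<s}"
    then show "real (card (U (I (u a)))) \<le> d * al" using u(1) by (intro card_nbhd_le) auto
  next
    fix ab assume "ab \<in> P"
    then have "fst ab < s" "snd ab < s" "fst ab \<noteq> snd ab" by (auto simp: P_def)
    then show "real (card {z. triple_danger A M (u (fst ab)) (u (snd ab)) z}) \<le> ka * (d * al)"
      using u by (intro card_triple_danger(1)) auto
  qed
  also have "\<dots> \<le> real s * (d * al) + real s ^ 2 * (ka * (d * al))"
  proof -
    have "real (card P) \<le> real s ^ 2" using of_nat_mono[OF cP, where 'a = real] by (simp add: power2_eq_square)
    then show ?thesis using params(6) d_pos al_pos by (simp add: mult_right_mono)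
  qed
  finally show ?thesis .
qed

lemma finite_blockers:
  assumes u: "\<And>a. a < s \<Longrightarrow> u a < n" "\<And>a b. a < s \<Longrightarrow> b < s \<Longrightarrow> a \<noteq> b \<Longrightarrow> u a \<noteq> u b \<and> \<not> shares A M (u a) (u b)"
  shows "finite (blockers A M s u)"
proof -
  have "{z. \<exists>a<s. shares A M (u a) z} \<subseteq> {..<n}" using shares_verts by auto
  moreover have "{z. \<exists>a<s. \<exists>b<s. a \<noteq> b \<and> triple_danger A M (u a) (u b) z}
     \<subseteq> (\<Union>a<s. \<Union>b\<in>{b. b < s \<and> a \<noteq> b}. {z. triple_danger A M (u a) (u b) z})" by auto
  moreover have "finite (\<Union>a<s. \<Union>b\<in>{b. b < s \<and> a \<noteq> b}. {z. triple_danger A M (u a) (u b) z})"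
    using u by (intro finite_UN_I card_triple_danger(2)) auto
  ultimately show ?thesis unfolding blockers_def using finite_subset by (auto intro: finite_below)
qed

text \<open>Union bound over pairs and triples of positions: bad pairs spoil at most a quarter of
  the \<open>m ^ s\<close> tuples, and so do bad triples. All obstructions are measured at the final
  stage \<open>M\<close>, where they are largest, so one count serves every
  \<open>i\<close>.\<close>

lemma many_good_tuples:
  assumes S: "S \<subseteq> {..<n}" "card S = m" and i: "i \<le> M"
    and F: "(\<Sum>j<M. real (card (S \<inter> A j)) * real (card (S \<inter> apexes j))) \<le> F"
    and T: "\<And>y. y < n \<Longrightarrow> (\<Sum>j\<in>rich 2 y. real (card (A j \<inter> U (I y)))^2) \<le> x"
    and s: "3 \<le> s"
    and small: "real s ^ 2 * (real m + al * (d * real m) + 2 * F + real m * (x * ka)) \<le> real m ^ 2 / 4"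
      "real s ^ 3 * (ka * (d * al)) \<le> real m / 4"
      "4 * (real s * (d * al) + real s ^ 2 * (ka * (d * al))) \<le> real B"
  shows "real m ^ s \<le> 2 * real (card {u. good_tuple A i s S u \<and> 4 * card (blockers A i s u) \<le> B})"
proof -
  have finS: "finite S" using S by (auto intro: finite_below)
  have Sn: "v < n" if "v \<in> S" for v using that S by auto
  define \<Omega> where "\<Omega> = {..<s} \<rightarrow>\<^sub>E S"
  have fin\<Omega>: "finite \<Omega>" unfolding \<Omega>_def using finS by (intro finite_PiE) auto
  have c\<Omega>: "card \<Omega> = m ^ s" unfolding \<Omega>_def using S by (simp add: card_PiE)
  define P where "P = {(x, y) \<in> S \<times> S. x = y \<or> shares A M x y \<or> pair_danger A M x y}"
  \<comment> \<open>Triples whose first two vertices coincide or share a column are already caught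
    by \<open>P\<close>; for the remaining ones the codegree bound applies.\<close>
  define Q where "Q = {(x, y, z) \<in> S \<times> S \<times> S. x \<noteq> y \<and> \<not> shares A M x y \<and> triple_danger A M x y z}"
  define G where "G = {u. good_tuple A i s S u \<and> 4 * card (blockers A i s u) \<le> B}"
  have finG: "finite G" using fin\<Omega> by (rule finite_subset[rotated]) (auto simp: G_def \<Omega>_def good_tuple_def)
  define PP where "PP = {ab\<in>{..<s}\<times>{..<s}. fst ab \<noteq> snd ab}"
  define TT where "TT = {t\<in>{..<s}\<times>{..<s}\<times>{..<s}. fst t \<noteq> fst (snd t) \<and> snd (snd t) \<noteq> fst t \<and> snd (snd t) \<noteq> fst (snd t)}"
  define BP where "BP ab = {u\<in>\<Omega>. (u (fst ab), u (snd ab)) \<in> P}" for ab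
  define BT where "BT t = {u\<in>\<Omega>. (u (fst t), u (fst (snd t)), u (snd (snd t))) \<in> Q}" for t
  have fins: "finite PP" "finite TT" by (auto simp: PP_def TT_def)
  have cPP: "card PP \<le> s ^ 2"
    using card_mono[of "{..<s}\<times>{..<s}" PP] by (auto simp: PP_def card_cartesian_product power2_eq_square)
  have cTT: "card TT \<le> s ^ 3"
    using card_mono[of "{..<s}\<times>{..<s}\<times>{..<s}" TT] by (auto simp: TT_def card_cartesian_product power3_eq_cube)
  have cover: "\<Omega> \<subseteq> G \<union> (\<Union>ab\<in>PP. BP ab) \<union> (\<Union>t\<in>TT. BT t)"
  proof
    fix u assume u: "u \<in> \<Omega>"
    show "u \<in> G \<union> (\<Union>ab\<in>PP. BP ab) \<union> (\<Union>t\<in>TT. BT t)"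
    proof (rule ccontr)
      assume nu: "u \<notin> G \<union> (\<Union>ab\<in>PP. BP ab) \<union> (\<Union>t\<in>TT. BT t)"
      have uS: "u a \<in> S" if "a < s" for a using u that unfolding \<Omega>_def by auto
      have p: "u a \<noteq> u b \<and> \<not> shares A M (u a) (u b) \<and> \<not> pair_danger A M (u a) (u b)"
        if "a < s" "b < s" "a \<noteq> b" for a b
      proof -
        have "(a, b) \<in> PP" using that by (auto simp: PP_def)
        then have "u \<notin> BP (a, b)" using nu by blast
        then show ?thesis using u uS that unfolding BP_def P_def by auto
      qed
      have t: "\<not> triple_danger A M (u a) (u b) (u c)"
        if "a < s" "b < s" "c < s" "a \<noteq> b" "c \<noteq> a" "c \<noteq> b" for a b c
      proof -
        have "(a, b, c) \<in> TT" using that by (auto simp: TT_def)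
        then have "u \<notin> BT (a, b, c)" using nu by blast
        then show ?thesis using u uS that p[of a b] unfolding BT_def Q_def by auto
      qed
      have gt: "good_tuple A i s S u"
        unfolding good_tuple_def
      proof (intro conjI allI impI)
        show "u \<in> {..<s} \<rightarrow>\<^sub>E S" using u by (simp add: \<Omega>_def)
      next
        fix a b assume "a < s" "b < s" "a \<noteq> b"
        from p[OF this] show "u a \<noteq> u b" "\<not> shares A i (u a) (u b)" "\<not> pair_danger A i (u a) (u b)"
          using shares_mono[of A i "u a" "u b" M] pair_danger_mono[of A i "u a" "u b" M] i by auto
      next
        fix a b c assume "a < s" "b < s" "c < s" "a \<noteq> b" "c \<noteq> a" "c \<noteq> b"
        from t[OF this] show "\<not> triple_danger A i (u a) (u b) (u c)"
          using triple_danger_mono[of A i "u a" "u b" "u c" M] i by auto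
      qed
      have un: "u a < n" if "a < s" for a using Sn[OF uS[OF that]] .
      have "blockers A i s u \<subseteq> blockers A M s u"
        unfolding blockers_def using shares_mono[OF _ i, of A] triple_danger_mono[OF _ i, of A] by fast
      then have "card (blockers A i s u) \<le> card (blockers A M s u)"
        using un p by (intro card_mono finite_blockers) auto
      then have "real (card (blockers A i s u)) \<le> real (card (blockers A M s u))" by simp
      also have "\<dots> \<le> real s * (d * al) + real s ^ 2 * (ka * (d * al))"
        using un p by (intro card_blockers) auto
      finally have "real (4 * card (blockers A i s u)) \<le> real B" using small(3) by simp
      then have "4 * card (blockers A i s u) \<le> B" by (rule of_nat_le_iff[THEN iffD1])
      then have "u \<in> G" using gt by (simp add: G_def)
      then show False using nu by blast
    qed
  qed
  have finBP: "finite (BP ab)" "finite (BT t)" for ab t using fin\<Omega> by (auto simp: BP_def BT_def)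
  have "m ^ s = card \<Omega>" using c\<Omega> by simp
  also have "\<dots> \<le> card (G \<union> (\<Union>ab\<in>PP. BP ab) \<union> (\<Union>t\<in>TT. BT t))"
    using finG finBP fins by (intro card_mono cover) auto
  also have "\<dots> \<le> card G + card (\<Union>ab\<in>PP. BP ab) + card (\<Union>t\<in>TT. BT t)"
    by (meson card_Un_le add_right_mono order_trans)
  also have "\<dots> \<le> card G + (\<Sum>ab\<in>PP. card (BP ab)) + (\<Sum>t\<in>TT. card (BT t))"
    using fins by (intro add_mono card_UN_le order_refl)
  also have "\<dots> \<le> card G + (\<Sum>ab\<in>PP. card P * m ^ (s - 2)) + (\<Sum>t\<in>TT. card Q * m ^ (s - 3))"
  proof (intro add_mono sum_mono order_refl)
    fix ab assume "ab \<in> PP"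
    then show "card (BP ab) \<le> card P * m ^ (s - 2)"
      unfolding BP_def \<Omega>_def S(2)[symmetric] PP_def
      by (intro card_pair_tuples) (use finS in \<open>auto simp: P_def\<close>)
  next
    fix t assume "t \<in> TT"
    then show "card (BT t) \<le> card Q * m ^ (s - 3)"
      unfolding BT_def \<Omega>_def S(2)[symmetric] TT_def
      by (intro card_triple_tuples) (use finS in \<open>auto simp: Q_def\<close>)
  qed
  also have "\<dots> \<le> card G + s ^ 2 * (card P * m ^ (s - 2)) + s ^ 3 * (card Q * m ^ (s - 3))"
    using cPP cTT by (intro add_mono) (auto intro!: mult_right_mono)
  finally have "real (m ^ s) \<le> real (card G + s ^ 2 * (card P * m ^ (s - 2)) + s ^ 3 * (card Q * m ^ (s - 3)))"
    by (rule of_nat_mono)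
  then have main: "real m ^ s \<le> real (card G) + (real s ^ 2 * real (card P)) * real m ^ (s - 2) + (real s ^ 3 * real (card Q)) * real m ^ (s - 3)"
    by simp
  \<comment> \<open>The summands stand for the diagonal, the sharing pairs, the fans in both
    orientations and the crossing pairs.\<close>
  have cP: "real (card P) \<le> real m + al * (d * real m) + 2 * F + real m * (x * ka)"
  proof -
    define F1 where "F1 = {(x, y) \<in> S \<times> S. fan x y}"
    define P1 where "P1 = {(x, y) \<in> S \<times> S. shares A M x y}"
    define C1 where "C1 = {(u, y) \<in> S \<times> S. cross u y}"
    have finF: "finite F1" "finite P1" "finite C1"
      by (rule finite_subset[of _ "S \<times> S"]; use finS in \<open>auto simp: F1_def P1_def C1_def\<close>)+
    have "P \<subseteq> (\<lambda>v. (v, v)) ` S \<union> P1 \<union> F1 \<union> prod.swap ` F1 \<union> C1"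
    proof
      fix p assume "p \<in> P"
      then obtain u v where p: "p = (u, v)" "u \<in> S" "v \<in> S" "u = v \<or> shares A M u v \<or> pair_danger A M u v"
        unfolding P_def by blast
      show "p \<in> (\<lambda>v. (v, v)) ` S \<union> P1 \<union> F1 \<union> prod.swap ` F1 \<union> C1"
      proof (cases "u = v \<or> shares A M u v")
        case True
        then show ?thesis using p by (auto simp: P1_def)
      next
        case False
        then have "fan u v \<or> fan v u \<or> cross u v"
          using p Sn by (intro pair_danger_cases) auto
        then show ?thesis using p unfolding F1_def C1_def by (auto simp: image_iff)
      qed
    qed
    then have "card P \<le> card ((\<lambda>v. (v, v)) ` S \<union> P1 \<union> F1 \<union> prod.swap ` F1 \<union> C1)"
      using finF finS by (intro card_mono) auto
    also have "\<dots> \<le> card ((\<lambda>v. (v, v)) ` S) + card P1 + card F1 + card (prod.swap ` F1) + card C1"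
      by (meson card_Un_le add_right_mono order_trans)
    also have "\<dots> \<le> m + card P1 + card F1 + card F1 + card C1"
      using card_image_le[OF finS, of "\<lambda>v. (v, v)"] card_image_le[OF finF(1), of prod.swap] S(2)
      by linarith
    finally have "real (card P) \<le> real m + real (card P1) + 2 * real (card F1) + real (card C1)"
      using of_nat_mono by fastforce
    moreover have "real (card P1) \<le> al * (d * real m)" unfolding P1_def by (rule card_sharing_pairs[OF S])
    moreover have "real (card F1) \<le> F" using card_fan_pairs[OF S(1)] F unfolding F1_def by linarith
    moreover have "real (card C1) \<le> real m * (x * ka)" unfolding C1_def by (rule card_cross_pairs[OF S T])
    ultimately show ?thesis by linarith
  qed
  have cQ: "real (card Q) \<le> real m ^ 2 * (ka * (d * al))"
  proof -
    define R where "R = {xy \<in> S \<times> S. fst xy \<noteq> snd xy \<and> \<not> shares A M (fst xy) (snd xy)}"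
    define Z where "Z xy = {z. triple_danger A M (fst xy) (snd xy) z}" for xy
    have finR: "finite R" using finS by (auto simp: R_def)
    have Rn: "fst xy < n \<and> snd xy < n \<and> fst xy \<noteq> snd xy \<and> \<not> shares A M (fst xy) (snd xy)" if "xy \<in> R" for xy
      using that Sn by (auto simp: R_def)
    have Zc: "real (card (Z xy)) \<le> ka * (d * al)" "finite (Z xy)" if "xy \<in> R" for xy
      using card_triple_danger[of "fst xy" "snd xy"] Rn[OF that] unfolding Z_def by auto
    have "Q \<subseteq> (\<Union>xy\<in>R. (\<lambda>z. (fst xy, snd xy, z)) ` Z xy)"
      unfolding Q_def R_def Z_def by force
    then have "card Q \<le> card (\<Union>xy\<in>R. (\<lambda>z. (fst xy, snd xy, z)) ` Z xy)"
      using finR Zc by (intro card_mono) auto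
    also have "\<dots> \<le> (\<Sum>xy\<in>R. card ((\<lambda>z. (fst xy, snd xy, z)) ` Z xy))" by (rule card_UN_le[OF finR])
    also have "\<dots> \<le> (\<Sum>xy\<in>R. card (Z xy))" using Zc by (intro sum_mono card_image_le)
    finally have "real (card Q) \<le> real (\<Sum>xy\<in>R. card (Z xy))" by (rule of_nat_mono)
    also have "\<dots> \<le> (\<Sum>xy\<in>R. ka * (d * al))" unfolding of_nat_sum by (intro sum_mono Zc)
    also have "\<dots> = real (card R) * (ka * (d * al))" by simp
    also have "\<dots> \<le> real m ^ 2 * (ka * (d * al))"
    proof (rule mult_right_mono)
      have "card R \<le> card (S \<times> S)" using finS by (intro card_mono) (auto simp: R_def)
      then have "card R \<le> m * m" using S by (simp only: card_cartesian_product)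
      from of_nat_mono[OF this, where 'a = real] show "real (card R) \<le> real m ^ 2" by (simp add: power2_eq_square)
    qed (use params(6) d_pos al_pos in auto)
    finally show ?thesis .
  qed
  have "real s ^ 2 * real (card P) \<le> real m ^ 2 / 4"
    using small(1) cP by (smt (verit) mult_left_mono zero_le_power of_nat_0_le_iff)
  then have "(real s ^ 2 * real (card P)) * real m ^ (s - 2) \<le> real m ^ 2 / 4 * real m ^ (s - 2)"
    by (rule mult_right_mono) simp
  also have "\<dots> = real m ^ (2 + (s - 2)) / 4" by (simp only: power_add times_divide_eq_left)
  also have "2 + (s - 2) = s" using s by simp
  finally have p1: "(real s ^ 2 * real (card P)) * real m ^ (s - 2) \<le> real m ^ s / 4" .
  have "real s ^ 3 * real (card Q) \<le> real s ^ 3 * (real m ^ 2 * (ka * (d * al)))"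
    using cQ by (intro mult_left_mono) auto
  also have "\<dots> = real m ^ 2 * (real s ^ 3 * (ka * (d * al)))" by simp
  also have "\<dots> \<le> real m ^ 2 * (real m / 4)" using small(2) by (intro mult_left_mono) auto
  finally have "real s ^ 3 * real (card Q) \<le> real m ^ 3 / 4" by (simp add: power2_eq_square power3_eq_cube)
  then have "(real s ^ 3 * real (card Q)) * real m ^ (s - 3) \<le> real m ^ 3 / 4 * real m ^ (s - 3)"
    by (rule mult_right_mono) simp
  also have "\<dots> = real m ^ (3 + (s - 3)) / 4" by (simp only: power_add times_divide_eq_left)
  also have "3 + (s - 3) = s" using s by simp
  finally have p2: "(real s ^ 3 * real (card Q)) * real m ^ (s - 3) \<le> real m ^ s / 4" .
  show ?thesis using main p1 p2 unfolding G_def by linarith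
qed

section \<open>Choice of thresholds\<close>

lemma few_heavy_apexes_log:
  assumes S: "S \<subseteq> {..<n}" "card S = m"
    and beta: "0 < beta" and r: "1 \<le> r" "9/20 * l \<le> ln (5 * real B / real r) - 1"
    and big: "180000 * C \<le> beta * l" "2 + 2000 * C * l^2 / (beta * real r) \<le> ln (beta * l / (12000 * C))"
  shows "card {j. j < M \<and> beta * real m < real (card (S \<inter> apexes j))} < r"
proof -
  \<comment> \<open>Chosen so that \<open>rho * (d * m)\<close> is a hundredth of the target
    \<open>r * (beta * m)\<close>.\<close>
  define rho where "rho = beta * real r / (100 * d)"
  have rho: "0 < rho" using beta r d_pos by (simp add: rho_def)
  have bm: "beta * l * sn \<le> 5 * (beta * real m)"
    using mult_left_mono[OF params(9), of beta] beta by (simp add: mult_ac)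
  have q: "180000 * C * sn \<le> 5 * (beta * real m)"
    using mult_right_mono[OF big(1), of sn] params(2) bm by linarith
  show ?thesis
  proof (rule few_heavy_apexes[OF S beta r(1) rho _ _ r(2), of 1])
    have "100 * d * al = 12000 * C * sn" using d_al by (simp add: mult.assoc)
    moreover have "beta * l / (12000 * C) = beta * (sn * l) / (12000 * C * sn)"
      using params(2) by simp
    ultimately have "beta * l / (12000 * C) = beta * (sn * l) / (100 * d * al)"
      by (simp only:)
    also have "\<dots> \<le> beta * real B / (100 * d * al)"
      using params(7) beta d_pos al_pos by (intro divide_right_mono mult_left_mono) auto
    also have "\<dots> = rho * real B / (real r * al)"
      using r d_pos by (simp add: rho_def field_simps)
    finally have "ln (beta * l / (12000 * C)) \<le> ln (rho * real B / (real r * al))"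
      using beta params(1,3) by (intro ln_mono_div) auto
    moreover have "l / rho = 2000 * C * l^2 / (beta * real r)"
      unfolding rho_def params(5) using beta r params(1,3) by (simp add: field_simps power2_eq_square)
    ultimately show "1 \<le> ln (rho * real B / (real r * al)) - 1 - l / rho" using big(2) by linarith
    have e1: "rho * (d * real m) = real r * (beta * real m) / 100"
      using d_pos by (simp add: rho_def)
    have e2: "36 * sn * real r / 1 \<le> real r * (beta * real m) / 1000"
    proof -
      have "180000 * sn \<le> 180000 * C * sn" using params(1,2) by simp
      then have "36 * sn \<le> beta * real m / 1000" using q by linarith
      then have "real r * (36 * sn) \<le> real r * (beta * real m / 1000)" by (intro mult_left_mono) auto
      then show ?thesis by (simp add: mult_ac)
    qed
    have e3: "24 * real r * (d * al) \<le> real r * (beta * real m) / 10"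
    proof -
      have "0 \<le> C * sn" using params(1,2) by simp
      then have "24 * (d * al) \<le> beta * real m / 10" using q d_al by simp
      then have "real r * (24 * (d * al)) \<le> real r * (beta * real m / 10)" by (intro mult_left_mono) auto
      then show ?thesis by (simp add: mult_ac)
    qed
    \<comment> \<open>The three error terms amount to at most
      \<open>5 * (4 * (0.01 + 0.001) + 0.1) = 0.72\<close> of the target.\<close>
    have combine: "a = X / 100 \<Longrightarrow> b \<le> X / 1000 \<Longrightarrow> c \<le> X / 10 \<Longrightarrow> 0 \<le> X \<Longrightarrow> 5 * (4 * (a + b) + c) \<le> X"
      for a b c X :: real by simp
    show "5 * (4 * (rho * (d * real m) + 36 * sn * real r / 1) + 24 * real r * (d * al)) \<le> real r * (beta * real m)"
      by (rule combine[OF e1 e2 e3]) (use beta in simp)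
  qed simp
qed

text \<open>The thresholds are tuned so that each of the four terms of \<open>fan_sum\<close> is at
  most \<open>\<delta> * m ^ 2\<close>; with \<open>\<delta> = 1 / (64 * s ^ 2)\<close> fans then
  use up half of the quarter allowed for bad pairs, and everything else fits into the other half for
  large \<open>l\<close>.\<close>

lemma all_good:
  fixes K1 \<delta> eta :: real and s :: nat
  assumes s: "3 \<le> s"
    and K1: "K1 = 14400 * C^3 * exp 4" and \<delta>: "\<delta> = 1 / (64 * real s ^ 2)" and eta: "eta = \<delta> / (5 * K1)"
    and ka: "ka = 10 * l / ln l"
    and sn: "ln sn = l / 2" "l ^ 10 \<le> sn"
    and l: "2 \<le> ln (l / (120 * C))" "(20 * C * l + 6) * l \<le> l ^ 3"
      "2 + ln (4 * C * l ^ 8) \<le> 9 * (ln (9 * l / (120 * C)) - 1)"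
      "ln l / 2 \<le> ln (4 * eta * l) - 1 - 1 / eta"
      "9/20 * l + 1 \<le> l / 2 - 3 * ln l"
      "180000 * C \<le> \<delta> * ln l / 4" "2 + 8000 * C / (\<delta> * ln l * l) \<le> ln (\<delta> * ln l / (48000 * C))"
      "930 \<le> \<delta> * l^2" "180000 * C \<le> \<delta> * l / 8" "2 + 496000 * C / \<delta>^2 \<le> ln (\<delta> * l / (96000 * C))"
      "real s ^ 2 * (1 / l + 600 * C / l + 3250 * K1 / ln l) \<le> 1 / 8"
      "24000 * C * real s ^ 3 \<le> ln l"
      "480 * C * real s + 4800 * C * real s ^ 2 * l / ln l \<le> l"
      "5 \<le> l"
    and S: "S \<subseteq> {..<n}" "card S = m" and i: "i \<le> M"
  shows "real m ^ s \<le> 2 * real (card {u. good_tuple A i s S u \<and> 4 * card (blockers A i s u) \<le> B})"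
proof -
  have C: "1 \<le> C" by (rule params(1))
  have l0: "0 < l" "5 \<le> l" using l by auto
  have "1 \<le> C ^ 3" using C by (simp add: one_le_power)
  moreover have "(1::real) \<le> exp 4" by simp
  ultimately have "1 * 1 \<le> C ^ 3 * exp (4::real)" using C by (intro mult_mono) auto
  then have K1ge: "1 \<le> K1" unfolding K1 by simp
  have \<delta>0: "0 < \<delta>" using s by (simp add: \<delta>)
  have \<delta>1: "\<delta> \<le> 1"
  proof -
    have "1 \<le> real s ^ 2" using s by (simp add: one_le_power)
    then show ?thesis by (simp add: \<delta> divide_le_eq)
  qed
  have eta0: "0 < eta" using \<delta>0 K1ge by (simp add: eta)
  have g0: "0 < ln l" using l0 by (simp add: ln_gt_zero)
  have sn0: "0 < sn" by (rule params(2))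
  have slm: "sn * l \<le> 5 * real m" by (rule params(9))
  have l46: "l ^ 4 * l ^ 6 \<le> sn" using sn(2) by (simp flip: power_add)
  have l1: "1 \<le> l" using l0 by simp
  have dl: "(d + 6) * l \<le> l ^ 3" using l(2) by (simp add: params(5))
  have dl5: "(d + 5) * l < l ^ 3" using dl l0 by (simp add: algebra_simps)
  have l34: "l ^ 3 \<le> l ^ 4" using l1 by (intro power_increasing) auto
  have snl6: "l ^ 4 \<le> sn / l ^ 6" using l46 l0 by (simp add: le_divide_eq)
  have snl6': "sn / l ^ 6 \<le> sn"
    using l1 sn0 by (simp add: divide_le_eq one_le_power)
  have K1sn: "sn \<le> K1 * sn" using K1ge sn0 by simp
  have lnl: "ln (q * l / (120 * C)) = ln q + ln (l / (120 * C))" if "0 < q" for q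
    using ln_mult[of q "l / (120 * C)"] that l0 C by simp
  \<comment> \<open>For \<open>q = 2\<close> both sides of the condition on \<open>x\<close> grow
    like \<open>2 * ln l\<close>, so only constants decide:
    \<open>K1 = 4 * C * (60 * C)^2 * exp 4\<close> turns it into an equality once \<open>M\<close>
    is replaced by its upper bound.\<close>
  have rich2: "real (card (rich 2 y)) \<le> K1 * sn" if y: "y < n" for y
  proof (rule card_rich_le[OF y])
    have "1 \<le> ln (l / (120 * C))" using l(1) by simp
    moreover have "0 \<le> ln (2::real)" by simp
    ultimately show "1 \<le> ln (real 2 * l / (120 * C))"
        unfolding of_nat_numeral lnl[of 2, OF zero_less_numeral] by linarith
    show "0 < K1 * sn" using K1ge sn0 by simp
    show "(d + 5) * l < K1 * sn" using dl5 l34 snl6 snl6' K1sn by linarith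
    have "real M / (K1 * sn) \<le> 4 * C * sn * l^2 / (K1 * sn)"
      using params(10) K1ge sn0 by (intro divide_right_mono) auto
    also have "\<dots> = 4 * C * l^2 / K1" using sn0 by simp
    also have "\<dots> = (l / (60 * C))^2 / exp 4"
      using C unfolding K1 by (simp add: field_simps power2_eq_square power3_eq_cube)
    finally have "ln (real M / (K1 * sn)) \<le> ln ((l / (60 * C))^2 / exp 4)"
      using params(12) K1ge sn0 by (intro ln_mono_div) auto
    also have "\<dots> = 2 * ln (l / (60 * C)) - 4"
      using l0 C by (simp add: ln_div ln_realpow)
    also have "l / (60 * C) = real 2 * l / (120 * C)" by simp
    finally show "2 + ln (real M / (K1 * sn)) \<le> real 2 * (ln (real 2 * l / (120 * C)) - 1)" by simp
  qed simp
  \<comment> \<open>The ratio of \<open>M\<close> to the target \<open>sn / l ^ 6\<close> is at most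
    \<open>4 * C * l ^ 8\<close>; 9 is the least integer exponent of \<open>l\<close> exceeding
    8.\<close>
  have rich9: "real (card (rich 9 y)) * l ^ 6 \<le> K1 * sn" if y: "y < n" for y
  proof -
    have "real (card (rich 9 y)) \<le> sn / l ^ 6"
    proof (rule card_rich_le[OF y])
      have "1 \<le> ln (l / (120 * C))" using l(1) by simp
      moreover have "0 \<le> ln (9::real)" by simp
      ultimately show "1 \<le> ln (real 9 * l / (120 * C))"
        unfolding of_nat_numeral lnl[of 9, OF zero_less_numeral] by linarith
      show "0 < sn / l ^ 6" using sn0 l0 by simp
      show "(d + 5) * l < sn / l ^ 6" using dl5 l34 snl6 by linarith
      have "real M / (sn / l ^ 6) \<le> 4 * C * sn * l^2 / (sn / l ^ 6)"
        using params(10) l0 sn0 by (intro divide_right_mono) auto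
      also have "\<dots> = 4 * C * l ^ 8" using sn0 l0 by (simp flip: power_add)
      finally have "ln (real M / (sn / l ^ 6)) \<le> ln (4 * C * l ^ 8)"
        using params(12) l0 sn0 by (intro ln_mono_div) auto
      then show "2 + ln (real M / (sn / l ^ 6)) \<le> real 9 * (ln (real 9 * l / (120 * C)) - 1)"
        using l(3) by simp
    qed simp
    then have "real (card (rich 9 y)) * l ^ 6 \<le> sn" using l0 by (simp add: le_divide_eq)
    then show ?thesis using K1sn by linarith
  qed
  have T: "(\<Sum>j\<in>rich 2 y. real (card (A j \<inter> U (I y)))^2) \<le> 65 * (K1 * sn)" if "y < n" for y
    by (rule sum_rich_squares[OF that rich2[OF that] rich9[OF that] l(1) dl])
  \<comment> \<open>\<open>r1\<close> is large enough to make \<open>l^2 / (b1 * r1)\<close> tend to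
    zero, yet polylogarithmic, as \<open>few_columns_incidences\<close> requires. \<open>r2\<close>
    is the largest size for which the trivial bound \<open>r2 * (al * m)\<close> stays below
    \<open>\<delta> * m ^ 2\<close>.\<close>
  define r1 where "r1 = nat \<lceil>l ^ 4\<rceil>"
  define r2 where "r2 = nat \<lfloor>\<delta> * l^2 / 30\<rfloor>"
  have r1: "l ^ 4 \<le> real r1" "real r1 \<le> l ^ 4 + 1"
    using l0 unfolding r1_def by (auto simp: of_nat_nat ceiling_correct of_int_ceiling_le_add_one)
  have r2: "real r2 \<le> \<delta> * l^2 / 30" "\<delta> * l^2 / 30 - 1 < real r2"
    using \<delta>0 unfolding r2_def by (auto simp: of_nat_nat) linarith+
  have r2': "\<delta> * l^2 / 31 \<le> real r2" using r2(2) l(8) by linarith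
  have r2pos: "1 \<le> r2" using r2' l(8) by linarith
  have one4: "1 \<le> l ^ 4" using l1 by (rule one_le_power)
  have r1pos: "1 \<le> r1" using r1(1) one4 by linarith
  have r2l4: "real r2 \<le> 2 * l ^ 4"
  proof -
    have "l ^ 2 \<le> l ^ 4" using l1 by (intro power_increasing) auto
    moreover have "\<delta> * l^2 \<le> 1 * l^2" using \<delta>1 by (intro mult_right_mono) auto
    ultimately show ?thesis using r2(1) one4 by linarith
  qed
  have r1l4: "real r1 \<le> 2 * l ^ 4" using r1(2) one4 by linarith
  \<comment> \<open>For polylogarithmic \<open>r\<close> the quotient \<open>B / r\<close> is still
    nearly sqrt(n), with logarithm at least \<open>l / 2 - 3 * ln l\<close>. The fractions
    \<open>9/20\<close> and \<open>2/5\<close> are safely below one half.\<close>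
  have lnr: "9/20 * l \<le> ln (5 * real B / real r) - 1" "2/5 * l \<le> ln (8 * real B / real r) - 1"
    if r: "1 \<le> r" "real r \<le> 2 * l ^ 4" for r :: nat
  proof -
    have "sn / l ^ 3 = 2 * (sn * l) / (2 * l ^ 4)" using l0 by (simp add: power_numeral_reduce field_simps)
    also have "\<dots> \<le> 5 * real B / real r"
      using params(7) r l0 sn0 by (intro frac_le) auto
    finally have "ln (sn / l ^ 3) \<le> ln (5 * real B / real r)" using sn0 l0 by (intro ln_mono_div) auto
    moreover have "ln (sn / l ^ 3) = l / 2 - 3 * ln l" using sn0 l0 sn(1) by (simp add: ln_div ln_realpow)
    ultimately show f: "9/20 * l \<le> ln (5 * real B / real r) - 1" using l(5) by linarith
    have "ln (5 * real B / real r) \<le> ln (8 * real B / real r)"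
      using r B_pos by (intro ln_mono_div divide_right_mono) auto
    then show "2/5 * l \<le> ln (8 * real B / real r) - 1" using f l0 by linarith
  qed
  have ml10: "l ^ 10 \<le> real m"
  proof -
    have "l ^ 10 * 5 \<le> sn * l" using sn(2) l0 sn0 by (intro mult_mono) auto
    then show ?thesis using slm by linarith
  qed
  have r1m: "r1 + 5 \<le> m"
  proof -
    have "5 ^ 6 * l ^ 4 \<le> l ^ 6 * l ^ 4" using l0 by (intro mult_right_mono power_mono) auto
    then have "15625 * l ^ 4 \<le> real m" using ml10 by (simp flip: power_add)
    then have "real (r1 + 5) \<le> real m" using r1(2) one4 by simp
    then show ?thesis by (rule of_nat_le_iff[THEN iffD1])
  qed
  \<comment> \<open>Both values make the corresponding term of \<open>fan_sum\<close> equal to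
    \<open>\<delta> * m ^ 2\<close>. The factor \<open>ln l\<close> saved by
    \<open>frequent_incidences\<close> is decisive: \<open>few_heavy_apexes_log\<close> needs
    \<open>b1 * l\<close> to be large, and \<open>b1 * l = \<delta> * ln l / 4\<close> just tends to
    infinity.\<close>
  define b1 where "b1 = \<delta> * ln l / (4 * l)"
  define b2 where "b2 = \<delta> / 8"
  have b1: "0 < b1" "b1 * l = \<delta> * ln l / 4" using \<delta>0 g0 l0 by (auto simp: b1_def)
  have b2: "0 < b2" "b2 * l = \<delta> * l / 8" using \<delta>0 by (auto simp: b2_def)
  have few1: "card {j. j < M \<and> b1 * real m < real (card (S \<inter> apexes j))} < r1"
  proof (rule few_heavy_apexes_log[OF S b1(1) r1pos lnr(1)[OF r1pos r1l4]])
    show "180000 * C \<le> b1 * l" using l(6) b1 by simp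
    have "2000 * C * l^2 / (b1 * real r1) \<le> 2000 * C * l^2 / (b1 * l ^ 4)"
      using r1(1) b1 C l0 one4 r1pos by (intro divide_left_mono mult_left_mono mult_pos_pos) auto
    also have "\<dots> = 8000 * C / (\<delta> * ln l * l)"
      using l0 g0 \<delta>0 by (simp add: b1_def field_simps power_numeral_reduce)
    finally have "2 + 2000 * C * l^2 / (b1 * real r1) \<le> ln (\<delta> * ln l / (48000 * C))" using l(7) by linarith
    also have "\<delta> * ln l / (48000 * C) = b1 * l / (12000 * C)" unfolding b1(2) by simp
    finally show "2 + 2000 * C * l^2 / (b1 * real r1) \<le> ln (b1 * l / (12000 * C))" .
  qed
  have few2: "card {j. j < M \<and> b2 * real m < real (card (S \<inter> apexes j))} < r2"
  proof (rule few_heavy_apexes_log[OF S b2(1) r2pos lnr(1)[OF r2pos r2l4]])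
    show "180000 * C \<le> b2 * l" unfolding b2(2) by (rule l(9))
    have "2000 * C * l^2 / (b2 * real r2) \<le> 2000 * C * l^2 / (b2 * (\<delta> * l^2 / 31))"
      using r2' b2 C l0 \<delta>0 r2pos by (intro divide_left_mono mult_left_mono mult_pos_pos) auto
    also have "\<dots> = 496000 * C / \<delta>^2"
      using l0 \<delta>0 by (simp add: b2_def field_simps power2_eq_square)
    finally have "2 + 2000 * C * l^2 / (b2 * real r2) \<le> ln (\<delta> * l / (96000 * C))" using l(10) by linarith
    also have "\<delta> * l / (96000 * C) = b2 * l / (12000 * C)" unfolding b2(2) by simp
    finally show "2 + 2000 * C * l^2 / (b2 * real r2) \<le> ln (b2 * l / (12000 * C))" .
  qed
  define F where "F = eta * l * (real m * (K1 * sn)) + b1 * real m * (4 * real m * l / ln l) + b2 * real m * (8 * real m) + real r2 * (al * real m)"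
  have Fsum: "(\<Sum>j<M. real (card (S \<inter> A j)) * real (card (S \<inter> apexes j))) \<le> F"
    unfolding F_def by (rule fan_sum[OF S rich2 eta0 g0 l(4) b1(1) few1 r1m lnr(2)[OF r1pos r1l4] b2(1) few2])
  have Fle: "F \<le> 4 * \<delta> * real m ^ 2"
  proof -
    have p1: "eta * l * (real m * (K1 * sn)) \<le> \<delta> * real m ^ 2"
    proof -
      have "eta * l * (real m * (K1 * sn)) = (\<delta> / 5 * real m) * (sn * l)"
        using K1ge by (simp add: eta)
      also have "\<dots> \<le> (\<delta> / 5 * real m) * (5 * real m)" using slm \<delta>0 by (intro mult_left_mono) auto
      finally show ?thesis by (simp add: power2_eq_square)
    qed
    have p2: "b1 * real m * (4 * real m * l / ln l) = \<delta> * real m ^ 2"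
      using l0 g0 by (simp add: b1_def power2_eq_square)
    have p3: "b2 * real m * (8 * real m) = \<delta> * real m ^ 2" by (simp add: b2_def power2_eq_square)
    have p4: "real r2 * (al * real m) \<le> \<delta> * real m ^ 2"
    proof -
      have "real r2 * (al * real m) \<le> \<delta> * l^2 / 30 * (al * real m)"
        using r2(1) al_pos by (intro mult_right_mono) auto
      also have "\<dots> = (\<delta> / 5 * real m) * (sn * l)" using l0 by (simp add: params(4) power2_eq_square)
      also have "\<dots> \<le> (\<delta> / 5 * real m) * (5 * real m)" using slm \<delta>0 by (intro mult_left_mono) auto
      finally show ?thesis by (simp add: power2_eq_square)
    qed
    show ?thesis unfolding F_def using p1 p2 p3 p4 by linarith
  qed
  have m0: "0 < real m" using params(13) by simp
  have snm: "sn \<le> 5 * real m / l" using slm l0 by (simp add: le_divide_eq)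
  show ?thesis
  proof (rule many_good_tuples[OF S i Fsum T s])
    have q1: "real m \<le> real m ^ 2 * (1 / l)"
    proof -
      have "l \<le> l ^ 10" using l1 by (rule self_le_power) simp
      then have "l \<le> real m" using ml10 by linarith
      then show ?thesis using l0 by (simp add: le_divide_eq power2_eq_square mult_left_mono)
    qed
    have q2: "al * (d * real m) \<le> real m ^ 2 * (600 * C / l)"
    proof -
      have "al * (d * real m) = (d * al) * real m" by simp
      also have "\<dots> = (120 * C * real m) * sn" by (simp add: d_al)
      also have "\<dots> \<le> (120 * C * real m) * (5 * real m / l)" using snm C by (intro mult_left_mono) auto
      finally show ?thesis by (simp add: power2_eq_square mult_ac)
    qed
    have q3: "real m * (65 * (K1 * sn) * ka) \<le> real m ^ 2 * (3250 * K1 / ln l)"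
    proof -
      have "real m * (65 * (K1 * sn) * ka) = (real m * 650 * K1 / ln l) * (sn * l)" by (simp add: ka)
      also have "\<dots> \<le> (real m * 650 * K1 / ln l) * (5 * real m)"
        using slm K1ge g0 by (intro mult_left_mono) auto
      finally show ?thesis by (simp add: power2_eq_square mult_ac)
    qed
    have "real m + al * (d * real m) + real m * (65 * (K1 * sn) * ka)
        \<le> real m ^ 2 * (1 / l + 600 * C / l + 3250 * K1 / ln l)"
      using q1 q2 q3 by (simp only: distrib_left)
    then have "real s ^ 2 * (real m + al * (d * real m) + real m * (65 * (K1 * sn) * ka))
        \<le> real s ^ 2 * (real m ^ 2 * (1 / l + 600 * C / l + 3250 * K1 / ln l))" by (rule mult_left_mono) simp
    also have "\<dots> = real m ^ 2 * (real s ^ 2 * (1 / l + 600 * C / l + 3250 * K1 / ln l))" by (simp add: mult_ac)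
    also have "\<dots> \<le> real m ^ 2 * (1 / 8)" using l(11) by (intro mult_left_mono) auto
    finally have "real s ^ 2 * (real m + al * (d * real m) + real m * (65 * (K1 * sn) * ka)) \<le> real m ^ 2 / 8" by simp
    moreover have "real s ^ 2 * (2 * F) \<le> real m ^ 2 / 8"
    proof -
      have "real s ^ 2 * (2 * F) \<le> real s ^ 2 * (2 * (4 * \<delta> * real m ^ 2))" using Fle by (intro mult_left_mono) auto
      also have "\<dots> = real m ^ 2 / 8" using s by (simp add: \<delta>)
      finally show ?thesis .
    qed
    ultimately show "real s ^ 2 * (real m + al * (d * real m) + 2 * F + real m * (65 * (K1 * sn) * ka)) \<le> real m ^ 2 / 4"
      by (simp add: distrib_left)
    have kd: "ka * (d * al) = 1200 * C / ln l * (sn * l)" by (simp add: ka d_al)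
    have "real s ^ 3 * (ka * (d * al)) = (1200 * C * real s ^ 3 / ln l) * (sn * l)" by (simp add: kd)
    also have "\<dots> \<le> (1200 * C * real s ^ 3 / ln l) * (5 * real m)"
      using slm C g0 by (intro mult_left_mono) auto
    also have "\<dots> = (24000 * C * real s ^ 3 / ln l) * (real m / 4)" by simp
    also have "\<dots> \<le> 1 * (real m / 4)"
      using l(12) g0 by (intro mult_right_mono) (auto simp: divide_le_eq)
    finally show "real s ^ 3 * (ka * (d * al)) \<le> real m / 4" by simp
    have "4 * (real s * (d * al) + real s ^ 2 * (ka * (d * al)))
       = sn * (480 * C * real s + 4800 * C * real s ^ 2 * l / ln l)"
      unfolding kd unfolding d_al by (simp add: algebra_simps)
    also have "\<dots> \<le> sn * l" using l(13) sn0 by (intro mult_left_mono) auto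
    also have "\<dots> \<le> real B" by (rule params(7))
    finally show "4 * (real s * (d * al) + real s ^ 2 * (ka * (d * al))) \<le> real B" .
  qed
qed

end

section \<open>Counting labellings\<close>

text \<open>The finite probability space: words are outcomes of independent uniform letters below
  \<open>Q\<close>, and probabilities appear as cardinalities compared with
  \<open>card (words I Q)\<close>.\<close>

abbreviation words :: "'i set \<Rightarrow> nat \<Rightarrow> ('i \<Rightarrow> nat) set" where
  "words I Q \<equiv> I \<rightarrow>\<^sub>E {..<Q}"

text \<open>The counting form of being determined by the coordinates outside \<open>G\<close>, that
  is, of being known before those in \<open>G\<close> are exposed.\<close>

definition local_off :: "'i set \<Rightarrow> nat \<Rightarrow> 'i set \<Rightarrow> (('i \<Rightarrow> nat) \<Rightarrow> 'b) \<Rightarrow> bool" where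
  "local_off I Q G f \<longleftrightarrow> (\<forall>w\<in>words I Q. \<forall>w'\<in>words I Q. (\<forall>i\<in>I - G. w i = w' i) \<longrightarrow> f w = f w')"

lemma local_offI:
  assumes "\<And>w w'. w \<in> words I Q \<Longrightarrow> w' \<in> words I Q \<Longrightarrow> (\<And>i. i \<in> I \<Longrightarrow> i \<notin> G \<Longrightarrow> w i = w' i) \<Longrightarrow> f w = f w'"
  shows "local_off I Q G f"
  unfolding local_off_def
proof (intro ballI impI)
  fix w w' assume "w \<in> words I Q" "w' \<in> words I Q" "\<forall>i\<in>I - G. w i = w' i"
  then show "f w = f w'" by (intro assms) auto
qed

lemma local_offD:
  assumes "local_off I Q G f" "w \<in> words I Q" "w' \<in> words I Q" "\<And>i. i \<in> I \<Longrightarrow> i \<notin> G \<Longrightarrow> w i = w' i"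
  shows "f w = f w'"
  using assms(1)[unfolded local_off_def, rule_format, OF assms(2,3)] assms(4) by blast

lemma finite_words: "finite I \<Longrightarrow> finite (words I Q)"
  by (intro finite_PiE) auto

lemma card_words: "finite I \<Longrightarrow> card (words I Q) = Q ^ card I"
  by (simp add: card_PiE)

lemma fiber_eq:
  assumes "G \<subseteq> I" "w \<in> words I Q" "T \<subseteq> G" "\<And>i. i \<in> T \<Longrightarrow> X i \<subseteq> {..<Q}"
  shows "{w' \<in> words I Q. (\<forall>i\<in>I - G. w' i = w i) \<and> (\<forall>i\<in>T. w' i \<in> X i)}
    = PiE I (\<lambda>i. if i \<in> T then X i else if i \<in> G then {..<Q} else {w i})"
proof (rule set_eqI)
  fix w'
  show "w' \<in> {w' \<in> words I Q. (\<forall>i\<in>I - G. w' i = w i) \<and> (\<forall>i\<in>T. w' i \<in> X i)} \<longleftrightarrow>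
    w' \<in> PiE I (\<lambda>i. if i \<in> T then X i else if i \<in> G then {..<Q} else {w i})"
  proof
    assume "w' \<in> {w' \<in> words I Q. (\<forall>i\<in>I - G. w' i = w i) \<and> (\<forall>i\<in>T. w' i \<in> X i)}"
    then show "w' \<in> PiE I (\<lambda>i. if i \<in> T then X i else if i \<in> G then {..<Q} else {w i})"
      by (auto simp: PiE_iff)
  next
    assume w': "w' \<in> PiE I (\<lambda>i. if i \<in> T then X i else if i \<in> G then {..<Q} else {w i})"
    then have h: "w' i \<in> (if i \<in> T then X i else if i \<in> G then {..<Q} else {w i})" if "i \<in> I" for i
      using that by (auto simp: PiE_iff)
    have "w' i \<in> {..<Q}" if "i \<in> I" for i
      using h[OF that] assms(2) assms(4)[of i] that by (auto simp: PiE_iff split: if_splits)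
    moreover have "w' i = w i" if "i \<in> I - G" for i using h[of i] that assms(3) by (auto split: if_splits)
    moreover have "w' i \<in> X i" if "i \<in> T" for i using h[of i] that assms(1,3) by (auto split: if_splits)
    ultimately show "w' \<in> {w' \<in> words I Q. (\<forall>i\<in>I - G. w' i = w i) \<and> (\<forall>i\<in>T. w' i \<in> X i)}"
      using w' by (auto simp: PiE_iff)
  qed
qed

lemma card_fiber:
  assumes "finite I" "G \<subseteq> I" "w \<in> words I Q" "T \<subseteq> G" "\<And>i. i \<in> T \<Longrightarrow> X i \<subseteq> {..<Q}"
  shows "card {w' \<in> words I Q. (\<forall>i\<in>I - G. w' i = w i) \<and> (\<forall>i\<in>T. w' i \<in> X i)}
    = (\<Prod>i\<in>T. card (X i)) * Q ^ (card G - card T)"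
proof -
  have finG: "finite G" and finT: "finite T" using assms finite_subset by metis+
  have "card {w' \<in> words I Q. (\<forall>i\<in>I - G. w' i = w i) \<and> (\<forall>i\<in>T. w' i \<in> X i)}
      = (\<Prod>i\<in>I. card (if i \<in> T then X i else if i \<in> G then {..<Q} else {w i}))"
    using assms by (subst fiber_eq) (auto simp: card_PiE)
  also have "\<dots> = (\<Prod>i\<in>I. if i \<in> T then card (X i) else if i \<in> G then Q else 1)"
    by (intro prod.cong) auto
  also have "\<dots> = (\<Prod>i\<in>T. card (X i)) * (\<Prod>i\<in>I - T. if i \<in> G then Q else 1)"
  proof -
    have "I \<inter> {i. i \<in> T} = T" "I \<inter> - {i. i \<in> T} = I - T" using assms(2,4) by auto
    then show ?thesis using assms(1) by (subst prod.If_cases) auto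
  qed
  also have "(\<Prod>i\<in>I - T. if i \<in> G then Q else 1) = (\<Prod>i\<in>G - T. Q)"
    using assms by (intro prod.mono_neutral_cong_right) auto
  also have "\<dots> = Q ^ (card G - card T)" using finT assms(4) by (simp add: card_Diff_subset)
  finally show ?thesis .
qed

lemma card_full_fiber:
  assumes "finite I" "G \<subseteq> I" "w \<in> words I Q"
  shows "card {w' \<in> words I Q. \<forall>i\<in>I - G. w' i = w i} = Q ^ card G"
  using card_fiber[OF assms, of "{}"] by simp

text \<open>The law of total probability: fixing all letters outside \<open>G\<close> splits the
  words into fibres of size \<open>Q ^ card G\<close>, and \<open>P\<close> is constant on each of
  them. A conditional bound \<open>c\<close> on every fibre satisfying \<open>P\<close> therefore
  survives summation.\<close>

lemma fiber_bound:
  assumes I: "finite I" "G \<subseteq> I"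
    and P: "local_off I Q G P"
    and bd: "\<And>w. w \<in> words I Q \<Longrightarrow> P w \<Longrightarrow>
      real (card {w' \<in> words I Q. (\<forall>i\<in>I - G. w' i = w i) \<and> X w'}) \<le> c * real (Q ^ card G)"
  shows "real (card {w \<in> words I Q. P w \<and> X w}) \<le> c * real (card {w \<in> words I Q. P w})"
proof -
  define rho where "rho w = restrict w (I - G)" for w :: "'a \<Rightarrow> nat"
  define D where "D = rho ` {w \<in> words I Q. P w}"
  have fin: "finite (words I Q)" by (rule finite_words[OF I(1)])
  have finD: "finite D" unfolding D_def using fin by simp
  have rho_eq: "rho w' = rho w \<longleftrightarrow> (\<forall>i\<in>I - G. w' i = w i)" for w w'
    unfolding rho_def restrict_def fun_eq_iff by auto
  have Pc: "P w'" if "w' \<in> words I Q" "rho w' \<in> D" for w'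
  proof -
    obtain w where w: "w \<in> words I Q" "P w" "rho w' = rho w" using \<open>rho w' \<in> D\<close> unfolding D_def by auto
    then have "\<forall>i\<in>I - G. w' i = w i" using rho_eq by blast
    then have "P w' = P w" using P that(1) w(1) unfolding local_off_def by blast
    then show ?thesis using w by simp
  qed
  have eX: "{w \<in> words I Q. P w \<and> X w} = (\<Union>h\<in>D. {w \<in> words I Q. rho w = h \<and> X w})"
    using Pc unfolding D_def by auto
  have eP: "{w \<in> words I Q. P w} = (\<Union>h\<in>D. {w \<in> words I Q. rho w = h})"
    using Pc unfolding D_def by auto
  have cP: "card {w \<in> words I Q. P w} = (\<Sum>h\<in>D. card {w \<in> words I Q. rho w = h})"
    unfolding eP using finD fin by (intro card_UN_disjoint) auto
  have full: "card {w \<in> words I Q. rho w = h} = Q ^ card G" if h: "h \<in> D" for h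
  proof -
    obtain w where w: "w \<in> words I Q" "h = rho w" using h unfolding D_def by auto
    show ?thesis using card_full_fiber[OF I w(1)] unfolding w(2) rho_eq by simp
  qed
  have part: "real (card {w \<in> words I Q. rho w = h \<and> X w}) \<le> c * real (Q ^ card G)" if h: "h \<in> D" for h
  proof -
    obtain w where w: "w \<in> words I Q" "P w" "h = rho w" using h unfolding D_def by auto
    show ?thesis using bd[OF w(1,2)] unfolding w(3) rho_eq by simp
  qed
  have "card {w \<in> words I Q. P w \<and> X w} \<le> (\<Sum>h\<in>D. card {w \<in> words I Q. rho w = h \<and> X w})"
    unfolding eX by (rule card_UN_le[OF finD])
  then have "real (card {w \<in> words I Q. P w \<and> X w}) \<le> real (\<Sum>h\<in>D. card {w \<in> words I Q. rho w = h \<and> X w})"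
    by (rule of_nat_mono)
  also have "\<dots> \<le> (\<Sum>h\<in>D. c * real (Q ^ card G))" unfolding of_nat_sum by (intro sum_mono part)
  also have "\<dots> = c * real (\<Sum>h\<in>D. Q ^ card G)" by simp
  also have "(\<Sum>h\<in>D. Q ^ card G) = card {w \<in> words I Q. P w}" unfolding cP using full by simp
  finally show ?thesis .
qed

text \<open>A first-moment bound with a random family: on a fibre the family \<open>F w\<close> is
  frozen, and each of its \<open>u\<close>-sets lies in the unexposed part \<open>G\<close>, so all
  its letters fall below \<open>s\<close> with probability \<open>(s / Q) ^ u\<close>.\<close>

lemma family_bound:
  assumes I: "finite I" "G \<subseteq> I" and sQ: "s \<le> Q" "0 < Q"
    and P: "local_off I Q G P" and F: "local_off I Q G F"
    and fam: "\<And>w. w \<in> words I Q \<Longrightarrow> P w \<Longrightarrow> finite (F w) \<and> real (card (F w)) \<le> N"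
    and N0: "0 \<le> N" and mem: "\<And>w T. w \<in> words I Q \<Longrightarrow> P w \<Longrightarrow> T \<in> F w \<Longrightarrow> T \<subseteq> G \<and> card T = u"
  shows "real (card {w \<in> words I Q. P w \<and> (\<exists>T\<in>F w. \<forall>i\<in>T. w i < s)})
    \<le> N * (real s / real Q) ^ u * real (card (words I Q))"
proof -
  have "real (card {w \<in> words I Q. P w \<and> (\<exists>T\<in>F w. \<forall>i\<in>T. w i < s)})
     \<le> N * (real s / real Q) ^ u * real (card {w \<in> words I Q. P w})"
  proof (rule fiber_bound[OF I P])
    fix w assume w: "w \<in> words I Q" "P w"
    define Y where "Y T = {w' \<in> words I Q. (\<forall>i\<in>I - G. w' i = w i) \<and> (\<forall>i\<in>T. w' i \<in> {..<s})}" for T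
    have finY: "finite (Y T)" for T unfolding Y_def using finite_words[OF I(1)] by simp
    have finF: "finite (F w)" using fam[OF w] by simp
    have "{w' \<in> words I Q. (\<forall>i\<in>I - G. w' i = w i) \<and> (\<exists>T\<in>F w'. \<forall>i\<in>T. w' i < s)} \<subseteq> (\<Union>T\<in>F w. Y T)"
    proof
      fix w' assume "w' \<in> {w' \<in> words I Q. (\<forall>i\<in>I - G. w' i = w i) \<and> (\<exists>T\<in>F w'. \<forall>i\<in>T. w' i < s)}"
      then obtain T where w': "w' \<in> words I Q" "\<forall>i\<in>I - G. w' i = w i" "T \<in> F w'" "\<forall>i\<in>T. w' i < s" by blast
      have "F w' = F w" using F w'(1,2) w(1) unfolding local_off_def by blast
      then show "w' \<in> (\<Union>T\<in>F w. Y T)" using w' unfolding Y_def by blast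
    qed
    then have "card {w' \<in> words I Q. (\<forall>i\<in>I - G. w' i = w i) \<and> (\<exists>T\<in>F w'. \<forall>i\<in>T. w' i < s)} \<le> card (\<Union>T\<in>F w. Y T)"
      using finF finY by (intro card_mono) auto
    also have "\<dots> \<le> (\<Sum>T\<in>F w. card (Y T))" by (rule card_UN_le[OF finF])
    finally have "real (card {w' \<in> words I Q. (\<forall>i\<in>I - G. w' i = w i) \<and> (\<exists>T\<in>F w'. \<forall>i\<in>T. w' i < s)})
       \<le> real (\<Sum>T\<in>F w. card (Y T))" by (rule of_nat_mono)
    also have "\<dots> = (\<Sum>T\<in>F w. (real s / real Q) ^ u * real (Q ^ card G))"
      unfolding of_nat_sum
    proof (rule sum.cong)
      fix T assume T: "T \<in> F w"
      have Tu: "T \<subseteq> G" "card T = u" using mem[OF w T] by auto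
      have uG: "u \<le> card G" using Tu I finite_subset card_mono by metis
      have "card (Y T) = (\<Prod>i\<in>T. card {..<s}) * Q ^ (card G - card T)"
        unfolding Y_def using sQ by (intro card_fiber[OF I w(1) Tu(1)]) auto
      then have "real (card (Y T)) = real s ^ u * real Q ^ (card G - u)" using Tu by simp
      also have "\<dots> = (real s / real Q) ^ u * real (Q ^ card G)"
        using uG sQ by (simp add: power_divide power_diff)
      finally show "real (card (Y T)) = (real s / real Q) ^ u * real (Q ^ card G)" .
    qed simp
    also have "\<dots> = real (card (F w)) * ((real s / real Q) ^ u * real (Q ^ card G))" by simp
    also have "\<dots> \<le> N * ((real s / real Q) ^ u * real (Q ^ card G))"
      using fam[OF w] by (intro mult_right_mono) auto
    finally show "real (card {w' \<in> words I Q. (\<forall>i\<in>I - G. w' i = w i) \<and> (\<exists>T\<in>F w'. \<forall>i\<in>T. w' i < s)})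
       \<le> N * (real s / real Q) ^ u * real (Q ^ card G)" by (simp add: mult.assoc)
  qed
  also have "\<dots> \<le> N * (real s / real Q) ^ u * real (card (words I Q))"
    using N0 finite_words[OF I(1)] by (intro mult_left_mono) (auto intro!: card_mono)
  finally show ?thesis .
qed

lemma power_self_le_fact: "(real t) ^ t \<le> exp (real t) * fact t"
proof -
  have "(real t) ^ t /\<^sub>R fact t \<le> (\<Sum>n. (real t) ^ n /\<^sub>R fact n)"
    using sum_le_suminf[OF summable_exp_generic[of "real t"], of "{t}"] by simp
  then have "(real t) ^ t / fact t \<le> exp (real t)" by (simp add: exp_def divide_inverse mult.commute)
  then show ?thesis by (simp add: field_simps)
qed

lemma binomial_exp_bound:
  assumes "real N \<le> b" "1 \<le> t"
  shows "real (N choose t) \<le> (exp 1 * b / real t) ^ t"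
proof -
  have "real (N choose t) * fact t \<le> real N ^ t"
  proof -
    have "real ((N choose t) * fact t) \<le> real (N ^ t)"
      by (rule of_nat_mono[OF binomial_fact_pow])
    then show ?thesis by simp
  qed
  also have "\<dots> \<le> b ^ t" using assms by (intro power_mono) auto
  finally have "real (N choose t) \<le> b ^ t / fact t" by (simp add: field_simps)
  also have "\<dots> \<le> b ^ t * (exp (real t) / real t ^ t)"
  proof -
    have "1 / fact t \<le> exp (real t) / real t ^ t"
      using power_self_le_fact[of t] assms(2) by (simp add: field_simps)
    then have "b ^ t * (1 / fact t) \<le> b ^ t * (exp (real t) / real t ^ t)"
      using assms(1) by (intro mult_left_mono) auto
    then show ?thesis by simp
  qed
  also have "\<dots> = (exp 1 * b / real t) ^ t"
    by (simp add: power_divide power_mult_distrib exp_of_nat_mult[symmetric])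
  finally show ?thesis .
qed

text \<open>The upper tail of a binomial variable, by counting \<open>t\<close>-subsets. The ground
  set \<open>E w\<close> may itself be random as long as it is determined outside \<open>G\<close>;
  the second entropy condition needs this, since there the ground set is built from a union of
  columns.\<close>

lemma edge_bound:
  assumes I: "finite I" "G \<subseteq> I" and sQ: "s \<le> Q" "0 < Q"
    and P: "local_off I Q G P" and E: "local_off I Q G E"
    and Esub: "\<And>w. w \<in> words I Q \<Longrightarrow> P w \<Longrightarrow> E w \<subseteq> G \<and> real (card (E w)) \<le> b"
    and t: "1 \<le> t" and b: "0 \<le> b"
  shows "real (card {w \<in> words I Q. P w \<and> t \<le> card {i \<in> E w. w i < s}})
    \<le> (exp 1 * b * (real s / real Q) / real t) ^ t * real (card (words I Q))"
proof -
  define F where "F w = {T. T \<subseteq> E w \<and> card T = t}" for w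
  have finE: "finite (E w)" if "w \<in> words I Q" "P w" for w
    using Esub[OF that] I finite_subset by metis
  have "{w \<in> words I Q. P w \<and> t \<le> card {i \<in> E w. w i < s}} \<subseteq> {w \<in> words I Q. P w \<and> (\<exists>T\<in>F w. \<forall>i\<in>T. w i < s)}"
  proof
    fix w assume "w \<in> {w \<in> words I Q. P w \<and> t \<le> card {i \<in> E w. w i < s}}"
    then have w: "w \<in> words I Q" "P w" "t \<le> card {i \<in> E w. w i < s}" by auto
    obtain T where "T \<subseteq> {i \<in> E w. w i < s}" "card T = t" using w(3) by (rule obtain_subset_with_card_n)
    then have "T \<in> F w" "\<forall>i\<in>T. w i < s" unfolding F_def by auto
    then show "w \<in> {w \<in> words I Q. P w \<and> (\<exists>T\<in>F w. \<forall>i\<in>T. w i < s)}" using w by blast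
  qed
  then have "real (card {w \<in> words I Q. P w \<and> t \<le> card {i \<in> E w. w i < s}})
    \<le> real (card {w \<in> words I Q. P w \<and> (\<exists>T\<in>F w. \<forall>i\<in>T. w i < s)})"
    using finite_words[OF I(1)] by (intro of_nat_mono card_mono) auto
  also have "\<dots> \<le> (exp 1 * b / real t) ^ t * (real s / real Q) ^ t * real (card (words I Q))"
  proof (rule family_bound[OF I sQ P])
    show "local_off I Q G F" using E unfolding local_off_def F_def by metis
    show "finite (F w) \<and> real (card (F w)) \<le> (exp 1 * b / real t) ^ t" if "w \<in> words I Q" "P w" for w
    proof
      show "finite (F w)" unfolding F_def using finE[OF that] by simp
      have "card (F w) = card (E w) choose t" unfolding F_def by (rule n_subsets[OF finE[OF that]])
      then show "real (card (F w)) \<le> (exp 1 * b / real t) ^ t"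
        using binomial_exp_bound Esub[OF that] t by simp
    qed
    show "T \<subseteq> G \<and> card T = t" if "w \<in> words I Q" "P w" "T \<in> F w" for w T
      using that Esub[of w] unfolding F_def by auto
  qed (use b in simp)
  also have "(exp 1 * b / real t) ^ t * (real s / real Q) ^ t = (exp 1 * b * (real s / real Q) / real t) ^ t"
    by (simp add: power_mult_distrib[symmetric] mult.commute)
  finally show ?thesis .
qed

text \<open>The columns are exposed one by one: as long as the past is good, the next column fails with
  conditional probability at most \<open>c\<close>.\<close>
lemma column_process:
  fixes n M Q :: nat
  defines "I \<equiv> {..<n} \<times> {..<M}"
  assumes Good: "\<And>i. i < M \<Longrightarrow> local_off I Q {vj \<in> I. i \<le> snd vj} (Good i)"
    and Succ: "\<And>i. i < M \<Longrightarrow> local_off I Q {vj \<in> I. i < snd vj} (Succ i)"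
    and c: "0 \<le> c"
    and step: "\<And>w i. w \<in> words I Q \<Longrightarrow> i < M \<Longrightarrow> Good i w \<Longrightarrow>
      real (card {w' \<in> words I Q. (\<forall>e\<in>I - {..<n} \<times> {i}. w' e = w e) \<and> \<not> Succ i w'}) \<le> c * real (Q ^ n)"
    and k: "k \<le> M"
  shows "real (card {w \<in> words I Q. \<forall>i<k. Good i w \<and> \<not> Succ i w}) \<le> c ^ k * real (card (words I Q))"
  using k
proof (induction k)
  case 0
  then show ?case by simp
next
  case (Suc k)
  have finI: "finite I" unfolding I_def by simp
  define P where "P w \<longleftrightarrow> (\<forall>i<k. Good i w \<and> \<not> Succ i w) \<and> Good k w" for w
  have GI: "{..<n} \<times> {k} \<subseteq> I" unfolding I_def using Suc.prems by auto
  have "{w \<in> words I Q. \<forall>i<Suc k. Good i w \<and> \<not> Succ i w} = {w \<in> words I Q. P w \<and> \<not> Succ k w}"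
    unfolding P_def by (auto simp: less_Suc_eq)
  moreover have "real (card {w \<in> words I Q. P w \<and> \<not> Succ k w}) \<le> c * real (card {w \<in> words I Q. P w})"
  proof (rule fiber_bound[OF finI GI])
    show "local_off I Q ({..<n} \<times> {k}) P"
    proof (rule local_offI)
      fix w w' assume w: "w \<in> words I Q" "w' \<in> words I Q"
        and eq: "\<And>i. i \<in> I \<Longrightarrow> i \<notin> {..<n} \<times> {k} \<Longrightarrow> w i = w' i"
      have eq': "w i = w' i" if "i \<in> I" "snd i \<noteq> k" for i using eq[OF that(1)] that(2) by (cases i) auto
      have "Good i w = Good i w'" if "i \<le> k" for i
        using Suc.prems that by (intro local_offD[OF Good w] eq') auto
      moreover have "Succ i w = Succ i w'" if "i < k" for i
        using Suc.prems that by (intro local_offD[OF Succ w] eq') auto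
      ultimately show "P w = P w'" unfolding P_def by auto
    qed
    show "real (card {w' \<in> words I Q. (\<forall>e\<in>I - {..<n} \<times> {k}. w' e = w e) \<and> \<not> Succ k w'})
       \<le> c * real (Q ^ card ({..<n} \<times> {k}))" if "w \<in> words I Q" "P w" for w
      using step[of w k] that Suc.prems unfolding P_def by (simp add: card_cartesian_product)
  qed
  moreover have "card {w \<in> words I Q. P w} \<le> card {w \<in> words I Q. \<forall>i<k. Good i w \<and> \<not> Succ i w}"
    using finite_words[OF finI] by (intro card_mono) (auto simp: P_def)
  then have "c * real (card {w \<in> words I Q. P w}) \<le> c * (c ^ k * real (card (words I Q)))"
    using Suc c by (intro mult_left_mono) (auto intro: order_trans[OF of_nat_mono])
  ultimately show ?case by (simp add: mult.assoc)
qed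

section \<open>One column of the random labelling\<close>

text \<open>A word assigns to each pair of a vertex and a column one of \<open>s * B\<close> values; the values below \<open>s\<close> put
  the vertex into that column and serve as its label there.\<close>
definition active :: "nat \<Rightarrow> nat \<Rightarrow> (nat \<times> nat \<Rightarrow> nat) \<Rightarrow> nat \<Rightarrow> nat set" where
  "active n s w j = {v. v < n \<and> w (v, j) < s}"

lemma active_sub: "active n s w j \<subseteq> {..<n}"
  by (auto simp: active_def)

lemma finite_active [simp]: "finite (active n s w j)"
  by (simp add: active_def)

text \<open>This and the following congruences record what each notion reads: sharing and danger at
  stage \<open>i\<close> only the columns before \<open>i\<close>, pruning and edges also column
  \<open>i\<close>. The \<open>local_off\<close> conditions of the process rest on them.\<close>

lemma shares_cong:
  assumes "\<And>j. j < i \<Longrightarrow> A j = A' j" shows "shares A i = shares A' i"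
  unfolding shares_def fun_eq_iff using assms by auto

lemma prune_cong:
  assumes "\<And>j. j \<le> i \<Longrightarrow> A j = A' j" shows "prune A i = prune A' i"
proof -
  have "shares A i = shares A' i" using assms by (intro shares_cong) auto
  moreover have "A i = A' i" using assms by simp
  ultimately show ?thesis unfolding prune_def by simp
qed

lemma joined_cong:
  assumes "\<And>j. j < i \<Longrightarrow> A j = A' j" shows "joined A i = joined A' i"
proof -
  have "prune A j = prune A' j" if "j < i" for j using assms that by (intro prune_cong) auto
  then show ?thesis unfolding joined_def fun_eq_iff by auto
qed

lemma danger_cong:
  assumes "\<And>j. j < i \<Longrightarrow> A j = A' j"
  shows "pair_danger A i = pair_danger A' i" "triple_danger A i = triple_danger A' i"
proof -
  have "joined A i = joined A' i" by (rule joined_cong) (rule assms)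
  then show "pair_danger A i = pair_danger A' i" "triple_danger A i = triple_danger A' i"
    by (simp_all add: pair_danger_def triple_danger_def fun_eq_iff)
qed

lemma good_tuple_cong:
  assumes "\<And>j. j < i \<Longrightarrow> A j = A' j"
  shows "good_tuple A i s S = good_tuple A' i s S" "blockers A i s = blockers A' i s"
proof -
  have "shares A i = shares A' i" by (rule shares_cong) (rule assms)
  moreover have "pair_danger A i = pair_danger A' i" "triple_danger A i = triple_danger A' i"
    by (rule danger_cong; rule assms; assumption)+
  ultimately show "good_tuple A i s S = good_tuple A' i s S" "blockers A i s = blockers A' i s"
    by (simp_all add: good_tuple_def blockers_def fun_eq_iff)
qed

lemma edge_at_cong:
  assumes "\<And>j. j \<le> i \<Longrightarrow> A j = A' j" "\<And>x. x \<in> A i \<Longrightarrow> c i x = c' i x"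
  shows "edge_at A c i x y = edge_at A' c' i x y"
proof -
  have "c i x = c' i x \<and> c i y = c' i y" if "x \<in> prune A i" "y \<in> prune A i"
    using assms(2) that by (auto simp: prune_def)
  moreover have "prune A i = prune A' i" using assms(1) by (rule prune_cong)
  moreover have "pair_danger A i = pair_danger A' i" "triple_danger A i = triple_danger A' i"
    using assms(1) by (intro danger_cong; auto)+
  ultimately show ?thesis unfolding edge_at_def by auto
qed

definition makes_clique :: "nat \<Rightarrow> nat \<Rightarrow> nat set \<Rightarrow> nat \<Rightarrow> (nat \<times> nat \<Rightarrow> nat) \<Rightarrow> bool" where
  "makes_clique n s S i w \<longleftrightarrow> (\<exists>u. (\<forall>a<s. u a \<in> S) \<and> inj_on u {..<s} \<and>
     (\<forall>a<s. \<forall>b<s. a \<noteq> b \<longrightarrow> edge_at (active n s w) (\<lambda>i x. w (x, i)) i (u a) (u b)))"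

definition admissible :: "nat \<Rightarrow> nat \<Rightarrow> nat \<Rightarrow> nat set \<Rightarrow> nat \<Rightarrow> (nat \<times> nat \<Rightarrow> nat) \<Rightarrow> (nat \<Rightarrow> nat) set" where
  "admissible n B s S i w = {u. good_tuple (active n s w) i s S u \<and> 4 * card (blockers (active n s w) i s u) \<le> B}"

text \<open>The substitute for typicality in the exposure argument: it is decided by the columns
  before \<open>i\<close>, so column \<open>i\<close> is still independent of it.\<close>

definition healthy :: "nat \<Rightarrow> nat \<Rightarrow> nat \<Rightarrow> nat set \<Rightarrow> nat \<Rightarrow> (nat \<times> nat \<Rightarrow> nat) \<Rightarrow> bool" where
  "healthy n B s S i w \<longleftrightarrow> real (card S) ^ s \<le> 2 * real (card (admissible n B s S i w))"

text \<open>Agreement on earlier columns preserves all danger. If no blocker besides tuple members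
  enters column \<open>i\<close>, nothing prunes a tuple member and no third vertex suppresses an
  edge; further vertices of the column are harmless.\<close>

lemma tuple_makes_clique:
  fixes n s i :: nat
  defines "A \<equiv> active n s"
  assumes gt: "good_tuple (A w) i s S u"
    and same: "\<And>j. j < i \<Longrightarrow> A w' j = A w j"
    and hit: "\<And>a. a < s \<Longrightarrow> u a < n \<and> w' (u a, i) = a"
    and miss: "\<And>v. v \<in> blockers (A w) i s u \<Longrightarrow> v \<notin> u ` {..<s} \<Longrightarrow> \<not> w' (v, i) < s"
  shows "makes_clique n s S i w'"
proof -
  have good: "good_tuple (A w') i s S u" and bl: "blockers (A w') i s u = blockers (A w) i s u"
    using gt good_tuple_cong[OF same] by auto
  have p: "u a \<noteq> u b" "\<not> shares (A w') i (u a) (u b)" "\<not> pair_danger (A w') i (u a) (u b)"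
    if "a < s" "b < s" "a \<noteq> b" for a b using good that unfolding good_tuple_def by auto
  have t: "\<not> triple_danger (A w') i (u a) (u b) (u c)"
    if "a < s" "b < s" "c < s" "a \<noteq> b" "c \<noteq> a" "c \<noteq> b" for a b c
    using good that unfolding good_tuple_def by auto
  have inA: "u a \<in> A w' i" if "a < s" for a using hit[OF that] that by (simp add: A_def active_def)
  have only: "v \<in> u ` {..<s}" if "v \<in> A w' i" "v \<in> blockers (A w') i s u" for v
    using miss[of v] that unfolding bl by (auto simp: A_def active_def)
  have inP: "u a \<in> prune (A w') i" if a: "a < s" for a
  proof -
    have "\<not> shares (A w') i (u a) z" if z: "z \<in> A w' i" "z \<noteq> u a" for z
    proof
      assume sh: "shares (A w') i (u a) z"
      then have "z \<in> blockers (A w') i s u" using a unfolding blockers_def by blast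
      then obtain b where b: "b < s" "z = u b" using only z(1) by blast
      then have "a \<noteq> b" using z by auto
      then show False using p(2)[OF a b(1)] sh b by simp
    qed
    then show ?thesis using inA[OF a] unfolding prune_def by blast
  qed
  have "edge_at (A w') (\<lambda>i x. w' (x, i)) i (u a) (u b)" if ab: "a < s" "b < s" "a \<noteq> b" for a b
    unfolding edge_at_def
  proof (intro conjI ballI impI)
    show "u a \<in> prune (A w') i" "u b \<in> prune (A w') i" using inP ab by auto
    show "w' (u a, i) \<noteq> w' (u b, i)" using hit ab by auto
    show "\<not> pair_danger (A w') i (u a) (u b)" using p ab by auto
    fix z assume z: "z \<in> prune (A w') i" "z \<noteq> u a" "z \<noteq> u b"
    show "\<not> triple_danger (A w') i (u a) (u b) z"
    proof
      assume td: "triple_danger (A w') i (u a) (u b) z"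
      then have "z \<in> blockers (A w') i s u" using ab unfolding blockers_def by blast
      then obtain c where c: "c < s" "z = u c" using only z(1) unfolding prune_def by blast
      then have "c \<noteq> a" "c \<noteq> b" using z by auto
      then show False using t[of a b c] ab c td by simp
    qed
  qed
  moreover have "inj_on u {..<s}" using p(1) unfolding inj_on_def by blast
  moreover have "u a \<in> S" if "a < s" for a using good that unfolding good_tuple_def by auto
  ultimately show ?thesis unfolding makes_clique_def A_def by blast
qed

text \<open>For each admissible tuple consider the event that it receives its labels while the rest
  of \<open>S\<close> and all its blockers stay out of column \<open>i\<close>. These events are
  disjoint, so their probabilities simply add and no second-moment argument is needed: at least
  \<open>card S ^ s / 2\<close> tuples contribute at least \<open>1 / (2 * Q ^ s)\<close>
  each.\<close>

lemma column_success:
  fixes n M B s i :: nat and w :: "nat \<times> nat \<Rightarrow> nat"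
  defines "I \<equiv> {..<n} \<times> {..<M}" and "Q \<equiv> s * B"
  assumes S: "S \<subseteq> {..<n}" "4 * card S \<le> B" and s: "1 \<le> s" and B: "1 \<le> B"
    and i: "i < M" and w: "w \<in> words I Q" and h: "healthy n B s S i w"
  shows "real (card {w' \<in> words I Q. (\<forall>e\<in>I - {..<n} \<times> {i}. w' e = w e) \<and> \<not> makes_clique n s S i w'})
    \<le> (1 - (real (card S) / real Q) ^ s / 4) * real (Q ^ n)"
proof -
  define A where "A = active n s w"
  define GT where "GT = admissible n B s S i w"
  define Fib where "Fib = {w' \<in> words I Q. \<forall>e\<in>I - {..<n} \<times> {i}. w' e = w e}"
  have finI: "finite I" by (simp add: I_def)
  have GI: "{..<n} \<times> {i} \<subseteq> I" using i by (auto simp: I_def)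
  have finS: "finite S" using S by (auto intro: finite_below)
  have finFib: "finite Fib" unfolding Fib_def using finite_words[OF finI] by simp
  have cFib: "card Fib = Q ^ n"
    unfolding Fib_def using card_full_fiber[OF finI GI w] by (simp add: card_cartesian_product)
  have sQ: "s \<le> Q" "1 \<le> Q" using s B by (auto simp: Q_def)
  have GTp: "good_tuple A i s S u" "4 * card (blockers A i s u) \<le> B" "u \<in> {..<s} \<rightarrow>\<^sub>E S" "inj_on u {..<s}" if "u \<in> GT" for u
    using that unfolding GT_def admissible_def A_def good_tuple_def inj_on_def by auto
  have finGT: "finite GT"
  proof (rule finite_subset)
    show "GT \<subseteq> {..<s} \<rightarrow>\<^sub>E S" using GTp by auto
    show "finite ({..<s} \<rightarrow>\<^sub>E S)" using finS by (intro finite_PiE) auto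
  qed
  have bl: "blockers A i s u \<subseteq> {..<n}" for u
  proof -
    have "z < n" if "shares A i x z" for x z using that unfolding shares_def A_def active_def by auto
    moreover have "z < n" if td: "triple_danger A i x y z" for x y z
    proof -
      obtain v where "joined A i z v" using td unfolding triple_danger_def by blast
      then have "shares A i z v" by (rule joined_imp_shares)
      then show ?thesis unfolding shares_def A_def active_def by auto
    qed
    ultimately show ?thesis unfolding blockers_def by auto
  qed
  \<comment> \<open>Keeping all of \<open>S\<close> out, not only the blockers, is what makes the
    events \<open>E u\<close> disjoint: the vertices of \<open>S\<close> in column \<open>i\<close>
    together with their labels determine \<open>u\<close>.\<close>
  define D where "D u = S \<union> blockers A i s u" for u
  define X where "X u e = (if fst e \<in> u ` {..<s} then {the_inv_into {..<s} u (fst e)} else {s..<Q})" for u :: "nat \<Rightarrow> nat" and e :: "nat \<times> nat"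
  define E where "E u = {w' \<in> words I Q. (\<forall>e\<in>I - {..<n} \<times> {i}. w' e = w e) \<and> (\<forall>e\<in>D u \<times> {i}. w' e \<in> X u e)}" for u
  have Dn: "D u \<subseteq> {..<n}" for u using S bl by (auto simp: D_def)
  have finD: "finite (D u)" for u using Dn by (auto intro: finite_below)
  have uS: "u a \<in> S" if "u \<in> GT" "a < s" for u a using GTp(3)[OF that(1)] that(2) by auto
  have Xin: "X u (u a, i) = {a}" if "u \<in> GT" "a < s" for u a
    using that GTp(4) by (auto simp: X_def the_inv_into_f_f)
  have Eval: "w' (u a, i) = a" if "w' \<in> E u" "u \<in> GT" "a < s" for w' u a
  proof -
    have "(u a, i) \<in> D u \<times> {i}" using uS[OF that(2,3)] by (auto simp: D_def)
    then have "w' (u a, i) \<in> X u (u a, i)" using that(1) unfolding E_def by blast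
    then show ?thesis using Xin[OF that(2,3)] by simp
  qed
  have Eoff: "s \<le> w' (v, i)" if "w' \<in> E u" "v \<in> D u" "v \<notin> u ` {..<s}" for w' u v
  proof -
    have "w' (v, i) \<in> X u (v, i)" using that unfolding E_def by blast
    then show ?thesis using that(3) by (auto simp: X_def)
  qed
  have Esucc: "makes_clique n s S i w'" if w': "w' \<in> E u" and u: "u \<in> GT" for w' u
  proof (rule tuple_makes_clique)
    show "good_tuple (active n s w) i s S u" using GTp(1)[OF u] unfolding A_def .
    show "active n s w' j = active n s w j" if "j < i" for j
    proof -
      have "w' (v, j) = w (v, j)" if "v < n" for v
        using w' \<open>v < n\<close> \<open>j < i\<close> i unfolding E_def I_def by auto
      then show ?thesis unfolding active_def by auto
    qed
    show "u a < n \<and> w' (u a, i) = a" if "a < s" for a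
      using uS[OF u that] S Eval[OF w' u that] by auto
    show "\<not> w' (v, i) < s" if "v \<in> blockers (active n s w) i s u" "v \<notin> u ` {..<s}" for v
      using Eoff[OF w' _ that(2)] that(1) unfolding D_def A_def by auto
  qed
  have disj: "u = u'" if "w' \<in> E u" "w' \<in> E u'" "u \<in> GT" "u' \<in> GT" for w' u u'
  proof (rule PiE_ext[OF GTp(3)[OF that(3)] GTp(3)[OF that(4)]])
    fix a assume "a \<in> {..<s}"
    then have a: "a < s" by simp
    have v: "w' (u' a, i) = a" using Eval[OF that(2,4) a] .
    have "u' a \<in> D u" using uS[OF that(4) a] by (auto simp: D_def)
    then have "u' a \<in> u ` {..<s}" using Eoff[OF that(1), of "u' a"] v a by auto
    then obtain b where b: "b < s" "u' a = u b" by auto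
    then show "u a = u' a" using Eval[OF that(1,3) b(1)] v by simp
  qed
  have cE: "real (Q ^ n) / (2 * real Q ^ s) \<le> real (card (E u))" if u: "u \<in> GT" for u
  proof -
    have sub: "D u \<times> {i} \<subseteq> {..<n} \<times> {i}" using Dn by auto
    have XQ: "X u e \<subseteq> {..<Q}" if "e \<in> D u \<times> {i}" for e
      using GTp(4)[OF u] sQ by (auto simp: X_def the_inv_into_f_f)
    have uD: "u ` {..<s} \<subseteq> D u" using uS[OF u] by (auto simp: D_def)
    have cu: "card (u ` {..<s}) = s" using card_image[OF GTp(4)[OF u]] by simp
    define N where "N = card (D u)"
    have sN: "s \<le> N" unfolding N_def using card_mono[OF finD uD] cu by simp
    have Nn: "N \<le> n" unfolding N_def using card_mono[OF _ Dn] by simp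
    have N2: "2 * N \<le> B"
      using card_Un_le[of S "blockers A i s u"] S(2) GTp(2)[OF u] unfolding N_def D_def by linarith
    have "card (E u) = (\<Prod>e\<in>D u \<times> {i}. card (X u e)) * Q ^ (card ({..<n} \<times> {i}) - card (D u \<times> {i}))"
      unfolding E_def by (rule card_fiber[OF finI GI w sub XQ])
    also have "(\<Prod>e\<in>D u \<times> {i}. card (X u e)) = (\<Prod>v\<in>D u. if v \<in> u ` {..<s} then 1 else Q - s)"
      by (rule prod.reindex_bij_witness[of _ "\<lambda>v. (v, i)" fst]) (auto simp: X_def)
    also have "\<dots> = (Q - s) ^ card (D u - u ` {..<s})"
      using finD by (simp add: prod.If_cases Diff_eq)
    also have "card (D u - u ` {..<s}) = N - s" using uD cu finD by (simp add: card_Diff_subset N_def)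
    finally have "card (E u) = (Q - s) ^ (N - s) * Q ^ (n - N)" by (simp add: card_cartesian_product N_def)
    then have "real (card (E u)) = (real Q - real s) ^ (N - s) * real Q ^ (n - N)" using sQ by (simp add: of_nat_diff)
    also have "real Q - real s = real Q * (1 - 1 / real B)" using B s by (simp add: Q_def field_simps)
    also have "(real Q * (1 - 1 / real B)) ^ (N - s) * real Q ^ (n - N) = (1 - 1 / real B) ^ (N - s) * real Q ^ (n - s)"
    proof -
      have "n - s = (N - s) + (n - N)" using sN Nn by simp
      then show ?thesis by (simp add: power_mult_distrib power_add)
    qed
    \<comment> \<open>At most \<open>B / 2\<close> vertices have to stay out, and each would enter
      with probability \<open>1 / B\<close>; Bernoulli's inequality leaves at least one
      half.\<close>
    also have "\<dots> \<ge> (1/2) * real Q ^ (n - s)"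
    proof (rule mult_right_mono)
      have "1 + real (N - s) * (- (1 / real B)) \<le> (1 + - (1 / real B)) ^ (N - s)"
        by (rule Bernoulli_inequality) (use B in simp)
      moreover have "real (N - s) * (1 / real B) \<le> 1/2"
      proof -
        have "2 * real (N - s) \<le> real B" using N2 sN by linarith
        then show ?thesis using B by (simp add: field_simps)
      qed
      ultimately show "1/2 \<le> (1 - 1 / real B) ^ (N - s)" by simp
    qed simp
    also have "(1/2) * real Q ^ (n - s) = real (Q ^ n) / (2 * real Q ^ s)"
      using sQ sN Nn by (simp add: power_diff)
    finally show ?thesis by simp
  qed
  have finE: "finite (E u)" for u unfolding E_def using finite_words[OF finI] by simp
  define Yes where "Yes = {w' \<in> Fib. makes_clique n s S i w'}"
  have "(\<Sum>u\<in>GT. card (E u)) = card (\<Union>u\<in>GT. E u)"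
    using finGT finE disj by (intro card_UN_disjoint[symmetric]) auto
  also have "\<dots> \<le> card Yes"
  proof (rule card_mono)
    show "finite Yes" using finFib by (simp add: Yes_def)
    show "(\<Union>u\<in>GT. E u) \<subseteq> Yes"
    proof
      fix w' assume "w' \<in> (\<Union>u\<in>GT. E u)"
      then obtain u where u: "u \<in> GT" "w' \<in> E u" by blast
      then have "w' \<in> Fib" by (auto simp: E_def Fib_def)
      then show "w' \<in> Yes" using Esucc[OF u(2,1)] by (simp add: Yes_def)
    qed
  qed
  finally have "real (\<Sum>u\<in>GT. card (E u)) \<le> real (card Yes)" by (rule of_nat_mono)
  moreover have "real (card GT) * (real (Q ^ n) / (2 * real Q ^ s)) \<le> real (\<Sum>u\<in>GT. card (E u))"
    unfolding of_nat_sum using sum_mono[OF cE, of GT "\<lambda>u. u"] by simp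
  moreover have "(real (card S) ^ s / 2) * (real (Q ^ n) / (2 * real Q ^ s)) \<le> real (card GT) * (real (Q ^ n) / (2 * real Q ^ s))"
    using h unfolding healthy_def GT_def by (intro mult_right_mono) auto
  ultimately have yes: "(real (card S) / real Q) ^ s / 4 * real (Q ^ n) \<le> real (card Yes)"
    by (simp add: power_divide)
  have e: "{w' \<in> words I Q. (\<forall>e\<in>I - {..<n} \<times> {i}. w' e = w e) \<and> \<not> makes_clique n s S i w'} = Fib - Yes"
    unfolding Fib_def Yes_def by auto
  have "card (Fib - Yes) = card Fib - card Yes" using finFib by (intro card_Diff_subset) (auto simp: Yes_def)
  moreover have "card Yes \<le> card Fib" using finFib by (intro card_mono) (auto simp: Yes_def)
  ultimately show ?thesis unfolding e using yes cFib by (simp add: of_nat_diff algebra_simps)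
qed

text \<open>An instance of \<open>column_process\<close>: health at stage \<open>i\<close> is known
  before column \<open>i\<close> is exposed, success immediately afterwards.\<close>

lemma never_clique_bound:
  fixes n M B s :: nat
  defines "I \<equiv> {..<n} \<times> {..<M}" and "Q \<equiv> s * B"
  assumes S: "S \<subseteq> {..<n}" "4 * card S \<le> B" and s: "1 \<le> s" and B: "1 \<le> B"
  shows "real (card {w \<in> words I Q. \<forall>i<M. healthy n B s S i w \<and> \<not> makes_clique n s S i w})
    \<le> (1 - (real (card S) / real Q) ^ s / 4) ^ M * real (card (words I Q))"
proof -
  have act: "active n s w j = active n s w' j"
    if "j < k" "k \<le> M" and eq: "\<And>e. e \<in> I \<Longrightarrow> e \<notin> {vj \<in> I. k \<le> snd vj} \<Longrightarrow> w e = w' e" for w w' j k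
  proof -
    have "w (v, j) = w' (v, j)" if "v < n" for v
      using that \<open>j < k\<close> \<open>k \<le> M\<close> by (intro eq) (auto simp: I_def)
    then show ?thesis unfolding active_def by auto
  qed
  have c0: "0 \<le> 1 - (real (card S) / real Q) ^ s / 4"
  proof -
    have "card S \<le> B" "B \<le> Q" using S s by (auto simp: Q_def)
    then have "real (card S) \<le> real Q" by simp
    moreover have "0 < real Q" using B s by (simp add: Q_def)
    ultimately have "real (card S) / real Q \<le> 1" by (simp add: divide_le_eq)
    then have "(real (card S) / real Q) ^ s \<le> 1" by (intro power_le_one) auto
    then show ?thesis by simp
  qed
  have Good: "local_off I Q {vj \<in> I. i \<le> snd vj} (healthy n B s S i)" if i: "i < M" for i
  proof (rule local_offI)
    fix w w' :: "nat \<times> nat \<Rightarrow> nat" assume eq: "\<And>e. e \<in> I \<Longrightarrow> e \<notin> {vj \<in> I. i \<le> snd vj} \<Longrightarrow> w e = w' e"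
    have "active n s w j = active n s w' j" if "j < i" for j using i by (intro act[OF that _ eq]) auto
    then show "healthy n B s S i w = healthy n B s S i w'"
      unfolding healthy_def admissible_def using good_tuple_cong[of i "active n s w" "active n s w'"] by simp
  qed
  have Succ: "local_off I Q {vj \<in> I. i < snd vj} (makes_clique n s S i)" if i: "i < M" for i
  proof (rule local_offI)
    fix w w' :: "nat \<times> nat \<Rightarrow> nat" assume eq: "\<And>e. e \<in> I \<Longrightarrow> e \<notin> {vj \<in> I. i < snd vj} \<Longrightarrow> w e = w' e"
    have a: "active n s w j = active n s w' j" if "j \<le> i" for j
      using i that by (intro act[of j "Suc i"]) (auto simp: Suc_le_eq intro: eq)
    have "w (x, i) = w' (x, i)" if "x \<in> active n s w i" for x
      using that i by (intro eq) (auto simp: active_def I_def)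
    then show "makes_clique n s S i w = makes_clique n s S i w'"
      unfolding makes_clique_def
      using edge_at_cong[of i "active n s w" "active n s w'" "\<lambda>i x. w (x, i)" "\<lambda>i x. w' (x, i)"] a by simp
  qed
  have step: "real (card {w' \<in> words I Q. (\<forall>e\<in>I - {..<n} \<times> {i}. w' e = w e) \<and> \<not> makes_clique n s S i w'})
      \<le> (1 - (real (card S) / real Q) ^ s / 4) * real (Q ^ n)"
    if "w \<in> words I Q" "i < M" "healthy n B s S i w" for w i
    using that unfolding I_def Q_def by (intro column_success[OF S s B])
  show ?thesis unfolding I_def
    by (rule column_process[OF Good[unfolded I_def] Succ[unfolded I_def] c0 step[unfolded I_def] order_refl])
qed

section \<open>Most labellings are typical\<close>

lemma card_exists_le:
  assumes "finite W" "finite X" "\<And>x. x \<in> X \<Longrightarrow> real (card {w \<in> W. R x w}) \<le> f x * c"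
  shows "real (card {w \<in> W. \<exists>x\<in>X. R x w}) \<le> (\<Sum>x\<in>X. f x) * c"
proof -
  have e: "{w \<in> W. \<exists>x\<in>X. R x w} = (\<Union>x\<in>X. {w \<in> W. R x w})" by auto
  have "card {w \<in> W. \<exists>x\<in>X. R x w} \<le> (\<Sum>x\<in>X. card {w \<in> W. R x w})"
    unfolding e by (rule card_UN_le[OF assms(2)])
  then have "real (card {w \<in> W. \<exists>x\<in>X. R x w}) \<le> real (\<Sum>x\<in>X. card {w \<in> W. R x w})" by (rule of_nat_mono)
  also have "\<dots> \<le> (\<Sum>x\<in>X. f x * c)" unfolding of_nat_sum by (rule sum_mono[OF assms(3)])
  also have "\<dots> = (\<Sum>x\<in>X. f x) * c" by (simp add: sum_distrib_right)
  finally show ?thesis .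
qed

lemma sum_Pow_power:
  fixes x :: real
  assumes "finite X" shows "(\<Sum>S\<in>Pow X. x ^ card S) = (1 + x) ^ card X"
  using assms
proof (induction X rule: finite_induct)
  case (insert a X)
  have "(\<Sum>S\<in>Pow (insert a X). x ^ card S) = (\<Sum>S\<in>Pow X. x ^ card S) + (\<Sum>S\<in>insert a ` Pow X. x ^ card S)"
    unfolding Pow_insert using insert.hyps by (intro sum.union_disjoint) auto
  also have "(\<Sum>S\<in>insert a ` Pow X. x ^ card S) = (\<Sum>S\<in>Pow X. x ^ card (insert a S))"
    using insert.hyps by (subst sum.reindex) (auto simp: inj_on_def)
  also have "\<dots> = (\<Sum>S\<in>Pow X. x * x ^ card S)"
  proof (rule sum.cong)
    fix S assume "S \<in> Pow X"
    then have "a \<notin> S" "finite S" using insert.hyps finite_subset by auto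
    then show "x ^ card (insert a S) = x * x ^ card S" by simp
  qed simp
  finally show ?case using insert by (simp add: sum_distrib_left[symmetric] algebra_simps)
qed simp

text \<open>Makes union bounds over sets of all sizes cheap: giving a set \<open>S\<close> the
  weight \<open>n\<close> to the power \<open>- card S\<close> keeps the total bounded, as
  \<open>(1 + 1/n) ^ n \<le> exp 1\<close>.\<close>

lemma sum_Pow_inverse_le:
  assumes "card X \<le> n" "finite X" "1 \<le> n" shows "(\<Sum>S\<in>Pow X. (1 / real n) ^ card S) \<le> exp 1"
proof -
  have "(\<Sum>S\<in>Pow X. (1 / real n) ^ card S) = (1 + 1 / real n) ^ card X"
    by (rule sum_Pow_power[OF assms(2)])
  also have "\<dots> \<le> (1 + 1 / real n) ^ n" using assms by (intro power_increasing) auto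
  also have "\<dots> \<le> exp (1 / real n) ^ n" by (intro power_mono exp_ge_add_one_self) auto
  also have "\<dots> = exp 1" using assms by (simp flip: exp_of_nat_mult)
  finally show ?thesis .
qed

lemma sum_Pow_card:
  fixes h :: "nat \<Rightarrow> real"
  assumes "finite X"
  shows "(\<Sum>K\<in>Pow X - {{}}. h (card K)) = (\<Sum>k=1..card X. real (card X choose k) * h k)"
proof -
  have e: "Pow X - {{}} = (\<Union>k\<in>{1..card X}. {K. K \<subseteq> X \<and> card K = k})"
  proof
    show "Pow X - {{}} \<subseteq> (\<Union>k\<in>{1..card X}. {K. K \<subseteq> X \<and> card K = k})"
    proof
      fix K assume K: "K \<in> Pow X - {{}}"
      then have "finite K" using assms finite_subset by auto
      then have "1 \<le> card K" using K by (simp add: Suc_le_eq card_gt_0_iff)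
      moreover have "card K \<le> card X" using K assms card_mono by auto
      ultimately show "K \<in> (\<Union>k\<in>{1..card X}. {K. K \<subseteq> X \<and> card K = k})" using K by auto
    qed
  qed auto
  have "(\<Sum>K\<in>Pow X - {{}}. h (card K)) = (\<Sum>k=1..card X. \<Sum>K\<in>{K. K \<subseteq> X \<and> card K = k}. h (card K))"
    unfolding e using assms by (intro sum.UNION_disjoint) auto
  also have "\<dots> = (\<Sum>k=1..card X. real (card {K. K \<subseteq> X \<and> card K = k}) * h k)"
    by (intro sum.cong) auto
  also have "\<dots> = (\<Sum>k=1..card X. real (card X choose k) * h k)"
    using n_subsets[OF assms] by simp
  finally show ?thesis .
qed

text \<open>Puts the binomial tail into the shape of the entropy conditions: a block violating such
  a condition has tail probability below the weight assigned to it in the union bound.\<close>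

lemma power_eq_exp_deficit:
  assumes "0 < (b::real)" "1 \<le> t"
  shows "(exp 1 * b / real t) ^ t = exp (- (real t * (ln (real t / b) - 1)))"
proof -
  have "exp 1 * b / real t = exp (1 - ln (real t / b))"
    using assms by (simp add: exp_diff)
  then have "(exp 1 * b / real t) ^ t = exp (real t * (1 - ln (real t / b)))"
    by (simp add: exp_of_nat_mult)
  then show ?thesis by (simp add: algebra_simps)
qed

lemma ln_power_inverse: "1 \<le> n \<Longrightarrow> exp (- (real k * ln (real n))) = (1 / real n) ^ k"
  by (simp add: exp_minus exp_of_nat_mult power_one_over inverse_eq_divide)

lemma sum_triple_product:
  fixes a :: "'a \<Rightarrow> real"
  shows "(\<Sum>(x, y, z)\<in>X \<times> Y \<times> Z. a x * b y * c z) = sum a X * (sum b Y * sum c Z)"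
proof -
  have "(\<Sum>(x, y, z)\<in>X \<times> Y \<times> Z. a x * b y * c z) = (\<Sum>x\<in>X. \<Sum>y\<in>Y. \<Sum>z\<in>Z. a x * b y * c z)"
    by (simp only: sum.cartesian_product split_def)
  also have "\<dots> = sum a X * (sum b Y * sum c Z)"
    by (simp only: sum_distrib_left[symmetric] sum_distrib_right[symmetric] mult.assoc)
  finally show ?thesis .
qed

section \<open>Tail bounds for the random columns\<close>

locale random_columns =
  fixes n M B s :: nat
  assumes pos: "1 \<le> s" "1 \<le> B" "2 \<le> n" "M \<le> n"
begin

abbreviation "Idx \<equiv> {..<n} \<times> {..<M}"
abbreviation "\<Omega> \<equiv> words Idx (s * B)"
abbreviation "A w \<equiv> active n s w"

lemma fin [simp]: "finite Idx" "finite \<Omega>"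
  by (auto intro!: finite_words)

lemma ratio: "real s / real (s * B) = 1 / real B" "s \<le> s * B" "0 < s * B"
  using pos by auto

lemma edges_bound:
  assumes G: "G \<subseteq> Idx" and P: "local_off Idx (s * B) G P" and E: "local_off Idx (s * B) G E"
    and Esub: "\<And>w. w \<in> \<Omega> \<Longrightarrow> P w \<Longrightarrow> E w \<subseteq> G \<and> real (card (E w)) \<le> b"
    and t: "1 \<le> t" and b: "0 \<le> b"
  shows "real (card {w \<in> \<Omega>. P w \<and> t \<le> card {i \<in> E w. w i < s}})
    \<le> (exp 1 * (b / real B) / real t) ^ t * real (card \<Omega>)"
  using edge_bound[OF fin(1) G ratio(2,3) P E Esub t b] unfolding ratio(1) by simp

lemma local_const: "local_off Idx (s * B) G (\<lambda>w. c)"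
  by (simp add: local_off_def)

lemma active_local:
  assumes "\<And>i. i \<in> Idx \<Longrightarrow> i \<notin> G \<Longrightarrow> w i = w' i" "j < M" "{..<n} \<times> {j} \<inter> G = {}"
  shows "A w j = A w' j"
proof -
  have "w (v, j) = w' (v, j)" if "v < n" for v using that assms(2,3) by (intro assms(1)) auto
  then show ?thesis unfolding active_def by auto
qed

lemma large_columns:
  assumes "real M * (exp 1 * (real n / real B) / real t) ^ t \<le> e" "1 \<le> t"
  shows "real (card {w \<in> \<Omega>. \<exists>j\<in>{..<M}. t \<le> card (A w j)}) \<le> e * real (card \<Omega>)"
proof -
  have "real (card {w \<in> \<Omega>. \<exists>j\<in>{..<M}. t \<le> card (A w j)}) \<le> (\<Sum>j<M. (exp 1 * (real n / real B) / real t) ^ t) * real (card \<Omega>)"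
  proof (rule card_exists_le)
    fix j assume j: "j \<in> {..<M}"
    have e: "card {i \<in> {..<n} \<times> {j}. w i < s} = card (A w j)" for w
      by (rule bij_betw_same_card[of fst]) (auto simp: bij_betw_def inj_on_def active_def image_iff)
    have "real (card {w \<in> \<Omega>. True \<and> t \<le> card {i \<in> {..<n} \<times> {j}. w i < s}})
      \<le> (exp 1 * (real n / real B) / real t) ^ t * real (card \<Omega>)"
      by (rule edges_bound[OF order_refl local_const local_const]) (use j assms in \<open>auto simp: card_cartesian_product\<close>)
    then show "real (card {w \<in> \<Omega>. t \<le> card (A w j)}) \<le> (exp 1 * (real n / real B) / real t) ^ t * real (card \<Omega>)"
      by (simp add: e)
  qed auto
  also have "\<dots> \<le> e * real (card \<Omega>)" using assms(1) by (intro mult_right_mono) auto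
  finally show ?thesis .
qed

lemma many_columns:
  assumes "real n * (exp 1 * (real M / real B) / real t) ^ t \<le> e" "1 \<le> t"
  shows "real (card {w \<in> \<Omega>. \<exists>v\<in>{..<n}. t \<le> card (cols (A w) M v)}) \<le> e * real (card \<Omega>)"
proof -
  have "real (card {w \<in> \<Omega>. \<exists>v\<in>{..<n}. t \<le> card (cols (A w) M v)}) \<le> (\<Sum>v<n. (exp 1 * (real M / real B) / real t) ^ t) * real (card \<Omega>)"
  proof (rule card_exists_le)
    fix v assume v: "v \<in> {..<n}"
    have e: "card {i \<in> {v} \<times> {..<M}. w i < s} = card (cols (A w) M v)" for w
      by (rule bij_betw_same_card[of snd]) (use v in \<open>auto simp: bij_betw_def inj_on_def active_def cols_def image_iff\<close>)
    have "real (card {w \<in> \<Omega>. True \<and> t \<le> card {i \<in> {v} \<times> {..<M}. w i < s}})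
      \<le> (exp 1 * (real M / real B) / real t) ^ t * real (card \<Omega>)"
      by (rule edges_bound[OF order_refl local_const local_const]) (use v assms in \<open>auto simp: card_cartesian_product\<close>)
    then show "real (card {w \<in> \<Omega>. t \<le> card (cols (A w) M v)}) \<le> (exp 1 * (real M / real B) / real t) ^ t * real (card \<Omega>)"
      by (simp add: e)
  qed auto
  also have "\<dots> \<le> e * real (card \<Omega>)" using assms(1) by (intro mult_right_mono) auto
  finally show ?thesis .
qed

abbreviation "common w x y \<equiv> {v\<in>{..<n}-{x,y}. \<exists>k<M. \<exists>j<M. k \<noteq> j \<and> x \<in> A w k \<and> y \<in> A w j \<and> v \<in> A w k \<and> v \<in> A w j}"

text \<open>First expose the letters of \<open>x\<close> and \<open>y\<close>, which fixes the
  columns through them. Then \<open>t\<close> common vertices need \<open>2 * t\<close> further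
  incidences, all distinct because \<open>k \<noteq> j\<close> and none at \<open>x\<close> or
  \<open>y\<close>. There are at most \<open>(n choose t) * d ^ (2 * t)\<close> patterns, each of
  probability \<open>1 / B ^ (2 * t)\<close>.\<close>

lemma large_codegree_pair:
  assumes xy: "x < n" "y < n" "x \<noteq> y" and t: "1 \<le> t" and d: "0 \<le> d"
  shows "real (card {w \<in> \<Omega>. (real (card (cols (A w) M x)) \<le> d \<and> real (card (cols (A w) M y)) \<le> d) \<and> t \<le> card (common w x y)})
    \<le> (exp 1 * (real n * d ^ 2 / real B ^ 2) / real t) ^ t * real (card \<Omega>)"
proof -
  define G where "G = {e \<in> Idx. fst e \<noteq> x \<and> fst e \<noteq> y}"
  define P where "P w \<longleftrightarrow> real (card (cols (A w) M x)) \<le> d \<and> real (card (cols (A w) M y)) \<le> d" for w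
  define Z where "Z w = (SIGMA V:{V. V \<subseteq> {..<n}-{x,y} \<and> card V = t}. (V \<rightarrow>\<^sub>E cols (A w) M x) \<times> (V \<rightarrow>\<^sub>E cols (A w) M y))" for w
  define T where "T = (\<lambda>(V, f, g). (\<lambda>v. (v, f v)) ` V \<union> (\<lambda>v. (v, g v)) ` V :: (nat \<times> nat) set)"
  define Z' where "Z' w = {z \<in> Z w. case z of (V, f, g) \<Rightarrow> \<forall>v\<in>V. f v \<noteq> g v}" for w
  define F where "F w = T ` Z' w" for w
  have colsx: "cols (A w) M u = {j. j < M \<and> w (u, j) < s}" if "u < n" for w u
    using that by (auto simp: cols_def active_def)
  have loc: "cols (A w) M u = cols (A w') M u"
    if "\<And>e. e \<in> Idx \<Longrightarrow> e \<notin> G \<Longrightarrow> w e = w' e" "u = x \<or> u = y" for w w' u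
  proof -
    have "w (u, j) = w' (u, j)" if "j < M" for j
      using xy \<open>u = x \<or> u = y\<close> that by (intro \<open>\<And>e. e \<in> Idx \<Longrightarrow> e \<notin> G \<Longrightarrow> w e = w' e\<close>) (auto simp: G_def)
    moreover have "u < n" using that xy by auto
    ultimately show ?thesis by (auto simp: colsx)
  qed
  have finV: "finite {V. V \<subseteq> {..<n}-{x,y} \<and> card V = t}" by simp
  have finVV: "finite V" if "V \<subseteq> {..<n}-{x,y}" for V using that by (auto intro: finite_below)
  have finZ: "finite (Z w)" for w
    unfolding Z_def using finVV by (intro finite_SigmaI finV finite_cartesian_product finite_PiE) auto
  have "real (card {w \<in> \<Omega>. P w \<and> (\<exists>T\<in>F w. \<forall>i\<in>T. w i < s)})
    \<le> ((exp 1 * real n / real t) ^ t * (d ^ t * d ^ t)) * (real s / real (s * B)) ^ (2 * t) * real (card \<Omega>)"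
  proof (rule family_bound[OF fin(1) _ ratio(2,3)])
    show "G \<subseteq> Idx" by (auto simp: G_def)
    show "local_off Idx (s * B) G P"
    proof (rule local_offI)
      fix w w' :: "nat \<times> nat \<Rightarrow> nat" assume eq: "\<And>e. e \<in> Idx \<Longrightarrow> e \<notin> G \<Longrightarrow> w e = w' e"
      show "P w = P w'" using loc[of w w' x, OF eq] loc[of w w' y, OF eq] by (simp add: P_def)
    qed
    show "local_off Idx (s * B) G F"
    proof (rule local_offI)
      fix w w' :: "nat \<times> nat \<Rightarrow> nat" assume eq: "\<And>e. e \<in> Idx \<Longrightarrow> e \<notin> G \<Longrightarrow> w e = w' e"
      show "F w = F w'" using loc[of w w' x, OF eq] loc[of w w' y, OF eq] by (simp add: F_def Z'_def Z_def)
    qed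
    show "finite (F w) \<and> real (card (F w)) \<le> (exp 1 * real n / real t) ^ t * (d ^ t * d ^ t)" if "w \<in> \<Omega>" "P w" for w
    proof
      have finZ': "finite (Z' w)" unfolding Z'_def using finZ by simp
      show "finite (F w)" unfolding F_def using finZ' by simp
      have "card (F w) \<le> card (Z' w)" unfolding F_def by (rule card_image_le[OF finZ'])
      also have "\<dots> \<le> card (Z w)" unfolding Z'_def by (intro card_mono finZ) auto
      also have "\<dots> = (\<Sum>V\<in>{V. V \<subseteq> {..<n}-{x,y} \<and> card V = t}. card ((V \<rightarrow>\<^sub>E cols (A w) M x) \<times> (V \<rightarrow>\<^sub>E cols (A w) M y)))"
        unfolding Z_def using finVV by (intro card_SigmaI finV) (auto intro!: finite_PiE)
      also have "\<dots> = (\<Sum>V\<in>{V. V \<subseteq> {..<n}-{x,y} \<and> card V = t}. card (cols (A w) M x) ^ t * card (cols (A w) M y) ^ t)"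
        using finVV by (intro sum.cong) (auto simp: card_cartesian_product card_PiE)
      finally have "card (F w) \<le> card {V. V \<subseteq> {..<n}-{x,y} \<and> card V = t} * (card (cols (A w) M x) ^ t * card (cols (A w) M y) ^ t)" by simp
      from of_nat_mono[OF this, where 'a = real]
      have "real (card (F w)) \<le> real (card {V. V \<subseteq> {..<n}-{x,y} \<and> card V = t}) * (real (card (cols (A w) M x)) ^ t * real (card (cols (A w) M y)) ^ t)"
        by simp
      also have "\<dots> \<le> (exp 1 * real n / real t) ^ t * (d ^ t * d ^ t)"
      proof (intro mult_mono power_mono)
        have "card ({..<n}-{x,y}) \<le> n" by (rule order_trans[OF card_mono[of "{..<n}"]]) auto
        then show "real (card {V. V \<subseteq> {..<n}-{x,y} \<and> card V = t}) \<le> (exp 1 * real n / real t) ^ t"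
          using n_subsets[of "{..<n}-{x,y}" t] binomial_exp_bound[OF _ t, of "card ({..<n}-{x,y})" "real n"] by simp
      qed (use that(2) d in \<open>auto simp: P_def\<close>)
      finally show "real (card (F w)) \<le> (exp 1 * real n / real t) ^ t * (d ^ t * d ^ t)" .
    qed
    show "0 \<le> (exp 1 * real n / real t) ^ t * (d ^ t * d ^ t)" using d by simp
    show "X \<subseteq> G \<and> card X = 2 * t" if "w \<in> \<Omega>" "P w" and XF: "X \<in> F w" for w X
    proof -
      obtain V f g where V: "V \<subseteq> {..<n}-{x,y}" "card V = t" "f \<in> V \<rightarrow>\<^sub>E cols (A w) M x" "g \<in> V \<rightarrow>\<^sub>E cols (A w) M y"
        "\<forall>v\<in>V. f v \<noteq> g v" "X = (\<lambda>v. (v, f v)) ` V \<union> (\<lambda>v. (v, g v)) ` V"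
        using XF unfolding F_def Z'_def Z_def T_def by auto
      have fg: "f v < M" "g v < M" if "v \<in> V" for v using V(3,4) that by (auto simp: cols_def PiE_iff)
      have "X \<subseteq> G" unfolding V(6) G_def using V(1) fg by auto
      moreover have "card X = card ((\<lambda>v. (v, f v)) ` V) + card ((\<lambda>v. (v, g v)) ` V)"
        unfolding V(6) using finVV[OF V(1)] V(5) by (intro card_Un_disjoint) auto
      moreover have "card ((\<lambda>v. (v, f v)) ` V) = t" "card ((\<lambda>v. (v, g v)) ` V) = t"
        using V(2) by (subst card_image; auto simp: inj_on_def)+
      ultimately show ?thesis by simp
    qed
  qed
  also have "((exp 1 * real n / real t) ^ t * (d ^ t * d ^ t)) * (real s / real (s * B)) ^ (2 * t)
     = (exp 1 * (real n * d ^ 2 / real B ^ 2) / real t) ^ t"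
    unfolding ratio(1) power_mult power_mult_distrib[symmetric] by (simp add: power2_eq_square mult_ac)
  finally have main: "real (card {w \<in> \<Omega>. P w \<and> (\<exists>T\<in>F w. \<forall>i\<in>T. w i < s)})
     \<le> (exp 1 * (real n * d ^ 2 / real B ^ 2) / real t) ^ t * real (card \<Omega>)" .
  have "{w \<in> \<Omega>. P w \<and> t \<le> card (common w x y)} \<subseteq> {w \<in> \<Omega>. P w \<and> (\<exists>T\<in>F w. \<forall>i\<in>T. w i < s)}"
  proof
    fix w assume "w \<in> {w \<in> \<Omega>. P w \<and> t \<le> card (common w x y)}"
    then have w: "w \<in> \<Omega>" "P w" "t \<le> card (common w x y)" by auto
    obtain V where V: "V \<subseteq> common w x y" "card V = t" using w(3) by (rule obtain_subset_with_card_n)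
    have "\<forall>v\<in>V. \<exists>k j. k < M \<and> j < M \<and> k \<noteq> j \<and> x \<in> A w k \<and> y \<in> A w j \<and> v \<in> A w k \<and> v \<in> A w j"
      using V(1) by blast
    then obtain f g where fg: "\<And>v. v \<in> V \<Longrightarrow> f v < M \<and> g v < M \<and> f v \<noteq> g v \<and> x \<in> A w (f v) \<and> y \<in> A w (g v) \<and> v \<in> A w (f v) \<and> v \<in> A w (g v)"
      by metis
    define f' where "f' = restrict f V"
    define g' where "g' = restrict g V"
    have "(V, f', g') \<in> Z' w" unfolding Z'_def Z_def f'_def g'_def cols_def using V fg by auto
    then have "T (V, f', g') \<in> F w" unfolding F_def by blast
    moreover have "w i < s" if "i \<in> T (V, f', g')" for i
      using that fg unfolding T_def f'_def g'_def active_def by auto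
    ultimately show "w \<in> {w \<in> \<Omega>. P w \<and> (\<exists>T\<in>F w. \<forall>i\<in>T. w i < s)}" using w by blast
  qed
  then have "card {w \<in> \<Omega>. P w \<and> t \<le> card (common w x y)} \<le> card {w \<in> \<Omega>. P w \<and> (\<exists>T\<in>F w. \<forall>i\<in>T. w i < s)}"
    by (intro card_mono) auto
  then show ?thesis using main unfolding P_def by linarith
qed

lemma large_codegrees:
  assumes "real n ^ 2 * (exp 1 * (real n * d ^ 2 / real B ^ 2) / real t) ^ t \<le> e" "1 \<le> t" "0 \<le> d"
  shows "real (card {w \<in> \<Omega>. (\<forall>v<n. real (card (cols (A w) M v)) \<le> d) \<and>
    (\<exists>x<n. \<exists>y<n. x \<noteq> y \<and> t \<le> card (common w x y))}) \<le> e * real (card \<Omega>)"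
proof -
  define X where "X = {xy \<in> {..<n}\<times>{..<n}. fst xy \<noteq> snd xy}"
  define R where "R xy w \<longleftrightarrow> (real (card (cols (A w) M (fst xy))) \<le> d \<and> real (card (cols (A w) M (snd xy))) \<le> d) \<and>
    t \<le> card (common w (fst xy) (snd xy))" for xy w
  define q where "q = (exp 1 * (real n * d ^ 2 / real B ^ 2) / real t) ^ t"
  have cX: "card X \<le> n * n" using card_mono[of "{..<n}\<times>{..<n}" X] by (auto simp: X_def card_cartesian_product)
  have q0: "0 \<le> q" unfolding q_def using assms(3) by simp
  have "{w \<in> \<Omega>. (\<forall>v<n. real (card (cols (A w) M v)) \<le> d) \<and>
    (\<exists>x<n. \<exists>y<n. x \<noteq> y \<and> t \<le> card (common w x y))} \<subseteq> {w \<in> \<Omega>. \<exists>xy\<in>X. R xy w}"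
    unfolding X_def R_def by force
  then have "real (card {w \<in> \<Omega>. (\<forall>v<n. real (card (cols (A w) M v)) \<le> d) \<and>
    (\<exists>x<n. \<exists>y<n. x \<noteq> y \<and> t \<le> card (common w x y))}) \<le> real (card {w \<in> \<Omega>. \<exists>xy\<in>X. R xy w})"
    by (intro of_nat_mono card_mono) auto
  also have "\<dots> \<le> (\<Sum>xy\<in>X. q) * real (card \<Omega>)"
    unfolding R_def q_def
    by (intro card_exists_le large_codegree_pair) (use assms in \<open>auto simp: X_def\<close>)
  also have "\<dots> \<le> e * real (card \<Omega>)"
  proof (rule mult_right_mono)
    have "real (card X) * q \<le> real n ^ 2 * q"
      using of_nat_mono[OF cX, where 'a = real] q0 by (intro mult_right_mono) (auto simp: power2_eq_square)
    then show "(\<Sum>xy\<in>X. q) \<le> e" using assms(1) unfolding q_def by simp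
  qed simp
  finally show ?thesis .
qed

lemma card_incidences:
  assumes "S \<subseteq> {..<n}" "J \<subseteq> {..<M}"
  shows "card {i \<in> S \<times> J. w i < s} = (\<Sum>j\<in>J. card (S \<inter> A w j))"
proof -
  have fin: "finite S" "finite J" using assms by (auto intro: finite_below)
  have "card {i \<in> S \<times> J. w i < s} = card (SIGMA j:J. S \<inter> A w j)"
    by (rule bij_betw_same_card[of prod.swap])
      (use assms in \<open>auto simp: bij_betw_def inj_on_def active_def image_iff\<close>)
  also have "\<dots> = (\<Sum>j\<in>J. card (S \<inter> A w j))" using fin by (intro card_SigmaI) auto
  finally show ?thesis .
qed

lemma incidences_le: "S \<subseteq> {..<n} \<Longrightarrow> J \<subseteq> {..<M} \<Longrightarrow> (\<Sum>j\<in>J. card (S \<inter> A w j)) \<le> n * M"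
proof -
  assume "S \<subseteq> {..<n}" "J \<subseteq> {..<M}"
  then have "card {i \<in> S \<times> J. w i < s} \<le> card Idx" by (intro card_mono) auto
  then show ?thesis using card_incidences[OF \<open>S \<subseteq> {..<n}\<close> \<open>J \<subseteq> {..<M}\<close>] by (simp add: card_cartesian_product)
qed

text \<open>The origin of the summand 5 in both entropy conditions: at most
  \<open>n * M \<le> n ^ 2\<close> values of \<open>t\<close> are possible, and the remaining cubic
  saving must still absorb a factor \<open>n\<close> in \<open>dense_column_blocks\<close>.\<close>

lemma sum_fifth_powers: "(\<Sum>t=1..n * M. (1 / real n) ^ 5) \<le> 1 / real n ^ 3"
proof -
  have "real n * real M \<le> real n * real n" using pos(4) by (intro mult_left_mono) auto
  then have "real n * real M * (1 / real n) ^ 5 \<le> (real n * real n) * (1 / real n) ^ 5"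
    by (intro mult_right_mono) auto
  also have "\<dots> = 1 / real n ^ 3" using pos(3) by (simp add: field_simps power_numeral_reduce)
  finally show ?thesis by simp
qed

text \<open>Union bound over \<open>S\<close>, \<open>J\<close> and the number \<open>t\<close> of
  incidences, with a weight of \<open>1 / n\<close> for every element of \<open>S\<close> and
  \<open>J\<close> and five more for \<open>t\<close>. Only the triples for which \<open>t\<close>
  violates the condition matter, and for them the tail is smaller than the weight.\<close>

lemma dense_blocks:
  "real (card {w \<in> \<Omega>. \<exists>S J. S \<subseteq> {..<n} \<and> J \<subseteq> {..<M} \<and> S \<noteq> {} \<and> J \<noteq> {} \<and> 0 < (\<Sum>j\<in>J. card (S \<inter> A w j)) \<and>
     (real (card S) + real (card J) + 5) * ln (real n) <
       real (\<Sum>j\<in>J. card (S \<inter> A w j)) *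
         (ln (real (\<Sum>j\<in>J. card (S \<inter> A w j)) * real B / (real (card S) * real (card J))) - 1)})
    \<le> (exp 1 ^ 2 / real n ^ 3) * real (card \<Omega>)"
    (is "real (card {w \<in> \<Omega>. ?bad w}) \<le> _")
proof -
  define D where "D S J t \<longleftrightarrow> (real (card S) + real (card J) + 5) * ln (real n) <
       real t * (ln (real t * real B / (real (card S) * real (card J))) - 1)" for S J :: "nat set" and t :: nat
  define X where "X = (Pow {..<n} - {{}}) \<times> (Pow {..<M} - {{}}) \<times> {1..n * M}"
  define R where "R = (\<lambda>(S, J, t) w. D S J t \<and> t \<le> (\<Sum>j\<in>J. card (S \<inter> A w j)))"
  define f where "f = (\<lambda>(S :: nat set, J :: nat set, t :: nat). (1 / real n) ^ card S * (1 / real n) ^ card J * (1 / real n) ^ 5 :: real)"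
  have "{w \<in> \<Omega>. ?bad w} \<subseteq> {w \<in> \<Omega>. \<exists>x\<in>X. R x w}"
  proof
    fix w assume "w \<in> {w \<in> \<Omega>. ?bad w}"
    then obtain S J where SJ: "w \<in> \<Omega>" "S \<subseteq> {..<n}" "J \<subseteq> {..<M}" "S \<noteq> {}" "J \<noteq> {}"
      "0 < (\<Sum>j\<in>J. card (S \<inter> A w j))" "D S J (\<Sum>j\<in>J. card (S \<inter> A w j))"
      unfolding D_def by auto
    then have "(S, J, \<Sum>j\<in>J. card (S \<inter> A w j)) \<in> X" "R (S, J, \<Sum>j\<in>J. card (S \<inter> A w j)) w"
      using incidences_le[OF SJ(2,3), of w] by (auto simp: X_def R_def)
    then show "w \<in> {w \<in> \<Omega>. \<exists>x\<in>X. R x w}" using SJ(1) by blast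
  qed
  then have "real (card {w \<in> \<Omega>. ?bad w}) \<le> real (card {w \<in> \<Omega>. \<exists>x\<in>X. R x w})"
    by (intro of_nat_mono card_mono) auto
  also have "\<dots> \<le> (\<Sum>x\<in>X. f x) * real (card \<Omega>)"
  proof (rule card_exists_le)
    show "finite X" by (auto simp: X_def)
    fix x assume xX: "x \<in> X"
    obtain S J t where x: "x = (S, J, t)" by (cases x)
    have S: "S \<subseteq> {..<n}" "S \<noteq> {}" and J: "J \<subseteq> {..<M}" "J \<noteq> {}" and t: "1 \<le> t"
      using xX by (auto simp: X_def x)
    have fin: "finite S" "finite J" using S J by (auto intro: finite_below)
    have c: "0 < card S" "0 < card J" using S J fin by (auto simp: card_gt_0_iff)
    show "real (card {w \<in> \<Omega>. R x w}) \<le> f x * real (card \<Omega>)"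
    proof (cases "D S J t")
      case False
      then show ?thesis by (simp add: x R_def f_def)
    next
      case True
      have prob: "real (card {w \<in> \<Omega>. True \<and> t \<le> card {i \<in> S \<times> J. w i < s}})
        \<le> (exp 1 * (real (card S * card J) / real B) / real t) ^ t * real (card \<Omega>)"
        by (rule edges_bound[OF order_refl local_const local_const]) (use S J t in \<open>auto simp: card_cartesian_product\<close>)
      have "(exp 1 * (real (card S * card J) / real B) / real t) ^ t
          = exp (- (real t * (ln (real t * real B / (real (card S) * real (card J))) - 1)))"
        using power_eq_exp_deficit[of "real (card S * card J) / real B" t] c pos t by simp
      also have "\<dots> \<le> exp (- (real (card S + card J + 5) * ln (real n)))"
        using True unfolding D_def by simp
      also have "\<dots> = f x" using pos by (simp only: ln_power_inverse x f_def power_add) simp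
      finally have "(exp 1 * (real (card S * card J) / real B) / real t) ^ t * real (card \<Omega>) \<le> f x * real (card \<Omega>)"
        by (rule mult_right_mono) simp
      with prob have "real (card {w \<in> \<Omega>. True \<and> t \<le> card {i \<in> S \<times> J. w i < s}}) \<le> f x * real (card \<Omega>)"
        by (rule order_trans)
      then show ?thesis by (simp add: x R_def True card_incidences[OF S(1) J(1)])
    qed
  qed auto
  also have "(\<Sum>x\<in>X. f x) = (\<Sum>S\<in>Pow {..<n} - {{}}. (1 / real n) ^ card S) *
      ((\<Sum>J\<in>Pow {..<M} - {{}}. (1 / real n) ^ card J) * (\<Sum>t=1..n * M. (1 / real n) ^ 5))"
    unfolding X_def f_def by (rule sum_triple_product)
  also have "\<dots> \<le> exp 1 * (exp 1 * (1 / real n ^ 3))"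
  proof (intro mult_mono)
    have sub: "(\<Sum>S\<in>Pow {..<N} - {{}}. (1 / real n) ^ card S) \<le> exp 1" if "N \<le> n" for N
    proof -
      have "(\<Sum>S\<in>Pow {..<N} - {{}}. (1 / real n) ^ card S) \<le> (\<Sum>S\<in>Pow {..<N}. (1 / real n) ^ card S)"
        by (intro sum_mono2) auto
      also have "\<dots> \<le> exp 1" using that pos by (intro sum_Pow_inverse_le) auto
      finally show ?thesis .
    qed
    show "(\<Sum>S\<in>Pow {..<n} - {{}}. (1 / real n) ^ card S) \<le> exp 1"
      "(\<Sum>J\<in>Pow {..<M} - {{}}. (1 / real n) ^ card J) \<le> exp 1"
      using sub pos by auto
    show "(\<Sum>t=1..n * M. (1 / real n) ^ 5) \<le> 1 / real n ^ 3" by (rule sum_fifth_powers)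
  qed (auto intro!: mult_nonneg_nonneg sum_nonneg)
  finally show ?thesis by (simp add: mult_right_mono power2_eq_square)
qed

text \<open>The columns outside \<open>K\<close>, among them those of \<open>J\<close>, are exposed
  first; given them, their union is a fixed set of at most \<open>card J * al\<close> vertices, and
  the columns of \<open>K\<close> are still independent. Thus the union is charged only for the
  choice of \<open>J\<close>.\<close>

lemma dense_column_blocks:
  assumes al: "0 < al"
  shows "real (card {w \<in> \<Omega>. (\<forall>j<M. real (card (A w j)) \<le> al) \<and>
     (\<exists>J K. J \<subseteq> {..<M} \<and> K \<subseteq> {..<M} \<and> J \<inter> K = {} \<and> J \<noteq> {} \<and> K \<noteq> {} \<and> 0 < (\<Sum>k\<in>K. card (A w k \<inter> (\<Union>j\<in>J. A w j))) \<and>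
     (real (card J) + 5) * ln (real n) + real (card K) * (1 + ln (real M / real (card K))) <
       real (\<Sum>k\<in>K. card (A w k \<inter> (\<Union>j\<in>J. A w j))) *
         (ln (real (\<Sum>k\<in>K. card (A w k \<inter> (\<Union>j\<in>J. A w j))) * real B / (real (card J) * al * real (card K))) - 1))})
    \<le> (exp 1 / real n ^ 2) * real (card \<Omega>)"
    (is "real (card {w \<in> \<Omega>. ?fine w \<and> ?bad w}) \<le> _")
proof -
  \<comment> \<open>For \<open>k > 0\<close> this is \<open>(k / (exp 1 * M)) ^ k\<close>, the
    reciprocal of the bound on \<open>M choose k\<close>. All \<open>k\<close>-sets together then
    weigh at most 1, and the sum over all sizes is at most \<open>M \<le> n\<close>.\<close>
  define H where "H k = (if k = 0 then 0 else exp (- (real k * (1 + ln (real M / real k)))))" for k :: nat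
  have H0: "0 \<le> H k" for k by (simp add: H_def)
  define D where "D J K t \<longleftrightarrow> (real (card J) + 5) * ln (real n) + real (card K) * (1 + ln (real M / real (card K))) <
       real t * (ln (real t * real B / (real (card J) * al * real (card K))) - 1)" for J K :: "nat set" and t :: nat
  define X where "X = (Pow {..<M} - {{}}) \<times> (Pow {..<M} - {{}}) \<times> {1..n * M}"
  define R where "R = (\<lambda>(J, K, t) w. D J K t \<and> J \<inter> K = {} \<and> ?fine w \<and> t \<le> (\<Sum>k\<in>K. card (A w k \<inter> (\<Union>j\<in>J. A w j))))"
  define f where "f = (\<lambda>(J :: nat set, K :: nat set, t :: nat). (1 / real n) ^ card J * H (card K) * (1 / real n) ^ 5 :: real)"
  have U: "(\<Union>j\<in>J. A w j) \<subseteq> {..<n}" for J w by (auto simp: active_def)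
  have "{w \<in> \<Omega>. ?fine w \<and> ?bad w} \<subseteq> {w \<in> \<Omega>. \<exists>x\<in>X. R x w}"
  proof
    fix w assume "w \<in> {w \<in> \<Omega>. ?fine w \<and> ?bad w}"
    then obtain J K where JK: "w \<in> \<Omega>" "?fine w" "J \<subseteq> {..<M}" "K \<subseteq> {..<M}" "J \<inter> K = {}" "J \<noteq> {}" "K \<noteq> {}"
      "0 < (\<Sum>k\<in>K. card (A w k \<inter> (\<Union>j\<in>J. A w j)))" "D J K (\<Sum>k\<in>K. card (A w k \<inter> (\<Union>j\<in>J. A w j)))"
      unfolding D_def by auto
    have "(\<Sum>k\<in>K. card (A w k \<inter> (\<Union>j\<in>J. A w j))) \<le> n * M"
      using incidences_le[OF U JK(4)] by (simp only: Int_commute)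
    then have "(J, K, \<Sum>k\<in>K. card (A w k \<inter> (\<Union>j\<in>J. A w j))) \<in> X" "R (J, K, \<Sum>k\<in>K. card (A w k \<inter> (\<Union>j\<in>J. A w j))) w"
      using JK by (auto simp: X_def R_def)
    then show "w \<in> {w \<in> \<Omega>. \<exists>x\<in>X. R x w}" using JK(1) by blast
  qed
  then have "real (card {w \<in> \<Omega>. ?fine w \<and> ?bad w}) \<le> real (card {w \<in> \<Omega>. \<exists>x\<in>X. R x w})"
    by (intro of_nat_mono card_mono) auto
  also have "\<dots> \<le> (\<Sum>x\<in>X. f x) * real (card \<Omega>)"
  proof (rule card_exists_le)
    show "finite X" by (auto simp: X_def)
    fix x assume xX: "x \<in> X"
    obtain J K t where x: "x = (J, K, t)" by (cases x)
    have J: "J \<subseteq> {..<M}" "J \<noteq> {}" and K: "K \<subseteq> {..<M}" "K \<noteq> {}" and t: "1 \<le> t"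
      using xX by (auto simp: X_def x)
    have fin: "finite J" "finite K" using J K by (auto intro: finite_below)
    have c: "0 < card J" "0 < card K" using J K fin by (auto simp: card_gt_0_iff)
    show "real (card {w \<in> \<Omega>. R x w}) \<le> f x * real (card \<Omega>)"
    proof (cases "D J K t \<and> J \<inter> K = {}")
      case False
      have "R x w \<longleftrightarrow> False" for w using False by (auto simp: x R_def)
      moreover have "0 \<le> f x" by (simp add: x f_def H_def)
      ultimately show ?thesis by simp
    next
      case True
      define G where "G = {..<n} \<times> K"
      define P where "P w \<longleftrightarrow> (\<forall>j\<in>J. real (card (A w j)) \<le> al)" for w
      define E where "E w = (\<Union>j\<in>J. A w j) \<times> K" for w
      have loc: "A w j = A w' j" if "\<And>i. i \<in> Idx \<Longrightarrow> i \<notin> G \<Longrightarrow> w i = w' i" "j \<in> J" for w w' j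
        using that J True by (intro active_local[OF that(1)]) (auto simp: G_def)
      have b: "E w \<subseteq> G \<and> real (card (E w)) \<le> real (card J) * al * real (card K)" if "P w" for w
      proof
        show "E w \<subseteq> G" using U unfolding E_def G_def by auto
        have "card (\<Union>j\<in>J. A w j) \<le> (\<Sum>j\<in>J. card (A w j))" by (rule card_UN_le[OF fin(1)])
        then have "real (card (\<Union>j\<in>J. A w j)) \<le> real (\<Sum>j\<in>J. card (A w j))" by (rule of_nat_mono)
        also have "\<dots> \<le> (\<Sum>j\<in>J. al)" unfolding of_nat_sum using that by (intro sum_mono) (auto simp: P_def)
        finally have "real (card (\<Union>j\<in>J. A w j)) * real (card K) \<le> (real (card J) * al) * real (card K)"
          by (intro mult_right_mono) auto
        then show "real (card (E w)) \<le> real (card J) * al * real (card K)" by (simp add: E_def card_cartesian_product)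
      qed
      have prob: "real (card {w \<in> \<Omega>. P w \<and> t \<le> card {i \<in> E w. w i < s}})
        \<le> (exp 1 * (real (card J) * al * real (card K) / real B) / real t) ^ t * real (card \<Omega>)"
      proof (rule edges_bound)
        show "G \<subseteq> Idx" using K by (auto simp: G_def)
        show "local_off Idx (s * B) G P"
        proof (rule local_offI)
          fix w w' :: "nat \<times> nat \<Rightarrow> nat" assume "\<And>e. e \<in> Idx \<Longrightarrow> e \<notin> G \<Longrightarrow> w e = w' e"
          from loc[OF this] show "P w = P w'" by (simp add: P_def)
        qed
        show "local_off Idx (s * B) G E"
        proof (rule local_offI)
          fix w w' :: "nat \<times> nat \<Rightarrow> nat" assume "\<And>e. e \<in> Idx \<Longrightarrow> e \<notin> G \<Longrightarrow> w e = w' e"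
          from loc[OF this] show "E w = E w'" by (simp add: E_def)
        qed
      qed (use b t al in auto)
      have "(exp 1 * (real (card J) * al * real (card K) / real B) / real t) ^ t
          = exp (- (real t * (ln (real t * real B / (real (card J) * al * real (card K))) - 1)))"
        using power_eq_exp_deficit[of "real (card J) * al * real (card K) / real B" t] c pos t al by simp
      also have "\<dots> \<le> exp (- (real (card J + 5) * ln (real n)) + - (real (card K) * (1 + ln (real M / real (card K)))))"
        using True unfolding D_def by simp
      also have "\<dots> = f x" using c pos by (simp only: exp_add ln_power_inverse x f_def power_add H_def) simp
      finally have "(exp 1 * (real (card J) * al * real (card K) / real B) / real t) ^ t * real (card \<Omega>) \<le> f x * real (card \<Omega>)"
        by (rule mult_right_mono) simp
      with prob have "real (card {w \<in> \<Omega>. P w \<and> t \<le> card {i \<in> E w. w i < s}}) \<le> f x * real (card \<Omega>)"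
        by (rule order_trans)
      moreover have "card {w \<in> \<Omega>. R x w} \<le> card {w \<in> \<Omega>. P w \<and> t \<le> card {i \<in> E w. w i < s}}"
      proof (rule card_mono)
        show "{w \<in> \<Omega>. R x w} \<subseteq> {w \<in> \<Omega>. P w \<and> t \<le> card {i \<in> E w. w i < s}}"
          using J K card_incidences[OF U K(1)] unfolding x R_def P_def E_def by (auto simp: Int_commute)
      qed auto
      ultimately show ?thesis by linarith
    qed
  qed auto
  also have "(\<Sum>x\<in>X. f x) = (\<Sum>J\<in>Pow {..<M} - {{}}. (1 / real n) ^ card J) *
      ((\<Sum>K\<in>Pow {..<M} - {{}}. H (card K)) * (\<Sum>t=1..n * M. (1 / real n) ^ 5))"
    unfolding X_def f_def by (rule sum_triple_product)
  also have "\<dots> \<le> exp 1 * (real n * (1 / real n ^ 3))"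
  proof (intro mult_mono)
    have "(\<Sum>S\<in>Pow {..<M} - {{}}. (1 / real n) ^ card S) \<le> (\<Sum>S\<in>Pow {..<M}. (1 / real n) ^ card S)"
      by (intro sum_mono2) auto
    also have "\<dots> \<le> exp 1" using pos by (intro sum_Pow_inverse_le) auto
    finally show "(\<Sum>J\<in>Pow {..<M} - {{}}. (1 / real n) ^ card J) \<le> exp 1" .
    have "(\<Sum>K\<in>Pow {..<M} - {{}}. H (card K)) = (\<Sum>k=1..M. real (M choose k) * H k)"
      using sum_Pow_card[of "{..<M}" H] by simp
    also have "\<dots> \<le> (\<Sum>k=1..M. 1)"
    proof (rule sum_mono)
      fix k assume k: "k \<in> {1..M}"
      then have k1: "1 \<le> k" "0 < M" by auto
      have "real (M choose k) \<le> (exp 1 * real M / real k) ^ k" by (rule binomial_exp_bound[OF _ k1(1)]) simp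
      also have "\<dots> = exp (- (real k * (ln (real k / real M) - 1)))"
        using power_eq_exp_deficit[of "real M" k] k1 by simp
      also have "ln (real k / real M) = - ln (real M / real k)" using k1 by (simp add: ln_div)
      also have "exp (- (real k * (- ln (real M / real k) - 1))) * H k = 1"
        using k1 by (simp add: H_def exp_add[symmetric] algebra_simps)
      finally show "real (M choose k) * H k \<le> 1"
        by (smt (verit) H_def exp_gt_zero mult_right_mono)
    qed
    also have "\<dots> \<le> real n" using pos by simp
    finally show "(\<Sum>K\<in>Pow {..<M} - {{}}. H (card K)) \<le> real n" .
    show "(\<Sum>t=1..n * M. (1 / real n) ^ 5) \<le> 1 / real n ^ 3" by (rule sum_fifth_powers)
  qed (auto intro!: mult_nonneg_nonneg sum_nonneg H0)
  also have "exp 1 * (real n * (1 / real n ^ 3)) = exp 1 / real n ^ 2"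
    using pos(3) by (simp add: field_simps power_numeral_reduce)
  finally show ?thesis by (simp add: mult_right_mono)
qed

lemma exists_avoiding:
  assumes "\<And>k. k < (N::nat) \<Longrightarrow> real (card {w \<in> \<Omega>. R k w}) \<le> real (card \<Omega>) / 8" "N < 8"
  shows "\<exists>w\<in>\<Omega>. \<forall>k<N. \<not> R k w"
proof (rule ccontr)
  assume "\<not> ?thesis"
  then have e: "\<Omega> = {w \<in> \<Omega>. \<exists>k\<in>{..<N}. R k w}" by blast
  have "real (card {w \<in> \<Omega>. \<exists>k\<in>{..<N}. R k w}) \<le> (\<Sum>k\<in>{..<N}. 1 / 8) * real (card \<Omega>)"
    using assms(1) by (intro card_exists_le) auto
  then have le: "real (card \<Omega>) \<le> real N / 8 * real (card \<Omega>)" using e by simp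
  have "0 < card \<Omega>" using pos by (simp add: card_words)
  then have "1 \<le> real N / 8" using le by simp
  then show False using assms(2) by simp
qed

text \<open>Six bad events, each of probability at most \<open>1/8\<close>. The third and fifth
  presuppose the bounds that the second and first secure. The sixth speaks only of sets that are
  healthy throughout without success, as only those are covered by the product estimate; hence the
  implication in the conclusion.\<close>

lemma exists_typical:
  fixes m :: nat and C sn l al d ka :: real
  assumes par: "1 \<le> C" "0 < sn" "1 < l" "al = 6 * sn / l" "d = 20 * C * l" "0 \<le> ka"
      "sn * l \<le> real B" "4 * m \<le> B" "sn * l \<le> 5 * real m" "real M \<le> 4 * C * sn * l^2"
      "1 + ln (real M) \<le> l" "0 < M" "5 \<le> m" and l: "l = ln (real n)"
    and t1: "real t1 \<le> al + 1" "1 \<le> t1" "real M * (exp 1 * (real n / real B) / real t1) ^ t1 \<le> 1 / 8"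
    and t2: "real t2 \<le> d + 1" "1 \<le> t2" "real n * (exp 1 * (real M / real B) / real t2) ^ t2 \<le> 1 / 8"
    and t3: "real t3 \<le> ka + 1" "1 \<le> t3" "real n ^ 2 * (exp 1 * (real n * d ^ 2 / real B ^ 2) / real t3) ^ t3 \<le> 1 / 8"
    and large: "exp 1 ^ 2 / real n ^ 3 \<le> 1 / 8" "exp 1 / real n ^ 2 \<le> 1 / 8"
    and sets: "real (n choose m) * (1 - (real m / real (s * B)) ^ s / 4) ^ M \<le> 1 / 8"
  shows "\<exists>w\<in>\<Omega>. typical n M B m (A w) C sn l al d ka \<and>
    (\<forall>S\<subseteq>{..<n}. card S = m \<longrightarrow> (\<exists>i<M. healthy n B s S i w \<longrightarrow> makes_clique n s S i w))"
proof -
  have al0: "0 < al" and d0: "0 \<le> d" using par by auto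
  define R1 where "R1 w \<longleftrightarrow> (\<exists>j\<in>{..<M}. t1 \<le> card (A w j))" for w
  define R2 where "R2 w \<longleftrightarrow> (\<exists>v\<in>{..<n}. t2 \<le> card (cols (A w) M v))" for w
  define R3 where "R3 w \<longleftrightarrow> (\<forall>v<n. real (card (cols (A w) M v)) \<le> d) \<and>
    (\<exists>x<n. \<exists>y<n. x \<noteq> y \<and> t3 \<le> card (common w x y))" for w
  define R4 where "R4 w \<longleftrightarrow> (\<exists>S J. S \<subseteq> {..<n} \<and> J \<subseteq> {..<M} \<and> S \<noteq> {} \<and> J \<noteq> {} \<and> 0 < (\<Sum>j\<in>J. card (S \<inter> A w j)) \<and>
     (real (card S) + real (card J) + 5) * ln (real n) <
       real (\<Sum>j\<in>J. card (S \<inter> A w j)) *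
         (ln (real (\<Sum>j\<in>J. card (S \<inter> A w j)) * real B / (real (card S) * real (card J))) - 1))" for w
  define R5 where "R5 w \<longleftrightarrow> (\<forall>j<M. real (card (A w j)) \<le> al) \<and>
     (\<exists>J K. J \<subseteq> {..<M} \<and> K \<subseteq> {..<M} \<and> J \<inter> K = {} \<and> J \<noteq> {} \<and> K \<noteq> {} \<and> 0 < (\<Sum>k\<in>K. card (A w k \<inter> (\<Union>j\<in>J. A w j))) \<and>
     (real (card J) + 5) * ln (real n) + real (card K) * (1 + ln (real M / real (card K))) <
       real (\<Sum>k\<in>K. card (A w k \<inter> (\<Union>j\<in>J. A w j))) *
         (ln (real (\<Sum>k\<in>K. card (A w k \<inter> (\<Union>j\<in>J. A w j))) * real B / (real (card J) * al * real (card K))) - 1))" for w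
  define R6 where "R6 w \<longleftrightarrow> (\<exists>S\<in>{S. S \<subseteq> {..<n} \<and> card S = m}. \<forall>i<M. healthy n B s S i w \<and> \<not> makes_clique n s S i w)" for w
  define R where "R k = [R1, R2, R3, R4, R5, R6] ! k" for k
  have e8: "x \<le> e * real (card \<Omega>) \<Longrightarrow> e \<le> 1 / 8 \<Longrightarrow> x \<le> real (card \<Omega>) / 8" for x e :: real
    using mult_right_mono[of e "1/8" "real (card \<Omega>)"] by simp
  have r: "real (card {w \<in> \<Omega>. R1 w}) \<le> real (card \<Omega>) / 8" "real (card {w \<in> \<Omega>. R2 w}) \<le> real (card \<Omega>) / 8"
    "real (card {w \<in> \<Omega>. R3 w}) \<le> real (card \<Omega>) / 8" "real (card {w \<in> \<Omega>. R4 w}) \<le> real (card \<Omega>) / 8"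
    "real (card {w \<in> \<Omega>. R5 w}) \<le> real (card \<Omega>) / 8"
    unfolding R1_def R2_def R3_def R4_def R5_def
    using e8[OF large_columns[OF t1(3,2)]] e8[OF many_columns[OF t2(3,2)]] e8[OF large_codegrees[OF t3(3,2) d0]]
      e8[OF dense_blocks large(1)] e8[OF dense_column_blocks[OF al0] large(2)] by simp_all
  have "real (card {w \<in> \<Omega>. R6 w})
      \<le> (\<Sum>S\<in>{S. S \<subseteq> {..<n} \<and> card S = m}. (1 - (real m / real (s * B)) ^ s / 4) ^ M) * real (card \<Omega>)"
    unfolding R6_def
  proof (rule card_exists_le)
    fix S assume "S \<in> {S. S \<subseteq> {..<n} \<and> card S = m}"
    then have S: "S \<subseteq> {..<n}" "card S = m" by auto
    then have "4 * card S \<le> B" using par(8) by simp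
    from never_clique_bound[OF S(1) this pos(1,2), of M]
    show "real (card {w \<in> \<Omega>. \<forall>i<M. healthy n B s S i w \<and> \<not> makes_clique n s S i w})
       \<le> (1 - (real m / real (s * B)) ^ s / 4) ^ M * real (card \<Omega>)" by (simp add: S(2))
  qed auto
  also have "(\<Sum>S\<in>{S. S \<subseteq> {..<n} \<and> card S = m}. (1 - (real m / real (s * B)) ^ s / 4) ^ M)
      = real (n choose m) * (1 - (real m / real (s * B)) ^ s / 4) ^ M"
    using n_subsets[of "{..<n}" m] by simp
  finally have r6: "real (card {w \<in> \<Omega>. R6 w}) \<le> real (card \<Omega>) / 8" using sets by (rule e8)
  have "\<exists>w\<in>\<Omega>. \<forall>k<6. \<not> R k w"
  proof (rule exists_avoiding)
    fix k :: nat assume "k < 6"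
    then have "k \<in> {0, 1, 2, 3, 4, 5}" by auto
    then show "real (card {w \<in> \<Omega>. R k w}) \<le> real (card \<Omega>) / 8"
      using r r6 by (auto simp: R_def)
  qed simp
  then obtain w where w: "w \<in> \<Omega>" "\<And>k. k < 6 \<Longrightarrow> \<not> R k w" by blast
  have nR: "\<not> R1 w" "\<not> R2 w" "\<not> R3 w" "\<not> R4 w" "\<not> R5 w" "\<not> R6 w"
    using w(2)[of 0] w(2)[of 1] w(2)[of 2] w(2)[of 3] w(2)[of 4] w(2)[of 5] by (auto simp: R_def)
  have T1: "real (card (A w j)) \<le> al" if "j < M" for j
  proof -
    have "card (A w j) < t1" using nR(1) that unfolding R1_def by (auto simp: not_le)
    then show ?thesis using t1(1) by linarith
  qed
  have T2: "real (card (cols (A w) M v)) \<le> d" if "v < n" for v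
  proof -
    have "card (cols (A w) M v) < t2" using nR(2) that unfolding R2_def by (auto simp: not_le)
    then show ?thesis using t2(1) by linarith
  qed
  have T3: "real (card (common w x y)) \<le> ka" if "x < n" "y < n" "x \<noteq> y" for x y
  proof -
    have "\<not> t3 \<le> card (common w x y)" using nR(3) T2 that unfolding R3_def by blast
    then show ?thesis using t3(1) by linarith
  qed
  have "typical n M B m (A w) C sn l al d ka"
  proof
    show "A w j \<subseteq> {..<n}" for j by (rule active_sub)
  next
    fix S :: "nat set" and J t assume h: "S \<subseteq> {..<n}" "J \<subseteq> {..<M}" "S \<noteq> {}" "J \<noteq> {}" "t = (\<Sum>j\<in>J. card (S \<inter> A w j))" "0 < t"
    show "real t * (ln (real t * real B / (real (card S) * real (card J))) - 1) \<le> (real (card S) + real (card J) + 5) * l"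
    proof (rule ccontr)
      assume "\<not> ?thesis"
      then have "R4 w" unfolding R4_def using h
        by (intro exI[of _ S] exI[of _ J]) (simp add: not_le l)
      then show False using nR(4) by simp
    qed
  next
    fix J K t assume h: "J \<subseteq> {..<M}" "K \<subseteq> {..<M}" "J \<inter> K = {}" "J \<noteq> {}" "K \<noteq> {}"
      "t = (\<Sum>k\<in>K. card (A w k \<inter> (\<Union>j\<in>J. A w j)))" "0 < t"
    show "real t * (ln (real t * real B / (real (card J) * al * real (card K))) - 1)
        \<le> (real (card J) + 5) * l + real (card K) * (1 + ln (real M / real (card K)))"
    proof (rule ccontr)
      assume "\<not> ?thesis"
      then have "\<exists>J K. J \<subseteq> {..<M} \<and> K \<subseteq> {..<M} \<and> J \<inter> K = {} \<and> J \<noteq> {} \<and> K \<noteq> {} \<and> 0 < (\<Sum>k\<in>K. card (A w k \<inter> (\<Union>j\<in>J. A w j))) \<and>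
       (real (card J) + 5) * ln (real n) + real (card K) * (1 + ln (real M / real (card K))) <
         real (\<Sum>k\<in>K. card (A w k \<inter> (\<Union>j\<in>J. A w j))) *
           (ln (real (\<Sum>k\<in>K. card (A w k \<inter> (\<Union>j\<in>J. A w j))) * real B / (real (card J) * al * real (card K))) - 1)"
        using h by (intro exI[of _ J] exI[of _ K]) (simp add: not_le l)
      then have "R5 w" unfolding R5_def using T1 by blast
      then show False using nR(5) by simp
    qed
  qed (use T1 T2 T3 par in auto)
  moreover have "\<exists>i<M. healthy n B s S i w \<longrightarrow> makes_clique n s S i w" if "S \<subseteq> {..<n}" "card S = m" for S
    using nR(6) that unfolding R6_def by auto
  ultimately show ?thesis using w(1) by blast
qed

end

section \<open>From a labelling to a bound on the function\<close>

lemma graph_from_labelling: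
  assumes s: "3 \<le> s"
    and cl: "\<And>S. S \<subseteq> {..<n} \<Longrightarrow> card S = m \<Longrightarrow> \<exists>i<M. makes_clique n s S i w"
  shows "\<exists>E. simple_graph n E \<and> Kfree E {0..<n} (s + 1) \<and> (\<forall>S\<subseteq>{0..<n}. card S = m \<longrightarrow> \<not> Kfree E S s)"
proof -
  define E where "E = edge (active n s w) (\<lambda>i x. w (x, i)) M"
  have "simple_graph n E" unfolding simple_graph_def E_def
    by (intro conjI allI impI edge_sym edge_irrefl)
  moreover have "Kfree E {0..<n} (s + 1)" unfolding Kfree_def
  proof
    assume "\<exists>K\<subseteq>{0..<n}. card K = s + 1 \<and> is_clique E K"
    then obtain K where K: "card K = s + 1" "is_clique E K" by blast
    show False
      by (rule edge_clique_free[OF s _ K(1), of M "active n s w" "\<lambda>i x. w (x, i)"])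
        (use K(2) in \<open>auto simp: is_clique_def E_def active_def\<close>)
  qed
  moreover have "\<not> Kfree E S s" if S: "S \<subseteq> {0..<n}" "card S = m" for S
  proof -
    have "S \<subseteq> {..<n}" using S by auto
    then obtain i u where iu: "i < M" "\<forall>a<s. u a \<in> S" "inj_on u {..<s}"
      "\<forall>a<s. \<forall>b<s. a \<noteq> b \<longrightarrow> edge_at (active n s w) (\<lambda>i x. w (x, i)) i (u a) (u b)"
      using cl[OF _ S(2)] unfolding makes_clique_def by blast
    have "u ` {..<s} \<subseteq> S" using iu by auto
    moreover have "card (u ` {..<s}) = s" using card_image[OF iu(3)] by simp
    moreover have "is_clique E (u ` {..<s})"
      unfolding is_clique_def E_def edge_def using iu by fastforce
    ultimately show ?thesis unfolding Kfree_def by blast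
  qed
  ultimately show ?thesis by blast
qed

text \<open>Subsets of a K_s-free set are K_s-free, so an attainable size above \<open>m\<close>
  would yield such a set of size exactly \<open>m\<close>. The size 0 is always attainable, so the
  maximum is taken over a nonempty finite set.\<close>

lemma erdos_rogers_le:
  assumes s: "1 \<le> s" and E: "simple_graph n E" "Kfree E {0..<n} (s + 1)"
    and big: "\<And>S. S \<subseteq> {0..<n} \<Longrightarrow> card S = m \<Longrightarrow> \<not> Kfree E S s"
  shows "erdos_rogers s n \<le> m"
proof -
  define X where "X = {m. \<forall>E. simple_graph n E \<and> Kfree E {0..<n} (s + 1) \<longrightarrow>
       (\<exists>S\<subseteq>{0..<n}. card S = m \<and> Kfree E S s)}"
  have "k \<le> m" if k: "k \<in> X" for k
  proof (rule ccontr)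
    assume "\<not> k \<le> m"
    obtain S where S: "S \<subseteq> {0..<n}" "card S = k" "Kfree E S s" using k E unfolding X_def by blast
    then have "m \<le> card S" using \<open>\<not> k \<le> m\<close> by simp
    then obtain T where T: "T \<subseteq> S" "card T = m" by (rule obtain_subset_with_card_n)
    have "Kfree E T s" using S(3) T(1) unfolding Kfree_def by blast
    then show False using big[of T] T S(1) by blast
  qed
  moreover have "0 \<in> X"
  proof -
    have "Kfree E' {} s" for E' using s unfolding Kfree_def by auto
    then show ?thesis unfolding X_def by (auto intro!: exI[of _ "{}"])
  qed
  ultimately have "Max X \<le> m" by (subst Max_le_iff) (auto intro: finite_subset[of X "{..m}"])
  then show ?thesis unfolding erdos_rogers_def X_def .
qed

section \<open>Choice of parameters\<close>

text \<open>All the growth conditions on \<open>l\<close>, gathered with the constants fixed and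
  \<open>l\<close> a real variable, so that their eventual truth is settled at once by asymptotics
  in \<open>l\<close>.\<close>

definition large_log :: "real \<Rightarrow> real \<Rightarrow> real \<Rightarrow> real \<Rightarrow> real \<Rightarrow> real \<Rightarrow> bool" where
  "large_log C K1 \<delta> eta s l \<longleftrightarrow>
    2 \<le> ln (l / (120 * C)) \<and> (20 * C * l + 6) * l \<le> l ^ 3 \<and>
    2 + ln (4 * C * l ^ 8) \<le> 9 * (ln (9 * l / (120 * C)) - 1) \<and>
    ln l / 2 \<le> ln (4 * eta * l) - 1 - 1 / eta \<and>
    9/20 * l + 1 \<le> l / 2 - 3 * ln l \<and>
    180000 * C \<le> \<delta> * ln l / 4 \<and> 2 + 8000 * C / (\<delta> * ln l * l) \<le> ln (\<delta> * ln l / (48000 * C)) \<and>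
    930 \<le> \<delta> * l^2 \<and> 180000 * C \<le> \<delta> * l / 8 \<and> 2 + 496000 * C / \<delta>^2 \<le> ln (\<delta> * l / (96000 * C)) \<and>
    s ^ 2 * (1 / l + 600 * C / l + 3250 * K1 / ln l) \<le> 1 / 8 \<and>
    24000 * C * s ^ 3 \<le> ln l \<and>
    480 * C * s + 4800 * C * s ^ 2 * l / ln l \<le> l \<and>
    5 \<le> l \<and>
    2 * l + 3 \<le> (10 * l / ln l) * (ln (10 * l / ln l) - 1 - ln (400 * C^2)) \<and>
    0 \<le> ln (10 * l / ln l) - 1 - ln (400 * C^2) \<and>
    1 + ln (4 * C) + l / 2 + 2 * ln l \<le> l \<and>
    4 * C * l ^ 2 \<le> l ^ 10"

lemma eventually_large_log:
  assumes pos: "0 < C" "0 < K1" "0 < \<delta>" "0 < eta"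
  shows "eventually (large_log C K1 \<delta> eta s) at_top"
  unfolding large_log_def using pos by (intro eventually_conj) real_asymp+

lemma exp_minus_3: "exp (-3) \<le> (1 / 8 :: real)"
proof -
  have "(1 + 1 :: real) ^ 3 \<le> exp 1 ^ 3" by (intro power_mono exp_ge_add_one_self) auto
  also have "exp 1 ^ 3 = exp (3::real)" by (simp flip: exp_of_nat_mult)
  finally show ?thesis by (simp add: exp_minus divide_simps)
qed

text \<open>The common pattern of the union bounds below: at most \<open>exp x\<close> events, each
  of probability at most \<open>exp (- e * t)\<close>, where the margin 3 in the exponent produces
  the \<open>1/8\<close>.\<close>

lemma exp_power_le:
  fixes y e u x :: real
  assumes "0 \<le> y" "y \<le> exp (- e)" "0 \<le> e" "x \<le> e * real t - 3" "N \<le> exp x" "0 \<le> N"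
  shows "N * y ^ t \<le> 1 / 8"
proof -
  have "N * y ^ t \<le> exp x * exp (- e) ^ t" using assms by (intro mult_mono power_mono) auto
  also have "\<dots> = exp (x - e * real t)" by (simp add: exp_of_nat_mult[symmetric] exp_diff exp_minus mult.commute field_simps)
  also have "\<dots> \<le> exp (-3)" using assms(4) by simp
  also have "\<dots> \<le> 1 / 8" by (rule exp_minus_3)
  finally show ?thesis .
qed

text \<open>\<open>c0\<close> is the lower bound of \<open>column_success\<close> for
  \<open>m / Q \<ge> 1 / (5 * s)\<close>, and \<open>C\<close> is chosen so that
  \<open>c0 * M \<ge> 2 * B * l\<close>, twice what the union bound over \<open>m\<close>-sets could
  ever need.\<close>

lemma erdos_rogers_bound:
  fixes n s :: nat
  defines "c0 \<equiv> (1 / (5 * real s)) ^ s / 4"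
  defines "C \<equiv> 2 / c0"
  defines "K1 \<equiv> 14400 * C ^ 3 * exp 4" and "\<delta> \<equiv> 1 / (64 * real s ^ 2)"
  defines "eta \<equiv> \<delta> / (5 * K1)"
  defines "l \<equiv> ln (real n)" and "sn \<equiv> sqrt (real n)"
  assumes s: "3 \<le> s" and n: "l ^ 10 \<le> sn" and l: "large_log C K1 \<delta> eta (real s) l"
  shows "real (erdos_rogers s n) \<le> sn * l"
proof -
  note L = l[unfolded large_log_def]
  have l5: "5 \<le> l" using L by simp
  have l1: "1 \<le> l" using l5 by simp
  have sl5: "5 ^ 10 \<le> l ^ 10" using l5 by (intro power_mono) auto
  then have snbig: "9765625 \<le> sn" using n by simp
  have sn0: "0 < sn" using snbig by simp
  have npos: "0 < real n" using sn0 by (simp add: sn_def)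
  have nsq: "real n = sn * sn" by (simp add: sn_def)
  have lnsn: "ln sn = l / 2" using npos by (simp add: sn_def l_def ln_sqrt)
  have expl: "exp l = real n" using npos by (simp add: l_def)
  have sn_n: "sn \<le> real n" unfolding nsq using snbig by simp
  have g0: "0 < ln l" using l5 by (simp add: ln_gt_zero)
  have c0pos: "0 < c0" using s by (simp add: c0_def)
  have c0le: "c0 \<le> 1"
  proof -
    have "(1 / (5 * real s)) ^ s \<le> 1" using s by (intro power_le_one) (auto simp: divide_le_eq)
    then show ?thesis by (simp add: c0_def)
  qed
  have C2: "2 \<le> C" using c0pos c0le by (simp add: C_def le_divide_eq)
  have Cc: "c0 * C = 2" using c0pos by (simp add: C_def)
  define B where "B = nat \<lceil>sn * l\<rceil>"
  define m where "m = B div 4"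
  define M where "M = nat \<lceil>C * real B * l\<rceil>"
  have snl: "5 * sn \<le> sn * l" using l5 sn0 by simp
  have B: "sn * l \<le> real B" "real B \<le> sn * l + 1"
    using snl sn0 by (auto simp: B_def of_nat_nat ceiling_correct of_int_ceiling_le_add_one)
  have B15: "15 \<le> B" using B(1) snl snbig by linarith
  have m4: "4 * m \<le> B" by (simp add: m_def)
  have m5: "B \<le> 5 * m" using B15 unfolding m_def by linarith
  have m5r: "real B \<le> 5 * real m" using of_nat_mono[OF m5, where 'a = real] by simp
  have m4r: "4 * real m \<le> real B" using of_nat_mono[OF m4, where 'a = real] by simp
  have CBl0: "0 \<le> C * real B * l" using C2 l5 by simp
  have M: "C * real B * l \<le> real M" "real M \<le> C * real B * l + 1"
    using CBl0 by (auto simp: M_def of_nat_nat ceiling_correct of_int_ceiling_le_add_one)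
  have Cl10: "10 \<le> C * l" using mult_mono[OF C2 l5] C2 by simp
  have CBl1: "1 \<le> C * real B * l"
  proof -
    have "1 * 1 \<le> (C * l) * real B" using Cl10 B15 by (intro mult_mono) auto
    then show ?thesis by (simp add: mult_ac)
  qed
  have MCB: "real M \<le> 2 * C * l * real B" using M(2) CBl1 by (simp add: mult_ac)
  have B2: "real B \<le> 2 * (sn * l)" using B(2) snl snbig by linarith
  have Mle: "real M \<le> 4 * C * sn * l ^ 2"
  proof -
    have "2 * C * l * real B \<le> 2 * C * l * (2 * (sn * l))" using B2 C2 l5 by (intro mult_left_mono) auto
    then show ?thesis using MCB by (simp add: power2_eq_square mult_ac)
  qed
  have Mn: "real M \<le> real n"
  proof -
    have "4 * C * sn * l ^ 2 = (4 * C * l ^ 2) * sn" by simp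
    also have "\<dots> \<le> sn * sn" using L n sn0 by (intro mult_right_mono) auto
    finally show ?thesis using Mle nsq by simp
  qed
  have Mpos: "0 < M" using M(1) CBl1 by linarith
  have n2: "2 \<le> n" using sn_n snbig by linarith
  interpret random_columns n M B s
    by unfold_locales (use s B15 n2 Mn in auto)
  \<comment> \<open>Multiples of the means: a column has mean size
    \<open>n / B \<le> sn / l\<close>, and a vertex lies in \<open>M / B \<le> 2 * C * l\<close>
    columns on average. The codegrees have bounded mean, and \<open>ka\<close> is of the order of
    the maximum of n^2 such variables.\<close>
  define al where "al = 6 * sn / l"
  define d where "d = 20 * C * l"
  define ka where "ka = 10 * l / ln l"
  have al0: "0 \<le> al" and d0: "0 \<le> d" and ka0: "0 < ka"
    using sn0 l5 C2 g0 by (auto simp: al_def d_def ka_def)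
  have fl: "real (nat \<lfloor>x\<rfloor> + 1) \<le> x + 1" "x < real (nat \<lfloor>x\<rfloor> + 1)" if "0 \<le> x" for x :: real
    using that by (auto simp: of_nat_nat) linarith
  have lnM: "1 + ln (real M) \<le> l"
  proof -
    have "ln (real M) \<le> ln (4 * C * sn * l ^ 2)" using Mle Mpos by simp
    also have "\<dots> = ln (4 * C) + ln sn + 2 * ln l"
      using C2 sn0 l5 by (simp add: ln_mult ln_realpow)
    finally show ?thesis using L lnsn by simp
  qed
  have nB: "real n / real B \<le> sn / l"
  proof -
    have "real n / real B \<le> real n / (sn * l)" using B(1) B15 sn0 l5 by (intro divide_left_mono) auto
    then show ?thesis using sn0 by (simp add: nsq)
  qed
  have e3: "exp 1 \<le> (3::real)" by (rule exp_le)
  have T1: "real M * (exp 1 * (real n / real B) / real (nat \<lfloor>al\<rfloor> + 1)) ^ (nat \<lfloor>al\<rfloor> + 1) \<le> 1 / 8"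
  proof (rule exp_power_le[of _ "1 / 2" l])
    define t where "t = nat \<lfloor>al\<rfloor> + 1"
    have t: "al < real t" using fl(2)[OF al0] by (simp add: t_def)
    have t0: "0 < real t" using t al0 by linarith
    show "0 \<le> exp 1 * (real n / real B) / real (nat \<lfloor>al\<rfloor> + 1)" by simp
    have "exp 1 * (real n / real B) \<le> 3 * (sn / l)" using e3 nB sn0 l5 by (intro mult_mono) auto
    also have "\<dots> \<le> 1 / 2 * real t" using t by (simp add: al_def)
    finally have "exp 1 * (real n / real B) / real t \<le> 1 / 2" by (rule pos_divide_le_eq[OF t0, THEN iffD2])
    also have "(1 / 2 :: real) \<le> exp (- (1 / 2))"
    proof -
      have "exp (1 / 2) ^ 2 = exp (1::real)" by (simp flip: exp_of_nat_mult)
      also have "\<dots> \<le> 2 ^ 2" using e3 by simp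
      finally have "exp (1 / 2) \<le> (2::real)" by (rule power2_le_imp_le) simp
      then show ?thesis by (simp add: exp_minus divide_simps)
    qed
    finally show "exp 1 * (real n / real B) / real (nat \<lfloor>al\<rfloor> + 1) \<le> exp (- (1 / 2))" by (simp add: t_def)
    have "l ^ 9 * l \<le> sn" using n by (simp flip: power_Suc2)
    then have "l ^ 9 \<le> sn / l" using l5 by (simp add: le_divide_eq)
    moreover have "l \<le> l ^ 9" using l1 by (intro self_le_power) auto
    ultimately have "3 * l \<le> al / 2" by (simp add: al_def)
    then have "l \<le> 1 / 2 * real t - 3" using t l5 by linarith
    then show "l \<le> 1 / 2 * real (nat \<lfloor>al\<rfloor> + 1) - 3" unfolding t_def .
  qed (use Mn expl in auto)
  have T2: "real n * (exp 1 * (real M / real B) / real (nat \<lfloor>d\<rfloor> + 1)) ^ (nat \<lfloor>d\<rfloor> + 1) \<le> 1 / 8"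
  proof (rule exp_power_le[of _ 1 l])
    define t where "t = nat \<lfloor>d\<rfloor> + 1"
    have t: "d < real t" using fl(2)[OF d0] by (simp add: t_def)
    have t0: "0 < real t" using t d0 by linarith
    show "0 \<le> exp 1 * (real M / real B) / real (nat \<lfloor>d\<rfloor> + 1)" by simp
    have "real M / real B \<le> 2 * C * l" using MCB B15 by (simp add: divide_le_eq)
    then have "exp 1 * (real M / real B) \<le> 3 * (2 * C * l)" using e3 by (intro mult_mono) auto
    also have "\<dots> = 3 / 10 * d" by (simp add: d_def)
    also have "\<dots> \<le> 1 / 3 * real t" using t d0 by linarith
    finally have "exp 1 * (real M / real B) / real t \<le> 1 / 3" by (rule pos_divide_le_eq[OF t0, THEN iffD2])
    also have "(1 / 3 :: real) \<le> exp (- 1)" using e3 by (simp add: exp_minus divide_simps)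
    finally show "exp 1 * (real M / real B) / real (nat \<lfloor>d\<rfloor> + 1) \<le> exp (- 1)" by (simp add: t_def)
    have "2 * l \<le> C * l" using C2 l5 by (intro mult_right_mono) auto
    then have "40 * l \<le> d" by (simp add: d_def)
    then have "l \<le> 1 * real t - 3" using t l5 by linarith
    then show "l \<le> 1 * real (nat \<lfloor>d\<rfloor> + 1) - 3" unfolding t_def .
  qed (use expl in auto)
  \<comment> \<open>Given the columns of the two vertices, the mean is at most
    \<open>400 * C^2\<close>, so the tail exponent is about \<open>ka * ln ka\<close>, close to
    \<open>10 * l\<close>, against \<open>2 * l\<close> for the choice of the pair.\<close>
  have T3: "real n ^ 2 * (exp 1 * (real n * d ^ 2 / real B ^ 2) / real (nat \<lfloor>ka\<rfloor> + 1)) ^ (nat \<lfloor>ka\<rfloor> + 1) \<le> 1 / 8"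
  proof (rule exp_power_le[of _ "ln ka - 1 - ln (400 * C^2)" "2 * l"])
    define t where "t = nat \<lfloor>ka\<rfloor> + 1"
    have t: "ka < real t" using fl(2)[of ka] ka0 by (simp add: t_def)
    show "0 \<le> exp 1 * (real n * d ^ 2 / real B ^ 2) / real (nat \<lfloor>ka\<rfloor> + 1)" by simp
    have "real n * d ^ 2 / real B ^ 2 \<le> real n * d ^ 2 / (sn * l) ^ 2"
      using B(1) B15 sn0 l5 by (intro divide_left_mono power_mono mult_pos_pos) auto
    also have "\<dots> = 400 * C ^ 2" using sn0 l5 by (simp add: nsq d_def power2_eq_square)
    finally have "exp 1 * (real n * d ^ 2 / real B ^ 2) / real t \<le> exp 1 * (400 * C ^ 2) / ka"
      using t ka0 by (intro frac_le mult_left_mono) auto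
    also have "\<dots> = exp (- (ln ka - 1 - ln (400 * C^2)))"
      using ka0 C2 by (simp add: exp_diff exp_add)
    finally show "exp 1 * (real n * d ^ 2 / real B ^ 2) / real (nat \<lfloor>ka\<rfloor> + 1) \<le> exp (- (ln ka - 1 - ln (400 * C^2)))"
      by (simp add: t_def)
    show e0: "0 \<le> ln ka - 1 - ln (400 * C^2)" using L by (simp add: ka_def)
    have "2 * l + 3 \<le> (ln ka - 1 - ln (400 * C^2)) * ka" using L by (simp add: ka_def mult.commute)
    also have "\<dots> \<le> (ln ka - 1 - ln (400 * C^2)) * real t" using e0 t by (intro mult_left_mono) auto
    finally show "2 * l \<le> (ln ka - 1 - ln (400 * C^2)) * real (nat \<lfloor>ka\<rfloor> + 1) - 3" by (simp add: t_def)
    have "exp (2 * l) = real n ^ 2" unfolding expl[symmetric] by (simp flip: exp_of_nat_mult)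
    then show "real n ^ 2 \<le> exp (2 * l)" by simp
  qed simp
  have sets: "real (n choose m) * (1 - (real m / real (s * B)) ^ s / 4) ^ M \<le> 1 / 8"
  proof (rule exp_power_le[of _ c0 "real m * l"])
    have q: "0 \<le> real m / real (s * B)" "1 / (5 * real s) \<le> real m / real (s * B)" "real m / real (s * B) \<le> 1"
    proof -
      show "0 \<le> real m / real (s * B)" by simp
      have sB: "0 < real s * real B" using s B15 by simp
      have "real s * real B \<le> real s * (5 * real m)" using m5r by (intro mult_left_mono) auto
      then show "1 / (5 * real s) \<le> real m / real (s * B)" using s B15 by (simp add: divide_simps mult_ac)
      have "1 * real m \<le> real s * real B" using s m4r by (intro mult_mono) auto
      then show "real m / real (s * B) \<le> 1" using sB by (simp add: divide_le_eq)
    qed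
    have "(real m / real (s * B)) ^ s \<le> 1" using q by (intro power_le_one) auto
    then show "0 \<le> 1 - (real m / real (s * B)) ^ s / 4" by simp
    have "(1 / (5 * real s)) ^ s \<le> (real m / real (s * B)) ^ s" using q by (intro power_mono) auto
    then have "1 - (real m / real (s * B)) ^ s / 4 \<le> 1 - c0" by (simp add: c0_def)
    also have "\<dots> \<le> exp (- c0)" using exp_ge_add_one_self[of "- c0"] by simp
    finally show "1 - (real m / real (s * B)) ^ s / 4 \<le> exp (- c0)" .
    show "0 \<le> c0" using c0pos by simp
    \<comment> \<open>One \<open>B * l\<close> pays for the choice of the set, since
      \<open>m \<le> B\<close>; the other exceeds 3 and gives the factor \<open>1/8\<close>.\<close>
    have "2 * (real B * l) = c0 * (C * real B * l)" using Cc by (simp add: mult.assoc[symmetric])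
    also have "\<dots> \<le> c0 * real M" using M(1) c0pos by (intro mult_left_mono) auto
    finally have "2 * (real B * l) \<le> c0 * real M" .
    moreover have "real m * l \<le> real B * l" using m4r l5 by (intro mult_right_mono) auto
    moreover have "3 \<le> real B * l"
    proof -
      have "3 * 1 \<le> real B * l" using B15 l1 by (intro mult_mono) auto
      then show ?thesis by simp
    qed
    ultimately show "real m * l \<le> c0 * real M - 3" by linarith
    have "(n choose m) * 1 \<le> (n choose m) * fact m" by (intro mult_left_mono) (auto simp: Suc_le_eq)
    also have "\<dots> \<le> n ^ m" by (rule binomial_fact_pow)
    finally have "n choose m \<le> n ^ m" by simp
    from of_nat_mono[OF this, where 'a = real] have "real (n choose m) \<le> real n ^ m" by simp
    also have "\<dots> = exp (real m * l)" unfolding expl[symmetric] by (simp add: exp_of_nat_mult)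
    finally show "real (n choose m) \<le> exp (real m * l)" .
  qed simp
  have big: "exp 1 ^ 2 / real n ^ 3 \<le> 1 / 8" "exp 1 / real n ^ 2 \<le> 1 / 8"
  proof -
    have n100: "100 \<le> real n" using sn_n snbig by linarith
    have "(exp 1 :: real) ^ 2 \<le> 3 ^ 2" using e3 by (intro power_mono) auto
    then have "exp 1 ^ 2 / real n ^ 3 \<le> 3 ^ 2 / 100 ^ 3"
      using power_mono[OF n100, of 3] by (intro frac_le) auto
    then show "exp 1 ^ 2 / real n ^ 3 \<le> 1 / 8" by (rule order_trans) simp
    have "exp 1 / real n ^ 2 \<le> 3 / 100 ^ 2"
      using power_mono[OF n100, of 2] e3 by (intro frac_le) auto
    then show "exp 1 / real n ^ 2 \<le> 1 / 8" by (rule order_trans) simp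
  qed
  have slm: "sn * l \<le> 5 * real m" using B(1) m5r by linarith
  have m5': "5 \<le> m" using slm snl snbig by linarith
  have C1: "1 \<le> C" and lgt: "1 < l" and ka0': "0 \<le> ka" and leq: "l = ln (real n)"
    using C2 l5 ka0 by (auto simp: l_def)
  have suc: "1 \<le> k + 1" for k :: nat by simp
  obtain w where tp: "typical n M B m (A w) C sn l al d ka"
    and w: "\<And>S. S \<subseteq> {..<n} \<Longrightarrow> card S = m \<Longrightarrow> \<exists>i<M. healthy n B s S i w \<longrightarrow> makes_clique n s S i w"
    using exists_typical[OF C1 sn0 lgt al_def d_def ka0' B(1) m4 slm Mle lnM Mpos m5' leq
      fl(1)[OF al0] suc T1 fl(1)[OF d0] suc T2 fl(1)[OF ka0'] suc T3 big sets]
    by blast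
  have "\<exists>i<M. makes_clique n s S i w" if S: "S \<subseteq> {..<n}" "card S = m" for S
  proof -
    obtain i where i: "i < M" "healthy n B s S i w \<longrightarrow> makes_clique n s S i w" using w[OF S] by blast
    \<comment> \<open>Typicality of the full labelling gives health at whatever stage
      \<open>i\<close> was supplied, so the implication obtained for \<open>i\<close> yields a
      clique.\<close>
    have "real m ^ s \<le> 2 * real (card {u. good_tuple (A w) i s S u \<and> 4 * card (blockers (A w) i s u) \<le> B})"
      by (rule typical.all_good[OF tp s K1_def[THEN meta_eq_to_obj_eq] \<delta>_def[THEN meta_eq_to_obj_eq]
        eta_def[THEN meta_eq_to_obj_eq] ka_def lnsn n _ _ _ _ _ _ _ _ _ _ _ _ _ _ S less_imp_le[OF i(1)]])
        (use L in blast)+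
    then have "healthy n B s S i w" unfolding healthy_def admissible_def using S by simp
    then show ?thesis using i by blast
  qed
  from graph_from_labelling[OF s this]
  obtain E where "simple_graph n E" "Kfree E {0..<n} (s + 1)" "\<And>S. S \<subseteq> {0..<n} \<Longrightarrow> card S = m \<Longrightarrow> \<not> Kfree E S s"
    by blast
  then have "erdos_rogers s n \<le> m" using s by (intro erdos_rogers_le) auto
  then have "real (erdos_rogers s n) \<le> real m" by simp
  also have "\<dots> \<le> sn * l" using m4r B2 sn0 l5 by (smt (verit) mult_pos_pos)
  finally show ?thesis .
qed

theorem theorem1p1:
  fixes s :: nat
  assumes "s \<ge> 3"
  shows "(\<lambda>n. real (erdos_rogers s n)) \<in> O(\<lambda>n. sqrt (real n) * ln (real n))"
proof -
  define c0 where "c0 = (1 / (5 * real s)) ^ s / 4"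
  define C where "C = 2 / c0"
  define K1 where "K1 = 14400 * C ^ 3 * exp 4"
  define \<delta> where "\<delta> = 1 / (64 * real s ^ 2)"
  define eta where "eta = \<delta> / (5 * K1)"
  have pos: "0 < C" "0 < K1" "0 < \<delta>" "0 < eta"
    using assms by (auto simp: c0_def C_def K1_def \<delta>_def eta_def)
  have "filterlim (\<lambda>n. ln (real n)) at_top sequentially" by real_asymp
  then have "eventually (\<lambda>n. large_log C K1 \<delta> eta (real s) (ln (real n))) sequentially"
    using eventually_large_log[OF pos] by (simp add: filterlim_iff)
  moreover have "eventually (\<lambda>n. ln (real n) ^ 10 \<le> sqrt (real n)) sequentially" by real_asymp
  ultimately have "eventually (\<lambda>n. norm (real (erdos_rogers s n)) \<le> 1 * norm (sqrt (real n) * ln (real n))) sequentially"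
  proof eventually_elim
    case (elim n)
    then have "real (erdos_rogers s n) \<le> sqrt (real n) * ln (real n)"
      unfolding eta_def K1_def \<delta>_def C_def c0_def by (intro erdos_rogers_bound[OF assms])
    then show ?case by simp
  qed
  then show ?thesis by (rule bigoI)
qed

end
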